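(* There exists a homeomorphism $f:\mathbb{T}^2\to\mathbb{T}^2$ of the torus $\mathbb{T}^2$ that is $cw2$-expansive, has a $1$-prong, and is not $N$-expansive for any integer $N\ge1$.
   Context: Let $X$ be a compact metric space with metric $d$ and $f:X\to X$ a homeomorphism. A continuum is a nonempty compact connected set. For an integer $N\ge1$: - $f$ is $cwN$-expansive if there is $\alpha>0$ such that whenever $A,B\subset X$ are continua with $\operatorname{diam}(f^k(A))\le\alpha$ for all $k\ge0$ and $\operatorname{diam}(f^k(B))\le\alpha$ for all $k\le0$, the set $A\cap B$ has at most $N$ elements ($cw2$-expansive is the case $N=2$). - $f$ is $N$-expansive if there exists $\alpha>0$ such that for all $x\in X$ the set $\Gamma_\alpha(x)=\{y\in X : d(f^k(x),f^k(y))\le\alpha \text{ for all } k\in\mathbb{Z}\}$ has at most $N$ elements. A $1$-prong of a homeomorphism $f$ of a surface is a point $p$ whose local stable set and local unstable set are both arcs finishing at $p$ (that is, arcs having $p$ as an endpoint); here, for small $\varepsilon>0$, the local stable set of $p$ is $\{y : d(f^k(p),f^k(y))\le\varepsilon \text{ for all } k\ge0\}$ and the local unstable set of $p$ is $\{y : d(f^k(p),f^k(y))\le\varepsilon \text{ for all } k\le0\}$. The torus carries a metric inducing its topology. *)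

theory Defs
  imports "HOL-Analysis.Analysis"
begin

text \<open>
  Dynamics of a homeomorphism of a subset \<open>X\<close> of a metric space, with the induced metric
  \<open>dist\<close>. Maps are total functions on the ambient type; only their values on \<open>X\<close> matter.
\<close>

definition iterate :: "'a set \<Rightarrow> ('a \<Rightarrow> 'a) \<Rightarrow> int \<Rightarrow> 'a \<Rightarrow> 'a" where
  "iterate X f k = (if k \<ge> 0 then f ^^ nat k else inv_into X f ^^ nat (- k))"

definition continuum :: "'a::topological_space set \<Rightarrow> bool" where
  "continuum A \<longleftrightarrow> A \<noteq> {} \<and> compact A \<and> connected A"

definition cw_expansive :: "nat \<Rightarrow> 'a::metric_space set \<Rightarrow> ('a \<Rightarrow> 'a) \<Rightarrow> bool" where
  "cw_expansive N X f \<longleftrightarrow>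
     (\<exists>\<alpha>>0. \<forall>A B. A \<subseteq> X \<and> B \<subseteq> X \<and> continuum A \<and> continuum B \<and>
        (\<forall>k\<ge>0. diameter (iterate X f k ` A) \<le> \<alpha>) \<and>
        (\<forall>k\<le>0. diameter (iterate X f k ` B) \<le> \<alpha>) \<longrightarrow>
        finite (A \<inter> B) \<and> card (A \<inter> B) \<le> N)"

definition dynamical_ball :: "'a::metric_space set \<Rightarrow> ('a \<Rightarrow> 'a) \<Rightarrow> real \<Rightarrow> 'a \<Rightarrow> 'a set" where
  "dynamical_ball X f \<alpha> x = {y \<in> X. \<forall>k. dist (iterate X f k x) (iterate X f k y) \<le> \<alpha>}"

definition expansive :: "nat \<Rightarrow> 'a::metric_space set \<Rightarrow> ('a \<Rightarrow> 'a) \<Rightarrow> bool" where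
  "expansive N X f \<longleftrightarrow>
     (\<exists>\<alpha>>0. \<forall>x\<in>X. finite (dynamical_ball X f \<alpha> x) \<and> card (dynamical_ball X f \<alpha> x) \<le> N)"

definition local_stable :: "'a::metric_space set \<Rightarrow> ('a \<Rightarrow> 'a) \<Rightarrow> real \<Rightarrow> 'a \<Rightarrow> 'a set" where
  "local_stable X f \<epsilon> p = {y \<in> X. \<forall>k\<ge>0. dist (iterate X f k p) (iterate X f k y) \<le> \<epsilon>}"

definition local_unstable :: "'a::metric_space set \<Rightarrow> ('a \<Rightarrow> 'a) \<Rightarrow> real \<Rightarrow> 'a \<Rightarrow> 'a set" where
  "local_unstable X f \<epsilon> p = {y \<in> X. \<forall>k\<le>0. dist (iterate X f k p) (iterate X f k y) \<le> \<epsilon>}"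

text \<open>Since \<open>arc\<close> demands injectivity on the unit interval, the arcs below are nondegenerate.\<close>

definition arc_from :: "'a::topological_space \<Rightarrow> 'a set \<Rightarrow> bool" where
  "arc_from p S \<longleftrightarrow> (\<exists>\<gamma>. arc \<gamma> \<and> pathstart \<gamma> = p \<and> path_image \<gamma> = S)"

text \<open>The condition is imposed for every sufficiently small \<open>\<epsilon>\<close>.\<close>

definition one_prong :: "'a::metric_space set \<Rightarrow> ('a \<Rightarrow> 'a) \<Rightarrow> 'a \<Rightarrow> bool" where
  "one_prong X f p \<longleftrightarrow> p \<in> X \<and>
     (\<exists>\<epsilon>\<^sub>0>0. \<forall>\<epsilon>. 0 < \<epsilon> \<and> \<epsilon> \<le> \<epsilon>\<^sub>0 \<longrightarrow>
        arc_from p (local_stable X f \<epsilon> p) \<and> arc_from p (local_unstable X f \<epsilon> p))"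

text \<open>
  The torus is the product of two unit circles, with the metric inherited from the Euclidean
  metric of \<open>complex \<times> complex\<close>.
\<close>

definition torus :: "(complex \<times> complex) set" where
  "torus = sphere 0 1 \<times> sphere 0 1"

end

theory Submission
  imports Defs
begin

text \<open>
  The pillowcase, the quotient of a torus by \<open>- 1\<close>, carries the homeomorphism induced by the
  hyperbolic matrix with rows \<open>(8, 1)\<close> and \<open>(1, 0)\<close>. It permutes four regular points, and the double
  cover branched over these is again a torus, to which the homeomorphism lifts: the matrix is a
  reflection followed by a horizontal shear, and upstairs the shear is a Dehn twist in each of two
  cylinders. Stable and unstable continua are pieces of leaves. A stable and an unstable leaf piece meet
  twice only near a cone point, where the cover is injective, and otherwise once downstairs, hence at most
  twice upstairs. The eight lifts of cone points are 1-prongs. Orbits making many homoclinic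
  excursions from a cone point can be shadowed with independent signs for the excursions, so dynamical
  balls have arbitrarily many points.
\<close>

section \<open>Slit cylinders\<close>

text \<open>The cone points are not branch points, so near each of their lifts the torus still looks
  like the plane modulo -1. The stable line through such a point is folded in half, and this leaves
  a single prong. The same folding governs the other two properties: near a cone point the sign of a
  lift to the plane can be lost. For one orbit this loss is what permits independent signs. For a
  small continuum connectedness forbids it, and the linear product structure survives. The second
  ambiguity, the sheet of the double cover, is harmless as long as an orbit keeps away from the
  branch points. The homoclinic orbit must therefore avoid them, which a parity argument shows. The
  entry 8 of the matrix is the circumference of the cylinders: a full turn is the identity on the
  boundary circle, where the two cylinders are glued. As the torus is literally a product of
  circles, the gluing is done in explicit piecewise linear angles; the pillowcase is embedded in
  three-space so that closeness there needs no quotient topology.\<close>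

text \<open>The triangle wave of period 8 and amplitude 2. With \<open>arcsin\<close> continuity and
  periodicity come for free, and (\<open>tri x\<close>, \<open>tri (x + 2)\<close>) runs once around
  the boundary of the diamond in each period.\<close>

definition tri :: "real \<Rightarrow> real" where
  "tri x = 4 / pi * arcsin (sin (pi * x / 4))"

lemma sin_tri: "sin (pi * tri x / 4) = sin (pi * x / 4)"
  by (simp add: tri_def)

lemma tri_bounds: "- 2 \<le> tri x" "tri x \<le> 2"
  using arcsin_bounded[of "sin (pi * x / 4)"]
  by (auto simp: tri_def field_simps)

lemma tri_id: "\<bar>x\<bar> \<le> 2 \<Longrightarrow> tri x = x"
proof -
  assume "\<bar>x\<bar> \<le> 2"
  then have "-2 \<le> x" "x \<le> 2" by auto
  then have "arcsin (sin (pi * x / 4)) = pi * x / 4"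
    using mult_left_mono[of "-2" x pi] mult_left_mono[of x 2 pi]
    by (intro arcsin_sin) (simp_all add: field_simps)
  then show ?thesis unfolding tri_def by (simp only:) simp
qed

lemma tri_add4 [simp]: "tri (x + 4) = - tri x"
proof -
  have "sin (pi * (x + 4) / 4) = - sin (pi * x / 4)"
    using sin_periodic_pi[of "pi * x / 4"] by (simp add: algebra_simps add_divide_distrib)
  then show ?thesis by (simp add: tri_def arcsin_minus)
qed

lemma tri_minus [simp]: "tri (- x) = - tri x"
  by (simp add: tri_def arcsin_minus)

text \<open>A shift by 2 is a quarter turn and exchanges sine and cosine up to sign; the arcsines of
  their absolute values are complementary angles.\<close>

lemma tri_sum: "\<bar>tri x\<bar> + \<bar>tri (x + 2)\<bar> = 2"
proof -
  define a where "a = arcsin (sin (pi * x / 4))"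
  have a: "- (pi/2) \<le> a" "a \<le> pi/2" using arcsin_bounded[of "sin (pi * x / 4)"] by (auto simp: a_def)
  have sa: "sin a = sin (pi * x / 4)" by (simp add: a_def)
  have "cos a \<ge> 0" using a by (simp add: cos_ge_zero)
  moreover have "(cos a)\<^sup>2 = (cos (pi * x / 4))\<^sup>2" using sa by (simp add: cos_squared_eq)
  ultimately have ca: "cos a = \<bar>cos (pi * x / 4)\<bar>"
    by (auto intro!: power2_eq_imp_eq[of "cos a"])
  have e: "pi * (x + 2) / 4 = pi * x / 4 + pi/2" by (simp add: field_simps)
  have s2: "sin (pi * (x + 2) / 4) = cos (pi * x / 4)"
    unfolding e by (simp add: sin_add)
  have "\<bar>arcsin (cos (pi * x / 4))\<bar> = arcsin \<bar>cos (pi * x / 4)\<bar>"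
  proof (cases "cos (pi * x / 4) \<ge> 0")
    case True
    then have "arcsin (cos (pi * x / 4)) \<ge> 0"
      using arcsin_le_arcsin[of 0 "cos (pi * x / 4)"] by simp
    then show ?thesis using True by simp
  next
    case False
    then have "arcsin (- cos (pi * x / 4)) \<ge> 0"
      using arcsin_le_arcsin[of 0 "- cos (pi * x / 4)"] by (simp add: minus_le_iff)
    then show ?thesis using False arcsin_minus[of "cos (pi * x / 4)"] by simp
  qed
  also have "\<dots> = arcsin (sin (pi/2 - \<bar>a\<bar>))" using ca by (simp add: sin_diff)
  also have "\<dots> = pi/2 - \<bar>a\<bar>" using a by (intro arcsin_sin) auto
  finally show ?thesis
    unfolding tri_def s2 a_def[symmetric] by (simp add: abs_mult field_simps)
qed

text \<open>This and \<open>sin_tri2\<close> express the pillowcase coordinates through the position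
  on the diamond alone. That is what makes them well defined on the torus.\<close>

lemma cos_tri: "cos (pi * x / 2) = cos (pi * tri x / 2)"
proof -
  have "cos (pi * x / 2) = 1 - 2 * (sin (pi * x / 4))\<^sup>2" for x
    using cos_double_sin[of "pi * x / 4"] by (simp add: field_simps)
  then show ?thesis by (metis sin_tri)
qed

lemma sin_tri2: "sin (pi * x / 2) = 2 * sin (pi * tri x / 4) * sin (pi * tri (x + 2) / 4)"
proof -
  have e: "pi * (x + 2) / 4 = pi * x / 4 + pi/2" by (simp add: field_simps)
  have "sin (pi * (x + 2) / 4) = cos (pi * x / 4)"
    unfolding e by (simp add: sin_add)
  then show ?thesis
    using sin_double[of "pi * x / 4"] by (simp add: sin_tri)
qed

text \<open>The two values fix the sine and the cosine of \<open>pi * x / 4\<close>, hence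
  \<open>x\<close> modulo the period 8.\<close>

lemma tri_eq_shift:
  assumes "tri x = tri x'" "tri (x + 2) = tri (x' + 2)"
  shows "tri (x + d) = tri (x' + d)"
proof -
  have s: "sin (pi * x / 4) = sin (pi * x' / 4)" using assms(1) sin_tri by metis
  have e: "pi * (x + 2) / 4 = pi * x / 4 + pi/2" for x :: real by (simp add: field_simps)
  have "sin (pi * x / 4 + pi/2) = sin (pi * x' / 4 + pi/2)"
    using assms(2) sin_tri[of "x+2"] sin_tri[of "x'+2"] by (simp add: e)
  then have c: "cos (pi * x / 4) = cos (pi * x' / 4)" by (simp add: sin_add)
  have e: "pi * (x + d) / 4 = pi * x / 4 + pi*d/4" for x :: real by (simp add: field_simps)
  show ?thesis unfolding tri_def e sin_add using s c by simp
qed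

lemma tri_onto:
  assumes "\<bar>s\<bar> + \<bar>t\<bar> = 2"
  shows "\<exists>x. tri x = s \<and> tri (x + 2) = t"
proof -
  have "tri (s + 2) = 2 - \<bar>s\<bar>" if "\<bar>s\<bar> \<le> 2" for s
  proof (cases "s \<le> 0")
    case True then show ?thesis using that by (simp add: tri_id)
  next
    case False
    then have "tri (s - 2) = s - 2" using that by (simp add: tri_id)
    moreover have "tri (s + 2) = - tri (s - 2)" using tri_add4[of "s - 2"] by (simp add: algebra_simps)
    ultimately show ?thesis using False by simp
  qed
  note t2 = this
  have s2: "\<bar>s\<bar> \<le> 2" using assms by auto
  show ?thesis
  proof (cases "t \<ge> 0")
    case True
    then show ?thesis using t2[OF s2] s2 assms tri_id by (intro exI[of _ s]) auto
  next
    case False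
    have "tri (- s + 4) = s" using tri_add4[of "-s"] s2 by (simp add: tri_id)
    moreover have "tri (- s + 4 + 2) = t" using tri_add4[of "-s+2"] t2[of "-s"] s2 assms False
      by (simp add: add.commute add.left_commute)
    ultimately show ?thesis by blast
  qed
qed

lemma continuous_tri [continuous_intros]:
  fixes f :: "'a::metric_space \<Rightarrow> real"
  shows "continuous_on S f \<Longrightarrow> continuous_on S (\<lambda>x. tri (f x))"
proof -
  assume f: "continuous_on S f"
  have "continuous_on S (\<lambda>x. sin (pi * f x / 4))"
    using f by (intro continuous_intros) auto
  then have "continuous_on S (\<lambda>x. arcsin (sin (pi * f x / 4)))"
    by (rule continuous_on_arcsin) auto
  then show ?thesis unfolding tri_def by (rule continuous_on_mult_left)
qed

text \<open>
  For \<open>0 \<le> y \<le> 1\<close> and \<open>\<bar>s\<bar> + \<bar>t\<bar> = 2\<close> the points \<open>(gap s y, gap t y)\<close> trace, with \<open>y\<close> fixed, the level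
  curve of height \<open>y\<close> in the diamond \<open>\<bar>a\<bar> + \<bar>b\<bar> \<le> 2\<close>: the boundary of the diamond for \<open>y = 1\<close>, and
  for \<open>y = 0\<close> the plus sign \<open>a * b = 0\<close>, \<open>\<bar>a\<bar> + \<bar>b\<bar> \<le> 1\<close>, run through twice.
\<close>

definition gap :: "real \<Rightarrow> real \<Rightarrow> real" where
  "gap t y = max (- y) (min y t) + max 0 (t - 1) + min 0 (t + 1)"

lemma gap_minus [simp]: "0 \<le> y \<Longrightarrow> gap (- t) y = - gap t y"
  by (auto simp: gap_def min_def max_def)

lemma gap_1: "\<bar>t\<bar> \<le> 2 \<Longrightarrow> gap t 1 = t"
  by (auto simp: gap_def min_def max_def)

lemma gap_sum_le:
  assumes "\<bar>s\<bar> + \<bar>t\<bar> = 2" "0 \<le> y" "y \<le> 1"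
  shows "\<bar>gap s y\<bar> + \<bar>gap t y\<bar> \<le> 1 + y"
  using assms by (auto simp: gap_def min_def max_def abs_if split: if_splits)

text \<open>Height and absolute position can be read off from the absolute values of the two gaps:
  \<open>lev\<close> and \<open>hor\<close> are the inverse formulas. Signs are recovered only at
  positive height, because at height 0 the two sides of the slit are zipped together.\<close>

lemma gap_inj:
  assumes "\<bar>s\<bar> + \<bar>t\<bar> = 2" "0 \<le> y" "y \<le> 1" "\<bar>s'\<bar> + \<bar>t'\<bar> = 2" "0 \<le> y'" "y' \<le> 1"
    and "gap s y = gap s' y'" "gap t y = gap t' y'"
  shows "y = y' \<and> \<bar>s\<bar> = \<bar>s'\<bar> \<and> (y > 0 \<longrightarrow> s = s' \<and> t = t')"
proof -
  define lev where "lev a b = (if \<bar>a\<bar> \<ge> 1 \<or> \<bar>b\<bar> \<ge> 1 then \<bar>a\<bar> + \<bar>b\<bar> - 1 else min \<bar>a\<bar> \<bar>b\<bar>)" for a b :: real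
  define hor where "hor a b = (if \<bar>b\<bar> \<ge> \<bar>a\<bar> then 1 + lev a b - \<bar>b\<bar> else 1 - lev a b + \<bar>a\<bar>)" for a b :: real
  have abs: "\<bar>gap s y\<bar> = min \<bar>s\<bar> y + max 0 (\<bar>s\<bar> - 1)" if "0 \<le> y" for s y
    using that by (auto simp: gap_def min_def max_def abs_if)
  have sg: "sgn (gap s y) = sgn s" if "0 < y" for s y
    using that by (auto simp: gap_def min_def max_def sgn_if)
  have lev: "lev (gap s y) (gap t y) = y \<and> hor (gap s y) (gap t y) = \<bar>s\<bar>"
    if "\<bar>s\<bar> + \<bar>t\<bar> = 2" "0 \<le> y" "y \<le> 1" for s t y
    using that unfolding lev_def hor_def abs[OF that(2)]
    by (smt (verit))
  have y: "y = y'" and s: "\<bar>s\<bar> = \<bar>s'\<bar>" using lev[OF assms(1-3)] lev[OF assms(4-6)] assms(7,8) by metis+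
  moreover have "s = s' \<and> t = t'" if "y > 0"
  proof -
    have "sgn s = sgn s'" "sgn t = sgn t'" using sg that y assms(7,8) by metis+
    moreover have "\<bar>t\<bar> = \<bar>t'\<bar>" using s assms by linarith
    ultimately show ?thesis using s by (metis abs_sgn mult_sgn_abs)
  qed
  ultimately show ?thesis by blast
qed

lemma gap_onto:
  assumes "\<bar>a\<bar> + \<bar>b\<bar> \<le> 2"
  shows "\<exists>s t y. \<bar>s\<bar> + \<bar>t\<bar> = 2 \<and> 0 \<le> y \<and> y \<le> 1 \<and> gap s y = a \<and> gap t y = b"
proof -
  define sg where "sg x = (if x \<ge> 0 then 1 else - 1 :: real)" for x :: real
  \<comment> \<open>By symmetry the first coordinate may be taken as the smaller one. The witnesses
    invert \<open>gap\<close> separately outside and inside the square of half side 1.\<close>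
  have main: "\<exists>s t y. \<bar>s\<bar> + \<bar>t\<bar> = 2 \<and> 0 \<le> y \<and> y \<le> 1 \<and> gap s y = a \<and> gap t y = b"
    if "\<bar>a\<bar> + \<bar>b\<bar> \<le> 2" "\<bar>a\<bar> \<le> \<bar>b\<bar>" for a b
  proof (cases "\<bar>b\<bar> \<ge> 1")
    case True
    show ?thesis
      by (rule exI[of _ a], rule exI[of _ "sg b * (2 - \<bar>a\<bar>)"], rule exI[of _ "\<bar>a\<bar> + \<bar>b\<bar> - 1"])
        (use that True in \<open>auto simp: sg_def gap_def min_def max_def abs_if split: if_splits\<close>)
  next
    case False
    show ?thesis
      by (rule exI[of _ "sg a * (1 + \<bar>a\<bar> - \<bar>b\<bar>)"], rule exI[of _ "sg b * (1 - \<bar>a\<bar> + \<bar>b\<bar>)"], rule exI[of _ "\<bar>a\<bar>"])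
        (use that False in \<open>auto simp: sg_def gap_def min_def max_def abs_if split: if_splits\<close>)
  qed
  show ?thesis
  proof (cases "\<bar>a\<bar> \<le> \<bar>b\<bar>")
    case True then show ?thesis using main assms by blast
  next
    case False
    then obtain s t y where "\<bar>s\<bar> + \<bar>t\<bar> = 2" "0 \<le> y" "y \<le> 1" "gap s y = b" "gap t y = a"
      using main[of b a] assms by auto
    then show ?thesis by (metis add.commute)
  qed
qed

lemma cis_quarter_eq:
  assumes "cis (pi / 2 * a) = cis (pi / 2 * b)"
  obtains n :: int where "a = b + 4 * of_int n"
proof -
  have "sin (pi / 2 * a) = sin (pi / 2 * b) \<and> cos (pi / 2 * a) = cos (pi / 2 * b)"
    using assms by (metis cis.sel)
  then obtain n :: int where "pi / 2 * a = pi / 2 * b + 2 * pi * of_int n"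
    using sin_cos_eq_iff[of "pi / 2 * a" "pi / 2 * b"] by blast
  then have "pi * a = pi * (b + 4 * of_int n)" by (simp add: algebra_simps)
  then have "a = b + 4 * of_int n" by simp
  then show thesis by (rule that)
qed

lemma cis_quarter_add2: "cis (pi / 2 * (a + 2)) = - cis (pi / 2 * a)"
  by (simp add: distrib_left flip: cis_mult)

lemma cis_quarter_eq_bounded:
  assumes "cis (pi / 2 * a) = cis (pi / 2 * b)" "\<bar>a\<bar> \<le> 2" "\<bar>b\<bar> \<le> 2"
  shows "a = b \<or> \<bar>a\<bar> = 2 \<and> b = - a"
proof -
  obtain n :: int where n: "a = b + 4 * of_int n" using cis_quarter_eq[OF assms(1)] .
  then have "\<bar>real_of_int n\<bar> \<le> 1" using assms(2,3) by linarith
  then have "n = -1 \<or> n = 0 \<or> n = 1" by linarith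
  then show ?thesis using n assms(2,3) by auto
qed

lemma cis_quarter_opp_bounded:
  assumes "cis (pi / 2 * a) = - cis (pi / 2 * b)" "\<bar>a\<bar> \<le> 2" "\<bar>b\<bar> \<le> 2"
  shows "a = b + 2 \<or> a = b - 2"
proof -
  have "cis (pi / 2 * a) = cis (pi / 2 * (b + 2))"
    using assms(1) cis_quarter_add2[of b] by simp
  then obtain n :: int where n: "a = (b + 2) + 4 * of_int n" by (rule cis_quarter_eq)
  then have "real_of_int n > -2" "real_of_int n < 1" using assms(2,3) by linarith+
  then have "n = -1 \<or> n = 0" by linarith
  then show ?thesis using n by auto
qed

text \<open>
  The torus is parametrised with period 4 in each angle. It is the union of two diamonds, centred at
  the angles \<open>(0, 0)\<close> (\<open>s = 1\<close>) and \<open>(2, 2)\<close> (\<open>s = - 1\<close>); \<open>cyl s\<close> is the quotient map from the cylinder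
  with circumference 8 and height 1 onto the diamond, which zips the bottom circle into the plus sign.
\<close>

definition cyl :: "real \<Rightarrow> real \<Rightarrow> real \<Rightarrow> complex \<times> complex" where
  "cyl s x y = (s *\<^sub>R cis (pi / 2 * gap (tri x) y), s *\<^sub>R cis (pi / 2 * gap (tri (x + 2)) y))"

definition chart :: "real \<Rightarrow> real \<Rightarrow> bool" where
  "chart s y \<longleftrightarrow> (s = 1 \<or> s = -1) \<and> 0 \<le> y \<and> y \<le> 1"

text \<open>
  The pillowcase \<open>\<real>\<^sup>2 / (\<plusminus> 1, 4 \<int>\<^sup>2)\<close> is embedded in \<open>\<real>\<^sup>3\<close> by
  \<open>(x, y) \<mapsto> (cos (\<pi> x / 2), cos (\<pi> y / 2), sin (\<pi> x / 2) sin (\<pi> y / 2))\<close>; \<open>sval s x y\<close> is the image of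
  \<open>(x, y)\<close>, shifted by \<open>(2, 2)\<close> if \<open>s = - 1\<close>.
\<close>

definition sval :: "real \<Rightarrow> real \<Rightarrow> real \<Rightarrow> real \<times> real \<times> real" where
  "sval s x y = (s * cos (pi * x / 2), s * cos (pi * y / 2), sin (pi * x / 2) * sin (pi * y / 2))"

lemma sval_cong:
  assumes "cos (pi * x / 2) = cos (pi * x' / 2)"
    and "sin (pi * y / 2) = 0 \<or> sin (pi * x / 2) = sin (pi * x' / 2)"
  shows "sval s x y = sval s x' y"
  using assms by (auto simp: sval_def)

lemma sval_antipodal:
  assumes "cos (pi * x / 2) = - cos (pi * x' / 2)" "sin (pi * x / 2) = sin (pi * x' / 2)"
  shows "sval s x 1 = sval (- s) x' 1"
  using assms by (auto simp: sval_def)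

text \<open>Either the angles agree and \<open>gap_inj\<close> applies, or an angle jumps between 2
  and -2 at a corner of the diamond, or the point lies in both diamonds. The last two cases force
  height 1, and \<open>sval\<close> is unchanged in all of them. So whatever respects these
  identifications descends to the torus.\<close>

lemma cyl_eq:
  assumes "chart s y" "chart s' y'" and eq: "cyl s x y = cyl s' x' y'"
  shows "y = y' \<and> (y = 0 \<or> y = 1 \<or> s = s' \<and> tri x = tri x' \<and> tri (x + 2) = tri (x' + 2))
     \<and> sval s x y = sval s' x' y'"
proof -
  define a b a' b' where "a = gap (tri x) y" "b = gap (tri (x + 2)) y"
    "a' = gap (tri x') y'" "b' = gap (tri (x' + 2)) y'"
  note ab = this
  have y: "0 \<le> y" "y \<le> 1" "0 \<le> y'" "y' \<le> 1" and s: "s = 1 \<or> s = -1" "s' = 1 \<or> s' = -1"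
    using assms by (auto simp: chart_def)
  have sum: "\<bar>a\<bar> + \<bar>b\<bar> \<le> 1 + y" "\<bar>a'\<bar> + \<bar>b'\<bar> \<le> 1 + y'"
    unfolding ab using gap_sum_le tri_sum y by blast+
  then have bd: "\<bar>a\<bar> \<le> 2" "\<bar>b\<bar> \<le> 2" "\<bar>a'\<bar> \<le> 2" "\<bar>b'\<bar> \<le> 2" using y by linarith+
  have g1: "gap (tri z) 1 = tri z" for z
    using tri_bounds[of z] by (intro gap_1) auto
  show ?thesis
  proof (cases "s = s'")
    case True
    have "s \<noteq> 0" using s by auto
    then have ea: "cis (pi / 2 * a) = cis (pi / 2 * a')" and eb: "cis (pi / 2 * b) = cis (pi / 2 * b')"
      using eq True by (auto simp: cyl_def ab)
    show ?thesis
    proof (cases "a = a' \<and> b = b'")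
      case True
      then have inj: "y = y' \<and> \<bar>tri x\<bar> = \<bar>tri x'\<bar> \<and> (y > 0 \<longrightarrow> tri x = tri x' \<and> tri (x + 2) = tri (x' + 2))"
        using gap_inj[OF tri_sum[of x] y(1,2) tri_sum[of x'] y(3,4)] unfolding ab by blast
      then have "cos (pi * x / 2) = cos (pi * x' / 2)"
        unfolding cos_tri[of x] cos_tri[of x'] by (auto simp: abs_eq_iff)
      moreover have "sin (pi * y / 2) = 0 \<or> sin (pi * x / 2) = sin (pi * x' / 2)"
        using inj y(1) by (auto simp: sin_tri2[of x] sin_tri2[of x'])
      ultimately have "sval s x y = sval s x' y" by (rule sval_cong)
      then show ?thesis using inj \<open>s = s'\<close> y(1) by auto
    next
      case False
      then have "(\<bar>a\<bar> = 2 \<and> a' = - a \<or> \<bar>b\<bar> = 2 \<and> b' = - b)"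
        using cis_quarter_eq_bounded[OF ea bd(1,3)] cis_quarter_eq_bounded[OF eb bd(2,4)] by blast
      then have y1: "y = 1" "y' = 1" using sum y by auto
      then have ab': "a = tri x" "b = tri (x + 2)" "a' = tri x'" "b' = tri (x' + 2)"
        by (simp_all add: ab g1)
      consider "\<bar>a\<bar> = 2" "a' = - a" "b = 0" "b' = 0" | "\<bar>b\<bar> = 2" "b' = - b" "a = 0" "a' = 0"
        using \<open>(\<bar>a\<bar> = 2 \<and> a' = - a \<or> \<bar>b\<bar> = 2 \<and> b' = - b)\<close> sum y1 by auto
      then have "cos (pi * x / 2) = cos (pi * x' / 2) \<and> sin (pi * x / 2) = sin (pi * x' / 2)"
        unfolding cos_tri[of x] cos_tri[of x'] sin_tri2[of x] sin_tri2[of x'] ab'[symmetric]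
        by cases auto
      then have "sval s x y = sval s x' y" using sval_cong by blast
      then show ?thesis using y1 \<open>s = s'\<close> by simp
    qed
  next
    case False
    then have s': "s' = - s" "s \<noteq> 0" using s by auto
    then have ea: "cis (pi / 2 * a) = - cis (pi / 2 * a')" and eb: "cis (pi / 2 * b) = - cis (pi / 2 * b')"
      using eq by (auto simp: cyl_def ab simp flip: scaleR_minus_right)
    have da: "a = a' + 2 \<or> a = a' - 2" and db: "b = b' + 2 \<or> b = b' - 2"
      using cis_quarter_opp_bounded[OF ea bd(1,3)] cis_quarter_opp_bounded[OF eb bd(2,4)] .
    \<comment> \<open>Both angles differ by 2, so the four absolute values add up to at least 4,
      while each diamond contributes at most 1 plus the height.\<close>
    then have y1: "y = 1" "y' = 1" using sum y by linarith+
    then have ab': "a = tri x" "b = tri (x + 2)" "a' = tri x'" "b' = tri (x' + 2)"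
      by (simp_all add: ab g1)
    have s1: "\<bar>a\<bar> + \<bar>b\<bar> = 2" "\<bar>a'\<bar> + \<bar>b'\<bar> = 2" unfolding ab' by (rule tri_sum)+
    have "cos (pi * a / 2) = - cos (pi * a' / 2)"
      using da by (auto simp: distrib_left right_diff_distrib add_divide_distrib diff_divide_distrib
          cos_add cos_diff)
    moreover have "sin (pi * a / 4) * sin (pi * b / 4) = sin (pi * a' / 4) * sin (pi * b' / 4)"
    proof -
      have compl: "sin (pi * (2 - u) / 4) = cos (pi * u / 4)" for u
        by (simp add: right_diff_distrib diff_divide_distrib sin_diff)
      have compl': "sin (pi * (u - 2) / 4) = - cos (pi * u / 4)" for u
        by (simp add: right_diff_distrib diff_divide_distrib sin_diff)
      have compl'': "sin (pi * (- 2 - u) / 4) = - cos (pi * u / 4)" for u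
        by (simp add: right_diff_distrib diff_divide_distrib sin_diff)
      have compl''': "sin (pi * (2 + u) / 4) = cos (pi * u / 4)" for u
        by (simp add: distrib_left add_divide_distrib sin_add)
      consider "a > 0" "b > 0" | "a > 0" "b < 0" | "a < 0" "b > 0" | "a < 0" "b < 0"
        | "a = 0" | "b = 0" by linarith
      then show ?thesis
      proof cases
        case 1
        then have "b = 2 - a" "a' = a - 2" "b' = - a" using s1 da db by auto
        then show ?thesis by (simp add: compl compl')
      next
        case 2
        then have "b = a - 2" "a' = a - 2" "b' = a" using s1 da db by auto
        then show ?thesis by (simp add: compl compl')
      next
        case 3
        then have "b = 2 + a" "a' = 2 + a" "b' = a" using s1 da db by auto
        then show ?thesis by (simp add: compl''')
      next
        case 4
        then have "b = - 2 - a" "a' = 2 + a" "b' = - a" using s1 da db by auto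
        then show ?thesis by (simp add: compl'' compl''')
      next
        case 5
        then have "b' = 0" using s1 bd db by auto
        then show ?thesis using 5 by simp
      next
        case 6
        then have "a' = 0" using s1 bd da by auto
        then show ?thesis using 6 by simp
      qed
    qed
    ultimately have "sval s x 1 = sval (- s) x' 1"
      by (intro sval_antipodal) (simp_all add: cos_tri[of x] cos_tri[of x'] sin_tri2[of x] sin_tri2[of x'] ab')
    then show ?thesis using y1 s' by simp
  qed
qed

lemma torus_cis: "(z, w) \<in> torus \<longleftrightarrow> (\<exists>a b. z = cis (pi / 2 * a) \<and> w = cis (pi / 2 * b))"
proof -
  have "norm z = 1 \<longleftrightarrow> (\<exists>a. z = cis (pi / 2 * a))" for z
  proof
    assume "norm z = 1"
    then have "cis (Arg z) = z"
      using cis_Arg[of z] by (cases "z = 0") (auto simp: sgn_eq)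
    then have "z = cis (pi / 2 * (Arg z * 2 / pi))" by simp
    then show "\<exists>a. z = cis (pi / 2 * a)" ..
  qed auto
  then show ?thesis by (auto simp: torus_def)
qed

lemma cyl_in_torus: "chart s y \<Longrightarrow> cyl s x y \<in> torus"
  by (auto simp: cyl_def torus_def chart_def)

lemma cis_quarter_reduce: "\<exists>b. \<bar>b\<bar> \<le> 2 \<and> cis (pi / 2 * a) = cis (pi / 2 * b)"
proof -
  define n where "n = \<lfloor>(a + 2) / 4\<rfloor>"
  have "of_int n \<le> (a + 2) / 4" "(a + 2) / 4 < of_int n + 1" unfolding n_def by linarith+
  then have "\<bar>a - 4 * of_int n\<bar> \<le> 2" by (auto simp: abs_le_iff field_simps)
  moreover have "cis (pi / 2 * a) = cis (pi / 2 * (a - 4 * of_int n))"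
  proof -
    have "pi / 2 * a = pi / 2 * (a - 4 * of_int n) + 2 * pi * of_int n" by (simp add: algebra_simps)
    then have "sin (pi / 2 * a) = sin (pi / 2 * (a - 4 * of_int n)) \<and> cos (pi / 2 * a) = cos (pi / 2 * (a - 4 * of_int n))"
      using sin_cos_eq_iff[of "pi / 2 * a"] by blast
    then show ?thesis by (simp add: complex_eq_iff)
  qed
  ultimately show ?thesis by blast
qed

lemma cyl_onto:
  assumes "t \<in> torus"
  obtains s x y where "chart s y" "t = cyl s x y"
proof -
  obtain z w where t: "t = (z, w)" by (cases t)
  obtain a b where ab: "z = cis (pi / 2 * a)" "w = cis (pi / 2 * b)" "\<bar>a\<bar> \<le> 2" "\<bar>b\<bar> \<le> 2"
    using assms torus_cis cis_quarter_reduce unfolding t by metis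
  have main: "\<exists>x y. 0 \<le> y \<and> y \<le> 1 \<and> cyl s x y = (s *\<^sub>R cis (pi / 2 * a), s *\<^sub>R cis (pi / 2 * b))"
    if "\<bar>a\<bar> + \<bar>b\<bar> \<le> 2" for a b s
  proof -
    obtain u v y where "\<bar>u\<bar> + \<bar>v\<bar> = 2" "0 \<le> y" "y \<le> 1" "gap u y = a" "gap v y = b"
      using gap_onto[OF \<open>\<bar>a\<bar> + \<bar>b\<bar> \<le> 2\<close>] by blast
    moreover from this obtain x where "tri x = u" "tri (x + 2) = v" using tri_onto by blast
    ultimately show ?thesis unfolding cyl_def by blast
  qed
  show thesis
  proof (cases "\<bar>a\<bar> + \<bar>b\<bar> \<le> 2")
    case True
    then obtain x y where "0 \<le> y" "y \<le> 1" "cyl 1 x y = (cis (pi / 2 * a), cis (pi / 2 * b))"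
      using main[of a b 1] by auto
    then show ?thesis using that[of 1 y x] ab t by (auto simp: chart_def)
  next
    case False
    \<comment> \<open>A point outside the first diamond lies in the second one: move both angles by
      2 towards 0.\<close>
    define p q where "p = (if a \<ge> 0 then a - 2 else a + 2)" and "q = (if b \<ge> 0 then b - 2 else b + 2)"
    have pq: "\<bar>p\<bar> + \<bar>q\<bar> \<le> 2" using False ab(3,4) by (auto simp: p_def q_def)
    have opp: "- cis (pi / 2 * (if a \<ge> 0 then a - 2 else a + 2)) = cis (pi / 2 * a)" for a
      using cis_quarter_add2[of a] cis_quarter_add2[of "a - 2"] by auto
    obtain x y where "0 \<le> y" "y \<le> 1" "cyl (- 1) x y = (- cis (pi / 2 * p), - cis (pi / 2 * q))"
      using main[OF pq, of "- 1"] by auto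
    then show ?thesis using that[of "- 1" y x] ab t opp[of a, folded p_def] opp[of b, folded q_def]
      by (auto simp: chart_def)
  qed
qed

section \<open>The projection to the pillowcase and the twist\<close>

lemma tri_shift2: "\<bar>x\<bar> \<le> 2 \<Longrightarrow> tri (x + 2) = 2 - \<bar>x\<bar>"
proof (cases "x \<le> 0")
  case False
  assume "\<bar>x\<bar> \<le> 2"
  then have "tri (x - 2) = x - 2" using False by (simp add: tri_id)
  moreover have "tri (x + 2) = - tri (x - 2)" using tri_add4[of "x - 2"] by (simp add: algebra_simps)
  ultimately show ?thesis using False by simp
qed (simp add: tri_id)

lemma tri_add8: "tri (x + 8 * of_int n) = tri x"
proof -
  have "pi * (x + 8 * of_int n) / 4 = pi * x / 4 + 2 * pi * of_int n" by (simp add: field_simps)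
  then have "sin (pi * (x + 8 * of_int n) / 4) = sin (pi * x / 4)"
    using sin_cos_eq_iff[of "pi * (x + 8 * of_int n) / 4" "pi * x / 4"] by blast
  then show ?thesis by (simp add: tri_def)
qed

lemma cyl_add8: "cyl s (x + 8 * of_int n) y = cyl s x y"
proof -
  have "x + 8 * of_int n + 2 = (x + 2) + 8 * of_int n" by simp
  then show ?thesis unfolding cyl_def by (simp only: tri_add8)
qed

text \<open>Negation of both angles. In cylinder coordinates it is half a turn
  (\<open>cyl_add4\<close>); its fixed points on the torus are the four points with real
  entries.\<close>

definition deck :: "complex \<times> complex \<Rightarrow> complex \<times> complex" where
  "deck t = (cnj (fst t), cnj (snd t))"

lemma deck_deck [simp]: "deck (deck t) = t"
  by (simp add: deck_def)

lemma deck_in_torus [simp]: "deck t \<in> torus \<longleftrightarrow> t \<in> torus"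
  by (simp add: deck_def torus_def mem_Times_iff)

lemma dist_deck [simp]: "dist (deck t) (deck u) = dist t u"
  by (simp add: deck_def dist_prod_def dist_norm flip: complex_cnj_diff)

lemma continuous_deck [continuous_intros]:
  "continuous_on S f \<Longrightarrow> continuous_on S (\<lambda>x. deck (f x))"
  unfolding deck_def by (intro continuous_intros)

lemma cyl_add4:
  assumes "0 \<le> y" shows "cyl s (x + 4) y = deck (cyl s x y)"
proof -
  have "tri (x + 4 + 2) = - tri (x + 2)" using tri_add4[of "x + 2"] by (simp add: algebra_simps)
  then show ?thesis using assms by (simp add: cyl_def deck_def cis_cnj)
qed

lemma cyl_add4n:
  assumes "0 \<le> y" shows "cyl s (x + 4 * of_int n) y \<in> {cyl s x y, deck (cyl s x y)}"
proof (cases "even n")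
  case True
  then obtain k where "n = 2 * k" by blast
  then show ?thesis using cyl_add8[of s x k y] by simp
next
  case False
  then obtain k where "n = 2 * k + 1" using oddE by blast
  then have "x + 4 * of_int n = (x + 4) + 8 * of_int k" by simp
  then show ?thesis using cyl_add8[of s "x + 4" k y] cyl_add4[OF assms, of s x]
    by (simp only: insert_iff) simp
qed

text \<open>
  A double cover branched over four regular points of the pillowcase (\<open>branch_vals\<close> below), with deck
  transformation \<open>deck\<close>; the four cone points lift to eight 1-prongs. By \<open>cyl_eq\<close> the value of
  the \<open>SOME\<close> does not depend on the choice of \<open>s x y\<close>.
\<close>

definition pproj :: "complex \<times> complex \<Rightarrow> real \<times> real \<times> real" where
  "pproj t = (SOME v. \<exists>s x y. chart s y \<and> t = cyl s x y \<and> v = sval s x y)"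

lemma pproj_cyl:
  assumes "chart s y" shows "pproj (cyl s x y) = sval s x y"
  unfolding pproj_def
proof (rule some_equality)
  fix v assume "\<exists>s' x' y'. chart s' y' \<and> cyl s x y = cyl s' x' y' \<and> v = sval s' x' y'"
  then show "v = sval s x y" using cyl_eq[OF assms] by metis
qed (use assms in blast)

text \<open>
  On each of the two cylinders this is the \<open>c\<close>-th power of a Dehn twist, which lifts the linear shear with slope
  \<open>8 c\<close>: it is the identity at heights 0 and 1, hence compatible with the gluing.
\<close>

definition shear :: "int \<Rightarrow> complex \<times> complex \<Rightarrow> complex \<times> complex" where
  "shear c t = (SOME t'. \<exists>s x y. chart s y \<and> t = cyl s x y \<and> t' = cyl s (x + 8 * of_int c * y) y)"

lemma shear_cyl:
  assumes "chart s y" shows "shear c (cyl s x y) = cyl s (x + 8 * of_int c * y) y"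
  unfolding shear_def
proof (rule some_equality)
  show "\<exists>s' x' y'. chart s' y' \<and> cyl s x y = cyl s' x' y' \<and>
          cyl s (x + 8 * of_int c * y) y = cyl s' (x' + 8 * of_int c * y') y'"
    using assms by blast
  fix t'
  assume "\<exists>s' x' y'. chart s' y' \<and> cyl s x y = cyl s' x' y' \<and> t' = cyl s' (x' + 8 * of_int c * y') y'"
  then obtain s' x' y' where *: "chart s' y'" "cyl s x y = cyl s' x' y'" "t' = cyl s' (x' + 8 * of_int c * y') y'"
    by blast
  from cyl_eq[OF assms *(1,2)] have y: "y' = y"
    and c: "y = 0 \<or> y = 1 \<or> s = s' \<and> tri x = tri x' \<and> tri (x + 2) = tri (x' + 2)" by auto
  from c show "t' = cyl s (x + 8 * of_int c * y) y"
  proof (elim disjE conjE)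
    assume "y = 1" then show ?thesis using * y cyl_add8[of _ _ c] by simp
  next
    assume e: "s = s'" "tri x = tri x'" "tri (x + 2) = tri (x' + 2)"
    have "tri (x + d) = tri (x' + d)" for d by (rule tri_eq_shift[OF e(2,3)])
    then show ?thesis using *(3) y e(1) by (simp add: cyl_def add.assoc)
  qed (use * y in auto)
qed

definition chart_dom :: "(real \<times> real \<times> real) set" where
  "chart_dom = {-1, 1} \<times> {0..8} \<times> {0..1}"

lemma chart_dom_chart: "(s, x, y) \<in> chart_dom \<Longrightarrow> chart s y"
  by (auto simp: chart_dom_def chart_def)

lemma cyl_image: "(\<lambda>(s, x, y). cyl s x y) ` chart_dom = torus"
proof (intro equalityI subsetI)
  fix t assume "t \<in> torus"
  then obtain s x y where *: "chart s y" "t = cyl s x y" by (rule cyl_onto)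
  define n where "n = \<lfloor>x / 8\<rfloor>"
  have "of_int n \<le> x / 8" "x / 8 < of_int n + 1" unfolding n_def by linarith+
  then have "0 \<le> x - 8 * of_int n" "x - 8 * of_int n \<le> 8" by auto
  moreover have "t = cyl s (x - 8 * of_int n) y" using cyl_add8[of s x "- n" y] * by simp
  ultimately show "t \<in> (\<lambda>(s, x, y). cyl s x y) ` chart_dom"
    using * by (intro image_eqI[of _ _ "(s, x - 8 * of_int n, y)"]) (auto simp: chart_dom_def chart_def)
qed (auto simp: chart_dom_def chart_def intro!: cyl_in_torus)

lemma compact_chart_dom: "compact chart_dom"
  unfolding chart_dom_def by (intro compact_Times finite_imp_compact compact_Icc) auto

lemma continuous_gap [continuous_intros]:
  "continuous_on S f \<Longrightarrow> continuous_on S g \<Longrightarrow> continuous_on S (\<lambda>x. gap (f x) (g x))"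
  unfolding gap_def by (intro continuous_intros)

lemma continuous_cyl [continuous_intros]:
  fixes f :: "'a::metric_space \<Rightarrow> real"
  assumes "continuous_on S f" "continuous_on S g" "continuous_on S h"
  shows "continuous_on S (\<lambda>x. cyl (f x) (g x) (h x))"
  unfolding cyl_def by (intro continuous_intros assms)

text \<open>A continuous surjection from a compact set onto the torus is a quotient map, so
  continuity can be tested in the cylinder coordinates.\<close>

lemma continuous_on_torus:
  fixes h :: "complex \<times> complex \<Rightarrow> 'a::topological_space"
  assumes "continuous_on chart_dom (\<lambda>(s, x, y). h (cyl s x y))"
  shows "continuous_on torus h"
proof -
  have cp: "continuous_on chart_dom (\<lambda>(s, x, y). cyl s x y)"
    unfolding case_prod_beta by (intro continuous_intros)
  have "compact torus"
    unfolding torus_def by (intro compact_Times compact_sphere)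
  have "closed (h -` B \<inter> torus)" if "closed B" for B
  proof -
    let ?C = "chart_dom \<inter> (\<lambda>(s, x, y). h (cyl s x y)) -` B"
    have "closedin (top_of_set chart_dom) ?C"
      using assms \<open>closed B\<close> by (rule continuous_closedin_preimage)
    then have "compact ?C"
      using closedin_compact compact_chart_dom by blast
    then have "compact ((\<lambda>(s, x, y). cyl s x y) ` ?C)"
      using cp by (meson compact_continuous_image continuous_on_subset inf_le1)
    moreover have "(\<lambda>(s, x, y). cyl s x y) ` ?C = h -` B \<inter> torus"
    proof (intro equalityI subsetI)
      fix t assume t: "t \<in> h -` B \<inter> torus"
      then obtain c where "c \<in> chart_dom" "t = (\<lambda>(s, x, y). cyl s x y) c"
        using cyl_image by blast
      then show "t \<in> (\<lambda>(s, x, y). cyl s x y) ` ?C" using t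
        by (intro image_eqI[of _ _ c]) (auto simp: case_prod_beta)
    next
      fix t assume "t \<in> (\<lambda>(s, x, y). cyl s x y) ` ?C"
      then show "t \<in> h -` B \<inter> torus" by (auto dest: chart_dom_chart intro: cyl_in_torus)
    qed
    ultimately show ?thesis by (simp add: compact_imp_closed)
  qed
  then show ?thesis
    using continuous_on_closed_vimage[OF compact_imp_closed[OF \<open>compact torus\<close>]] by blast
qed

lemma continuous_pproj: "continuous_on torus pproj"
proof (rule continuous_on_torus)
  have "continuous_on chart_dom (\<lambda>(s, x, y). sval s x y)"
    unfolding sval_def case_prod_beta by (intro continuous_intros) auto
  then show "continuous_on chart_dom (\<lambda>(s, x, y). pproj (cyl s x y))"
    by (rule continuous_on_eq) (auto dest!: chart_dom_chart simp: pproj_cyl)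
qed

lemma continuous_shear: "continuous_on torus (shear c)"
proof (rule continuous_on_torus)
  have "continuous_on chart_dom (\<lambda>(s, x, y). cyl s (x + 8 * of_int c * y) y)"
    unfolding case_prod_beta by (intro continuous_intros)
  then show "continuous_on chart_dom (\<lambda>(s, x, y). shear c (cyl s x y))"
    by (rule continuous_on_eq) (auto dest!: chart_dom_chart simp: shear_cyl)
qed

lemma shear_in_torus: "t \<in> torus \<Longrightarrow> shear c t \<in> torus"
  by (elim cyl_onto) (simp add: shear_cyl cyl_in_torus)

lemma shear_shear: "t \<in> torus \<Longrightarrow> shear c (shear (- c) t) = t"
  by (elim cyl_onto) (simp add: shear_cyl)

lemma pproj_deck:
  assumes "t \<in> torus" shows "pproj (deck t) = pproj t"
proof -
  obtain s x y where *: "chart s y" "t = cyl s x y" using assms by (rule cyl_onto)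
  have e: "pi * (x + 4) / 2 = pi * x / 2 + 2 * pi" by (simp add: field_simps)
  have "pproj (cyl s (x + 4) y) = pproj (cyl s x y)"
    unfolding pproj_cyl[OF *(1)] sval_def e by simp
  then show ?thesis using * by (simp add: cyl_add4 chart_def)
qed

text \<open>The angles (a, b) go to (a, 2 - b). Although nothing is exchanged in the angles, this
  lifts the reflection of the pillowcase that exchanges its two coordinates
  (\<open>pproj_flip\<close>).\<close>

definition flip :: "complex \<times> complex \<Rightarrow> complex \<times> complex" where
  "flip t = (fst t, - cnj (snd t))"

lemma flip_flip [simp]: "flip (flip t) = t" and flip_deck: "flip (deck t) = deck (flip t)"
  by (simp_all add: flip_def deck_def)

lemma flip_in_torus [simp]: "flip t \<in> torus \<longleftrightarrow> t \<in> torus"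
  by (auto simp: flip_def torus_def mem_Times_iff)

lemma continuous_flip: "continuous_on S flip"
  unfolding flip_def by (intro continuous_intros)

definition swap12 :: "real \<times> real \<times> real \<Rightarrow> real \<times> real \<times> real" where
  "swap12 = (\<lambda>(a, b, c). (b, a, c))"

text \<open>On this half of the cylinder the exchange of \<open>x\<close> and \<open>y\<close> stays
  in the same cylinder. A negative \<open>x\<close> would become a negative height, so the pair is
  then negated; this is the sign \<open>e\<close>.\<close>

lemma flip_cyl_1:
  assumes "chart s y" "\<bar>x\<bar> \<le> 1"
  defines "e \<equiv> if x \<ge> 0 then 1 else - 1"
  shows "flip (cyl s x y) = cyl s (e * y) \<bar>x\<bar>" "sval s (e * y) \<bar>x\<bar> = swap12 (sval s x y)"
proof -
  have y: "0 \<le> y" "y \<le> 1" using assms by (auto simp: chart_def)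
  have t: "tri x = x" "tri (x + 2) = 2 - \<bar>x\<bar>" "tri (e * y) = e * y" "tri (e * y + 2) = 2 - y"
    using assms y tri_id[of x] tri_shift2[of x] tri_id[of "e * y"] tri_shift2[of "e * y"] by auto
  have x: "- 1 \<le> x" "x \<le> 1" using assms(2) by auto
  have g: "gap x y = gap (e * y) \<bar>x\<bar>" "gap (2 - y) \<bar>x\<bar> = - gap (2 - \<bar>x\<bar>) y + 2"
    using x y by (auto simp: gap_def e_def min_def max_def abs_if)
  show "flip (cyl s x y) = cyl s (e * y) \<bar>x\<bar>"
    unfolding cyl_def flip_def t g cis_quarter_add2 by (simp add: cis_cnj)
  show "sval s (e * y) \<bar>x\<bar> = swap12 (sval s x y)"
    by (auto simp: sval_def swap12_def e_def abs_if)
qed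

text \<open>On the other half the exchanged point needs the shift by (2, 2) and lands in the other
  cylinder. The offset 6 agrees with 2 in the pillowcase; modulo 8 it selects the sheet that
  \<open>flip\<close> reaches.\<close>

lemma flip_cyl_2:
  assumes "chart s y" "\<bar>x\<bar> \<le> 1"
  defines "e \<equiv> if x \<ge> 0 then 1 else - 1"
  shows "flip (cyl s (x + 2) y) = cyl (- s) (e * y + 6) \<bar>x\<bar>"
    "sval (- s) (e * y + 6) \<bar>x\<bar> = swap12 (sval s (x + 2) y)"
proof -
  have y: "0 \<le> y" "y \<le> 1" using assms by (auto simp: chart_def)
  have ey: "\<bar>e * y\<bar> = y" using y by (auto simp: e_def)
  have "tri (x + 2 + 2) = tri (x + 4)" "tri (e * y + 6) = tri ((e * y + 2) + 4)"
    "tri (e * y + 6 + 2) = tri (e * y + 8 * of_int 1)"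
    by (simp_all add: add.assoc del: tri_add4)
  then have t: "tri (x + 2 + 2) = - x" "tri (x + 2) = 2 - \<bar>x\<bar>" "tri (e * y + 6) = - (2 - y)" "tri (e * y + 6 + 2) = e * y"
    using assms(2) ey y tri_id[of x] tri_shift2[of x] tri_id[of "e * y"] tri_shift2[of "e * y"]
      tri_add8[of "e * y" 1] by (simp_all only: tri_add4)
  have x: "- 1 \<le> x" "x \<le> 1" using assms(2) by auto
  have g: "gap (e * y) \<bar>x\<bar> = gap x y" "gap (- (2 - y)) \<bar>x\<bar> = gap (2 - \<bar>x\<bar>) y - 2" "gap (- x) y = - gap x y"
    using x y by (auto simp: gap_def e_def min_def max_def abs_if)
  have c: "cis (pi / 2 * (a - 2)) = - cis (pi / 2 * a)" for a
    using cis_quarter_add2[of "a - 2"] by simp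
  show "flip (cyl s (x + 2) y) = cyl (- s) (e * y + 6) \<bar>x\<bar>"
    unfolding cyl_def flip_def t g c by (simp add: cis_cnj)
  have a: "pi * (x + 2) / 2 = pi * x / 2 + pi" "pi * (e * y + 6) / 2 = pi * (e * y) / 2 + pi + 2 * pi"
    by (simp_all add: field_simps)
  show "sval (- s) (e * y + 6) \<bar>x\<bar> = swap12 (sval s (x + 2) y)"
    unfolding sval_def a sin_periodic cos_periodic by (auto simp: swap12_def e_def abs_if)
qed

lemma pproj_flip:
  assumes "t \<in> torus" shows "pproj (flip t) = swap12 (pproj t)"
proof -
  obtain s x y where *: "chart s y" "t = cyl s x y" using assms by (rule cyl_onto)
  \<comment> \<open>Up to \<open>deck\<close>, the position may be moved by multiples of 4 into
    [-1, 3], the range covered by the two halves.\<close>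
  define n where "n = \<lfloor>(x + 1) / 4\<rfloor>"
  define x' where "x' = x - 4 * of_int n"
  have "of_int n \<le> (x + 1) / 4" "(x + 1) / 4 < of_int n + 1" unfolding n_def by linarith+
  then have x': "-1 \<le> x'" "x' \<le> 3" by (auto simp: x'_def)
  have chart': "chart s \<bar>u\<bar>" "chart (- s) \<bar>u\<bar>" if "\<bar>u\<bar> \<le> 1" for u
    using * that by (auto simp: chart_def)
  have key: "pproj (flip (cyl s x' y)) = swap12 (pproj (cyl s x' y))"
  proof (cases "x' \<le> 1")
    case True
    then have "\<bar>x'\<bar> \<le> 1" using x' by auto
    then show ?thesis using flip_cyl_1[OF *(1)] chart' *(1) by (simp add: pproj_cyl)
  next
    case False
    then have "\<bar>x' - 2\<bar> \<le> 1" using x' by auto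
    then show ?thesis using flip_cyl_2[OF *(1), of "x' - 2"] chart' *(1) by (simp add: pproj_cyl)
  qed
  have "t = cyl s x' y \<or> t = deck (cyl s x' y)"
    using cyl_add4n[of y s x' n] * by (auto simp: x'_def chart_def)
  then show ?thesis
    using key pproj_deck[of "cyl s x' y"] pproj_deck[of "flip (cyl s x' y)"] cyl_in_torus[OF *(1)]
    by (auto simp: flip_deck)
qed

section \<open>Fibres of the projections from the torus and from the plane\<close>

lemma quarter_turn_eq:
  assumes "cos (pi * x / 2) = cos (pi * x' / 2)" "sin (pi * x / 2) = sin (pi * x' / 2)"
  obtains n :: int where "x = x' + 4 * of_int n"
  using assms cis_quarter_eq[of x x'] by (auto simp: complex_eq_iff)

text \<open>In one cylinder equal values give equal heights and then equal positions modulo 4, a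
  shift by 4 being \<open>deck\<close>. At height 0 the sine condition drops out, and the extra
  solution \<open>- x\<close> is the zip. Different cylinders meet only at height 1, where
  \<open>x\<close> corresponds to \<open>2 - x\<close>.\<close>

lemma pproj_eq:
  assumes "t \<in> torus" "t' \<in> torus" "pproj t = pproj t'"
  shows "t' = t \<or> t' = deck t"
proof -
  obtain s x y where *: "chart s y" "t = cyl s x y" using assms(1) by (rule cyl_onto)
  obtain s' x' y' where **: "chart s' y'" "t' = cyl s' x' y'" using assms(2) by (rule cyl_onto)
  have y: "0 \<le> y" "y \<le> 1" "0 \<le> y'" "y' \<le> 1" and s: "s = 1 \<or> s = -1" "s' = 1 \<or> s' = -1"
    using * ** by (auto simp: chart_def)
  have eq: "s * cos (pi * x / 2) = s' * cos (pi * x' / 2)" "s * cos (pi * y / 2) = s' * cos (pi * y' / 2)"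
    "sin (pi * x / 2) * sin (pi * y / 2) = sin (pi * x' / 2) * sin (pi * y' / 2)"
    using assms(3) * ** by (auto simp: pproj_cyl sval_def)
  have "0 \<le> pi * u \<and> pi * u \<le> pi" if "0 \<le> u" "u \<le> 1" for u
    using that mult_left_le[of u pi] by simp
  note pu = this
  have cnn: "cos (pi * y / 2) \<ge> 0" "cos (pi * y' / 2) \<ge> 0"
    using pu[OF y(1,2)] pu[OF y(3,4)] pi_gt_zero
    by (intro cos_ge_zero; linarith)+
  have cinj: "u = v" if "cos (pi * u / 2) = cos (pi * v / 2)" "0 \<le> u" "u \<le> 1" "0 \<le> v" "v \<le> 1" for u v
  proof -
    have "pi * u / 2 = pi * v / 2" using that(1) pu[OF that(2,3)] pu[OF that(4,5)]
      by - (rule cos_inj_pi, auto)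
    then show ?thesis by simp
  qed
  show ?thesis
  proof (cases "s = s'")
    case True
    then have c: "cos (pi * x / 2) = cos (pi * x' / 2)" "cos (pi * y / 2) = cos (pi * y' / 2)" using eq s by auto
    then have yy: "y' = y" using cinj y by metis
    show ?thesis
    proof (cases "y = 0")
      case False
      have "0 < y" using False y by simp
      then have "sin (pi * y / 2) > 0" using pu[OF y(1,2)] by (intro sin_gt_zero) auto
      then have "sin (pi * x / 2) = sin (pi * x' / 2)" using eq(3) yy by simp
      with c(1) obtain n :: int where "x' = x + 4 * of_int n" using quarter_turn_eq by metis
      then show ?thesis using cyl_add4n[of y s x n] y * ** True yy by auto
    next
      case y0: True
      have "(sin (pi * x / 2))\<^sup>2 = (sin (pi * x' / 2))\<^sup>2" using c(1) by (simp add: sin_squared_eq)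
      then have "sin (pi * x / 2) = sin (pi * x' / 2) \<or> sin (pi * (- x) / 2) = sin (pi * x' / 2)"
        by (auto simp: power2_eq_iff)
      moreover have "cos (pi * (- x) / 2) = cos (pi * x' / 2)" using c(1) by simp
      ultimately obtain n :: int where n: "x' = x + 4 * of_int n \<or> x' = - x + 4 * of_int n"
        using c(1) quarter_turn_eq by metis
      have "cyl s (- x) 0 \<in> {cyl s x 0, deck (cyl s x 0)}"
      proof -
        have t: "tri (- x) = - tri x" "tri (- x + 2) = tri (x + 2)"
          using tri_add4[of "x - 2"] tri_minus[of "x - 2"] by (auto simp: algebra_simps)
        have "\<bar>tri x\<bar> \<le> 1 \<or> \<bar>tri (x + 2)\<bar> \<le> 1" using tri_sum[of x] by linarith
        then have "gap (tri x) 0 = 0 \<or> gap (tri (x + 2)) 0 = 0" by (auto simp: gap_def min_def max_def abs_if)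
        then show ?thesis unfolding cyl_def deck_def t by (auto simp: cis_cnj)
      qed
      then show ?thesis using cyl_add4n[of 0 s x n] cyl_add4n[of 0 s "- x" n] n * ** True yy y0 by auto
    qed
  next
    case False
    then have s': "s' = - s" "s \<noteq> 0" using s by auto
    then have "cos (pi * y / 2) = 0" "cos (pi * y' / 2) = 0" using eq(2) cnn s(1) s'(1) by auto
    then have y1: "y = 1" "y' = 1" using cinj[of y 1] cinj[of y' 1] y by auto
    have "cos (pi * x' / 2) = - cos (pi * x / 2)" "sin (pi * x' / 2) = sin (pi * x / 2)"
      using eq s(1) s'(1) y1 by auto
    moreover have e: "pi * (2 - x) / 2 = pi - pi * x / 2" by (simp add: field_simps)
    have "cos (pi * (2 - x) / 2) = - cos (pi * x / 2)" "sin (pi * (2 - x) / 2) = sin (pi * x / 2)"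
      unfolding e by (simp_all add: cos_diff sin_diff)
    ultimately have "cos (pi * x' / 2) = cos (pi * (2 - x) / 2)" "sin (pi * x' / 2) = sin (pi * (2 - x) / 2)"
      by (simp_all only:)
    then obtain n :: int where n: "x' = (2 - x) + 4 * of_int n"
      by (rule quarter_turn_eq)
    have "cyl (- s) (2 - x) 1 \<in> {cyl s x 1, deck (cyl s x 1)}"
    proof -
      have t: "tri (2 - x) = tri (x + 2)" "tri (2 - x + 2) = tri x"
        using tri_add4[of "x - 2"] tri_minus[of "x - 2"] tri_add4[of "- x"] by (auto simp: algebra_simps)
      define u v where "u = tri x" "v = tri (x + 2)"
      note uv = this
      have g1: "gap u 1 = u" "gap v 1 = v"
        using tri_bounds[of x] tri_bounds[of "x + 2"] by (auto simp: uv intro!: gap_1)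
      have "\<bar>u\<bar> + \<bar>v\<bar> = 2" unfolding uv by (rule tri_sum)
      then consider "v = - u + 2" "u = - v + 2" | "- u = v + 2" "- v = u + 2" | "v = u + 2" | "u = v + 2"
        by linarith
      note cases = this
      define e where "e a = cis (pi / 2 * a)" for a
      have e2: "a = b + 2 \<Longrightarrow> e a = - e b" and ec: "cnj (e a) = e (- a)" for a b
        using cis_quarter_add2 by (auto simp: e_def cis_cnj)
      have "e v = - e (- u) \<and> e u = - e (- v) \<or> e (- u) = - e v \<and> e (- v) = - e u \<or> e v = - e u"
        using cases
      proof cases
        case 4
        then show ?thesis using e2[of u v] by simp
      qed (blast intro: e2)+
      then show ?thesis
        unfolding cyl_def t uv[symmetric] g1 deck_def e_def[symmetric] by (auto simp: ec)
    qed
    then show ?thesis using cyl_add4n[of 1 "- s" "2 - x" n] n * ** s' y1 by auto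
  qed
qed

definition pillow :: "real \<times> real \<Rightarrow> real \<times> real \<times> real" where
  "pillow b = (cos (pi * fst b / 2), cos (pi * snd b / 2), sin (pi * fst b / 2) * sin (pi * snd b / 2))"

lemma continuous_pillow: "continuous_on S pillow"
  unfolding pillow_def by (intro continuous_intros) auto

lemma pillow_sval: "s = 1 \<or> s = -1 \<Longrightarrow> sval s x y = pillow (x + (1 - s), y + (1 - s))"
  by (auto simp: sval_def pillow_def distrib_left add_divide_distrib)

lemma pillow_uminus [simp]: "pillow (- b) = pillow b"
  by (simp add: pillow_def)

lemma pillow_add4 [simp]: "pillow (fst b + 4 * of_int m, snd b + 4 * of_int n) = pillow b"
proof -
  have "sin (pi * (x + 4 * of_int n) / 2) = sin (pi * x / 2) \<and> cos (pi * (x + 4 * of_int n) / 2) = cos (pi * x / 2)"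
    for x and n :: int
  proof -
    have "pi * (x + 4 * of_int n) / 2 = pi * x / 2 + 2 * pi * of_int n" by (simp add: field_simps)
    then show ?thesis using sin_cos_eq_iff by blast
  qed
  then show ?thesis by (simp add: pillow_def)
qed

definition lat4 :: "(real \<times> real) set" where
  "lat4 = {(4 * of_int m, 4 * of_int n) | m n. True}"

lemma pillow_add_lat4: "l \<in> lat4 \<Longrightarrow> pillow (b + l) = pillow b"
  using pillow_add4[of b] by (auto simp: lat4_def plus_prod_def)

text \<open>Each cosine fixes a coordinate modulo 4 up to its sign; the product of the sines forces
  the two signs to be chosen alike.\<close>

lemma pillow_eq_iff: "pillow a = pillow b \<longleftrightarrow> (\<exists>l\<in>lat4. a = b + l \<or> a = - b + l)"
proof
  assume *: "pillow a = pillow b"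
  obtain a1 a2 b1 b2 where ab: "a = (a1, a2)" "b = (b1, b2)" by fastforce
  have eq: "cos (pi * a1 / 2) = cos (pi * b1 / 2)" "cos (pi * a2 / 2) = cos (pi * b2 / 2)"
    "sin (pi * a1 / 2) * sin (pi * a2 / 2) = sin (pi * b1 / 2) * sin (pi * b2 / 2)"
    using * by (auto simp: pillow_def ab)
  have sq: "sin (pi * u / 2) = sin (pi * v / 2) \<or> sin (pi * u / 2) = sin (pi * (- v) / 2)"
    if "cos (pi * u / 2) = cos (pi * v / 2)" for u v
  proof -
    have "(sin (pi * u / 2))\<^sup>2 = (sin (pi * v / 2))\<^sup>2" using that by (simp add: sin_squared_eq)
    then show ?thesis by (auto simp: power2_eq_iff)
  qed
  have s: "(sin (pi * a1 / 2) = sin (pi * b1 / 2) \<and> sin (pi * a2 / 2) = sin (pi * b2 / 2)) \<or>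
     (sin (pi * a1 / 2) = sin (pi * (- b1) / 2) \<and> sin (pi * a2 / 2) = sin (pi * (- b2) / 2))"
    using sq[OF eq(1)] sq[OF eq(2)] eq(3) by auto
  have c: "cos (pi * a1 / 2) = cos (pi * (- b1) / 2)" "cos (pi * a2 / 2) = cos (pi * (- b2) / 2)"
    using eq by auto
  have "\<exists>m n :: int. (a1 = b1 + 4 * of_int m \<and> a2 = b2 + 4 * of_int n) \<or>
     (a1 = - b1 + 4 * of_int m \<and> a2 = - b2 + 4 * of_int n)"
    using s quarter_turn_eq[OF eq(1)] quarter_turn_eq[OF eq(2)] quarter_turn_eq[OF c(1)] quarter_turn_eq[OF c(2)]
    by metis
  then show "\<exists>l\<in>lat4. a = b + l \<or> a = - b + l"
    unfolding lat4_def ab by (auto simp: plus_prod_def)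
next
  assume "\<exists>l\<in>lat4. a = b + l \<or> a = - b + l"
  then show "pillow a = pillow b" using pillow_add_lat4 pillow_uminus by metis
qed

lemma pproj_pillow: "t \<in> torus \<Longrightarrow> \<exists>b. pproj t = pillow b"
  by (elim cyl_onto) (auto simp: pproj_cyl pillow_sval chart_def)

lemma pillow_pproj: "\<exists>t\<in>torus. pproj t = pillow b"
proof -
  define n where "n = \<lfloor>(snd b + 1) / 4\<rfloor>"
  define x y where "x = fst b" "y = snd b - 4 * of_int n"
  have "of_int n \<le> (snd b + 1) / 4" "(snd b + 1) / 4 < of_int n + 1" unfolding n_def by linarith+
  then have y: "- 1 \<le> y" "y \<le> 3" by (auto simp: x_y_def)
  have b: "pillow b = pillow (x, y)" using pillow_add4[of b 0 "- n"] by (simp add: x_y_def)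
  have m: "pillow (x, y) = pillow (- x, - y)" using pillow_uminus[of "(x, y)"] by simp
  have c: "pproj (cyl s u v) = pillow (u + (1 - s), v + (1 - s)) \<and> cyl s u v \<in> torus" if "chart s v" for s u v
    using that pproj_cyl pillow_sval cyl_in_torus by (auto simp: chart_def)
  consider "y \<le> 0" | "0 \<le> y" "y \<le> 1" | "1 \<le> y" "y \<le> 2" | "2 \<le> y" using y by linarith
  then show ?thesis
  proof cases
    case 1
    then show ?thesis using c[of 1 "- y" "- x"] y unfolding b m by (auto simp: chart_def)
  next
    case 2
    then show ?thesis using c[of 1 y x] unfolding b by (auto simp: chart_def)
  next
    case 3
    have "pillow (x, y) = pillow (- x + 4, - y + 4)" using pillow_add4[of "(- x, - y)" 1 1] m by simp
    then show ?thesis using c[of "- 1" "2 - y" "- x + 2"] 3 unfolding b by (auto simp: chart_def)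
  next
    case 4
    then show ?thesis using c[of "- 1" "y - 2" "x - 2"] y unfolding b by (auto simp: chart_def)
  qed
qed

text \<open>The linear shear preserves \<open>lat4\<close> and commutes with negation, so it acts on
  the pillowcase. The second cylinder is shifted by (2, 2), which the shear moves by the lattice
  vector (16 c, 0).\<close>

lemma pproj_shear:
  assumes "t \<in> torus" "pproj t = pillow b"
  shows "pproj (shear c t) = pillow (fst b + 8 * of_int c * snd b, snd b)"
proof -
  obtain s x y where *: "chart s y" "t = cyl s x y" using assms(1) by (rule cyl_onto)
  define a where "a = (x + (1 - s), y + (1 - s))"
  have s: "s = 1 \<or> s = -1" using * by (auto simp: chart_def)
  have "pillow a = pillow b" using assms(2) * s by (simp add: pproj_cyl pillow_sval a_def)
  then obtain m n :: int where mn: "a = b + (4 * of_int m, 4 * of_int n) \<or> a = - b + (4 * of_int m, 4 * of_int n)"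
    unfolding pillow_eq_iff lat4_def by blast
  define S where "S = (\<lambda>b :: real \<times> real. (fst b + 8 * of_int c * snd b, snd b))"
  have "S a = S b + (4 * of_int (m + 8 * c * n), 4 * of_int n) \<or> S a = - S b + (4 * of_int (m + 8 * c * n), 4 * of_int n)"
    using mn by (auto simp: S_def plus_prod_def uminus_prod_def algebra_simps)
  then have "pillow (S a) = pillow (S b)"
    unfolding pillow_eq_iff lat4_def by blast
  moreover have "pproj (shear c t) = pillow (S a)"
  proof -
    have "pproj (shear c t) = pillow (x + 8 * of_int c * y + (1 - s), y + (1 - s))"
      using * s by (simp add: shear_cyl pproj_cyl pillow_sval)
    also have "\<dots> = pillow (S a)"
      using s
    proof
      assume s: "s = -1"
      have "(fst (S a), snd (S a)) = (x + 8 * of_int c * y + 2 + 4 * of_int (4 * c), y + 2 + 4 * of_int 0)"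
        by (simp add: S_def a_def s algebra_simps)
      then show ?thesis
        using pillow_add4[of "(x + 8 * of_int c * y + 2, y + 2)" "4 * c" 0] s by simp
    qed (simp add: S_def a_def)
    finally show ?thesis .
  qed
  ultimately show ?thesis by (simp add: S_def)
qed

section \<open>Shadowing in the pillowcase\<close>

text \<open>Makes an exact statement quantitative: on the compact set where \<psi> is at least
  \<zeta>, the function \<phi> has a positive minimum. It turns descriptions of fibres and fixed
  points into uniform estimates.\<close>

lemma compact_modulus:
  fixes \<phi> \<psi> :: "'a::metric_space \<Rightarrow> real"
  assumes "compact X" "continuous_on X \<phi>" "continuous_on X \<psi>"
    and "\<And>x. x \<in> X \<Longrightarrow> \<phi> x \<le> 0 \<Longrightarrow> \<psi> x < \<zeta>"
  shows "\<exists>\<eta>>0. \<forall>x\<in>X. \<phi> x < \<eta> \<longrightarrow> \<psi> x < \<zeta>"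
proof -
  define C where "C = X \<inter> \<psi> -` {\<zeta>..}"
  have "closedin (top_of_set X) C"
    unfolding C_def using assms(3) by (rule continuous_closedin_preimage) simp
  then have C: "compact C" using assms(1) closedin_compact by blast
  show ?thesis
  proof (cases "C = {}")
    case True
    then show ?thesis by (intro exI[of _ 1]) (force simp: C_def)
  next
    case False
    have "continuous_on C \<phi>" using assms(2) by (rule continuous_on_subset) (simp add: C_def)
    then obtain x where x: "x \<in> C" "\<forall>y\<in>C. \<phi> x \<le> \<phi> y" using continuous_attains_inf[OF C False] by blast
    then have "\<phi> x > 0" using assms(4)[of x] by (force simp: C_def)
    then show ?thesis using x(2) by (intro exI[of _ "\<phi> x"]) (force simp: C_def)
  qed
qed

lemma compact_torus: "compact torus"
  unfolding torus_def by (intro compact_Times compact_sphere)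

lemma lat4_0 [simp]: "0 \<in> lat4"
  by (auto simp: lat4_def zero_prod_def intro!: exI[of _ 0])

lemma lat4_uminus: "l \<in> lat4 \<Longrightarrow> - l \<in> lat4"
proof -
  assume "l \<in> lat4"
  then obtain m n :: int where "l = (4 * of_int m, 4 * of_int n)" by (auto simp: lat4_def)
  then have "- l = (4 * of_int (- m), 4 * of_int (- n))" by simp
  then show ?thesis unfolding lat4_def by blast
qed

lemma lat4_add: "l \<in> lat4 \<Longrightarrow> l' \<in> lat4 \<Longrightarrow> l + l' \<in> lat4"
proof -
  assume "l \<in> lat4" "l' \<in> lat4"
  then obtain m n m' n' :: int where "l = (4 * of_int m, 4 * of_int n)" "l' = (4 * of_int m', 4 * of_int n')"
    by (auto simp: lat4_def)
  then have "l + l' = (4 * of_int (m + m'), 4 * of_int (n + n'))" by simp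
  then show ?thesis unfolding lat4_def by blast
qed

lemma lat4_diff: "l \<in> lat4 \<Longrightarrow> l' \<in> lat4 \<Longrightarrow> l - l' \<in> lat4"
  using lat4_add[of l "- l'"] lat4_uminus[of l'] by simp

lemma abs_fst_le_norm: "\<bar>fst v\<bar> \<le> norm (v :: real \<times> real)"
  using norm_fst_le[of "fst v" "snd v"] by simp

lemma abs_snd_le_norm: "\<bar>snd v\<bar> \<le> norm (v :: real \<times> real)"
  using norm_snd_le[of "snd v" "fst v"] by simp

lemma norm_le_abs_sum: "norm (v :: real \<times> real) \<le> \<bar>fst v\<bar> + \<bar>snd v\<bar>"
  using norm_Pair_le[of "fst v" "snd v"] by simp

lemma lat4_eq_0:
  assumes "l \<in> lat4" "norm l < 4" shows "l = 0"
proof -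
  obtain m n :: int where l: "l = (4 * of_int m, 4 * of_int n)" using assms by (auto simp: lat4_def)
  have "\<bar>real_of_int m\<bar> < 1" "\<bar>real_of_int n\<bar> < 1"
    using abs_fst_le_norm[of l] abs_snd_le_norm[of l] assms(2) by (auto simp: l)
  then show ?thesis using l by (auto simp: zero_prod_def)
qed

lemma lat4_norm_ge: "l \<in> lat4 \<Longrightarrow> l \<noteq> 0 \<Longrightarrow> 4 \<le> norm l"
  using lat4_eq_0 not_le by blast

lemma lat4_reduce: "\<exists>l\<in>lat4. a - l \<in> {-2..2} \<times> {-2..2}"
proof -
  have "\<exists>n :: int. x - 4 * of_int n \<in> {-2..2}" for x :: real
  proof
    have "of_int \<lfloor>(x + 2) / 4\<rfloor> \<le> (x + 2) / 4" "(x + 2) / 4 < of_int \<lfloor>(x + 2) / 4\<rfloor> + 1" by linarith+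
    then show "x - 4 * of_int \<lfloor>(x + 2) / 4\<rfloor> \<in> {-2..2}" by (auto simp: field_simps)
  qed
  then obtain m n :: int where "fst a - 4 * of_int m \<in> {-2..2}" "snd a - 4 * of_int n \<in> {-2..2}" by metis
  then show ?thesis
    by (intro bexI[of _ "(4 * of_int m, 4 * of_int n)"]) (auto simp: lat4_def mem_Times_iff)
qed

definition wrap :: "real \<times> real \<Rightarrow> complex \<times> complex" where
  "wrap a = (cis (pi / 2 * fst a), cis (pi / 2 * snd a))"

lemma continuous_wrap: "continuous_on S wrap"
  unfolding wrap_def by (intro continuous_intros)

lemma wrap_add_lat4: "l \<in> lat4 \<Longrightarrow> wrap (a + l) = wrap a"
proof -
  have "cis (pi / 2 * (x + 4 * of_int n)) = cis (pi / 2 * x)" for x and n :: int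
  proof -
    have "pi / 2 * (x + 4 * of_int n) = pi / 2 * x + 2 * pi * of_int n" by (simp add: algebra_simps)
    then have "sin (pi / 2 * (x + 4 * of_int n)) = sin (pi / 2 * x) \<and> cos (pi / 2 * (x + 4 * of_int n)) = cos (pi / 2 * x)"
      using sin_cos_eq_iff by blast
    then show ?thesis by (simp add: complex_eq_iff)
  qed
  then show "l \<in> lat4 \<Longrightarrow> wrap (a + l) = wrap a" by (auto simp: lat4_def wrap_def)
qed

lemma dist_wrap: "dist (wrap a) (wrap b) = dist (wrap (a - b)) (wrap 0)"
proof -
  have "dist (cis u) (cis v) = dist (cis (u - v)) 1" for u v
  proof -
    have "cis u - cis v = cis v * (cis (u - v) - 1)" by (simp add: right_diff_distrib cis_mult)
    then show ?thesis by (simp add: dist_norm norm_mult)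
  qed
  from this[of "pi / 2 * fst a" "pi / 2 * fst b"] this[of "pi / 2 * snd a" "pi / 2 * snd b"]
  show ?thesis by (simp add: wrap_def dist_prod_def right_diff_distrib)
qed

lemma wrap_near:
  assumes "r > 0"
  shows "\<exists>\<delta>>0. \<forall>a b. dist (wrap a) (wrap b) < \<delta> \<longrightarrow> (\<exists>l\<in>lat4. norm (a - (b + l)) < r)"
proof -
  have "\<exists>\<eta>>0. \<forall>d\<in>{-2..2::real} \<times> {-2..2::real}. dist (wrap d) (wrap 0) < \<eta> \<longrightarrow> norm d < r"
  proof (rule compact_modulus)
    show "compact ({-2..2::real} \<times> {-2..2::real})" by (intro compact_Times compact_Icc)
    show "continuous_on ({-2..2} \<times> {-2..2}) (\<lambda>d. dist (wrap d) (wrap 0))"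
      by (intro continuous_intros continuous_wrap)
    show "continuous_on ({-2..2::real} \<times> {-2..2::real}) norm" by (intro continuous_intros)
    fix d :: "real \<times> real" assume d: "d \<in> {-2..2} \<times> {-2..2}" "dist (wrap d) (wrap 0) \<le> 0"
    then have "cis (pi / 2 * fst d) = cis (pi / 2 * 0)" "cis (pi / 2 * snd d) = cis (pi / 2 * 0)"
      by (auto simp: wrap_def)
    moreover have "\<bar>fst d\<bar> \<le> 2" "\<bar>snd d\<bar> \<le> 2" using d by auto
    ultimately have "fst d = 0" "snd d = 0"
      using cis_quarter_eq_bounded[of "fst d" 0] cis_quarter_eq_bounded[of "snd d" 0] by auto
    then have "d = 0" by (simp add: prod_eq_iff)
    then show "norm d < r" using assms by simp
  qed
  then obtain \<eta> where \<eta>: "\<eta> > 0"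
    "\<And>d. d \<in> {-2..2} \<times> {-2..2} \<Longrightarrow> dist (wrap d) (wrap 0) < \<eta> \<Longrightarrow> norm d < r" by blast
  have "\<exists>l\<in>lat4. norm (a - (b + l)) < r" if "dist (wrap a) (wrap b) < \<eta>" for a b
  proof -
    obtain l where l: "l \<in> lat4" "a - b - l \<in> {-2..2} \<times> {-2..2}" using lat4_reduce[of "a - b"] by (rule bexE)
    have "wrap (a - b - l) = wrap (a - b)" using wrap_add_lat4[OF lat4_uminus[OF l(1)], of "a - b"] by simp
    then have "norm (a - b - l) < r" using that \<eta>(2)[OF l(2)] dist_wrap[of a b] by simp
    then show ?thesis using l(1) by (auto simp: algebra_simps intro!: bexI[of _ l])
  qed
  then show ?thesis using \<eta>(1) by blast
qed

text \<open>The quantitative form of \<open>pillow_eq_iff\<close>. On pairs from a compact square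
  closeness is first obtained for \<open>wrap\<close>, which does not see the lattice;
  \<open>wrap_near\<close> then supplies the lattice vector.\<close>

lemma pillow_near:
  assumes "r > 0"
  shows "\<exists>\<delta>>0. \<forall>a b. dist (pillow a) (pillow b) < \<delta> \<longrightarrow>
    (\<exists>l\<in>lat4. norm (a - (b + l)) < r \<or> norm (a - (- b + l)) < r)"
proof -
  let ?Q = "({-2..2::real} \<times> {-2..2::real})"
  obtain \<delta>1 where d1: "\<delta>1 > 0" "\<And>a b. dist (wrap a) (wrap b) < \<delta>1 \<Longrightarrow> \<exists>l\<in>lat4. norm (a - (b + l)) < r"
    using wrap_near[OF assms] by blast
  have "\<exists>\<eta>>0. \<forall>p\<in>?Q \<times> ?Q. dist (pillow (fst p)) (pillow (snd p)) < \<eta> \<longrightarrow>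
    min (dist (wrap (fst p)) (wrap (snd p))) (dist (wrap (fst p)) (wrap (- snd p))) < \<delta>1"
  proof (rule compact_modulus)
    show "compact (?Q \<times> ?Q)" by (intro compact_Times compact_Icc)
    show "continuous_on (?Q \<times> ?Q) (\<lambda>p. dist (pillow (fst p)) (pillow (snd p)))"
      by (intro continuous_intros continuous_on_compose2[OF continuous_pillow[of UNIV]]) auto
    show "continuous_on (?Q \<times> ?Q) (\<lambda>p. min (dist (wrap (fst p)) (wrap (snd p))) (dist (wrap (fst p)) (wrap (- snd p))))"
      by (intro continuous_intros continuous_on_compose2[OF continuous_wrap[of UNIV]]) auto
    fix p assume "dist (pillow (fst p)) (pillow (snd p)) \<le> 0"
    then obtain l where "l \<in> lat4" "fst p = snd p + l \<or> fst p = - snd p + l"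
      using pillow_eq_iff[of "fst p" "snd p"] by auto
    then have "wrap (fst p) = wrap (snd p) \<or> wrap (fst p) = wrap (- snd p)" using wrap_add_lat4 by metis
    then show "min (dist (wrap (fst p)) (wrap (snd p))) (dist (wrap (fst p)) (wrap (- snd p))) < \<delta>1"
      using d1(1) by (auto simp: min_less_iff_disj)
  qed
  then obtain \<eta> where \<eta>: "\<eta> > 0" "\<And>a b. a \<in> ?Q \<Longrightarrow> b \<in> ?Q \<Longrightarrow> dist (pillow a) (pillow b) < \<eta> \<Longrightarrow>
      dist (wrap a) (wrap b) < \<delta>1 \<or> dist (wrap a) (wrap (- b)) < \<delta>1"
    by (force simp: min_less_iff_disj)
  have "\<exists>l\<in>lat4. norm (a - (b + l)) < r \<or> norm (a - (- b + l)) < r" if "dist (pillow a) (pillow b) < \<eta>" for a b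
  proof -
    obtain k where k: "k \<in> lat4" "a - k \<in> ?Q" using lat4_reduce[of a] by (rule bexE)
    obtain l where l: "l \<in> lat4" "b - l \<in> ?Q" using lat4_reduce[of b] by (rule bexE)
    have m: "- k \<in> lat4" "- l \<in> lat4" using k l lat4_uminus by auto
    have "pillow (a - k) = pillow a" "pillow (b - l) = pillow b" "wrap (a - k) = wrap a" "wrap (b - l) = wrap b" 
      "wrap (- (b - l)) = wrap (- b)"
      using pillow_add_lat4[OF m(1), of a] pillow_add_lat4[OF m(2), of b] wrap_add_lat4[OF m(1), of a]
        wrap_add_lat4[OF m(2), of b] wrap_add_lat4[OF l(1), of "- b"] by simp_all
    then have "dist (wrap a) (wrap b) < \<delta>1 \<or> dist (wrap a) (wrap (- b)) < \<delta>1"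
      using \<eta>(2)[OF k(2) l(2)] that by simp
    then show ?thesis using d1(2) by blast
  qed
  then show ?thesis using \<eta>(1) by blast
qed

lemma pillow_lift:
  assumes "r > 0"
  shows "\<exists>\<delta>>0. \<forall>b c. dist (pillow b) (pillow c) < \<delta> \<longrightarrow> (\<exists>c'. pillow c' = pillow c \<and> norm (c' - b) < r)"
proof -
  obtain \<delta> where d: "\<delta> > 0" "\<And>a b. dist (pillow a) (pillow b) < \<delta> \<Longrightarrow>
    \<exists>l\<in>lat4. norm (a - (b + l)) < r \<or> norm (a - (- b + l)) < r" using pillow_near[OF assms] by blast
  have "\<exists>c'. pillow c' = pillow c \<and> norm (c' - b) < r" if "dist (pillow b) (pillow c) < \<delta>" for b c
  proof -
    obtain l where l: "l \<in> lat4" "norm (b - (c + l)) < r \<or> norm (b - (- c + l)) < r" using d(2)[OF \<open>dist (pillow b) (pillow c) < \<delta>\<close>] by blast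
    have "pillow (c + l) = pillow c" "pillow (- c + l) = pillow c"
      using pillow_add_lat4[OF l(1), of c] pillow_add_lat4[OF l(1), of "- c"] by auto
    then show ?thesis using l(2) by (metis norm_minus_commute)
  qed
  then show ?thesis using d(1) by blast
qed

lemma pproj_near:
  assumes "\<beta> > 0"
  shows "\<exists>\<delta>>0. \<forall>t\<in>torus. \<forall>u\<in>torus. dist (pproj t) (pproj u) < \<delta> \<longrightarrow> dist t u < \<beta> \<or> dist t (deck u) < \<beta>"
proof -
  have "\<exists>\<eta>>0. \<forall>p\<in>torus \<times> torus. dist (pproj (fst p)) (pproj (snd p)) < \<eta> \<longrightarrow>
    min (dist (fst p) (snd p)) (dist (fst p) (deck (snd p))) < \<beta>"
  proof (rule compact_modulus)
    show "compact (torus \<times> torus)" by (intro compact_Times compact_torus)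
    show "continuous_on (torus \<times> torus) (\<lambda>p. dist (pproj (fst p)) (pproj (snd p)))"
      by (intro continuous_intros continuous_on_compose2[OF continuous_pproj]) auto
    show "continuous_on (torus \<times> torus) (\<lambda>p. min (dist (fst p) (snd p)) (dist (fst p) (deck (snd p))))"
      by (intro continuous_intros)
    fix p :: "(complex \<times> complex) \<times> complex \<times> complex"
    assume "p \<in> torus \<times> torus" "dist (pproj (fst p)) (pproj (snd p)) \<le> 0"
    then have "fst p = snd p \<or> fst p = deck (snd p)"
      using pproj_eq[of "snd p" "fst p"] by (auto simp: mem_Times_iff)
    then show "min (dist (fst p) (snd p)) (dist (fst p) (deck (snd p))) < \<beta>"
      using assms by (auto simp: min_less_iff_disj)
  qed
  then show ?thesis by (force simp: min_less_iff_disj)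
qed

text \<open>The images under \<open>pillow\<close> of (1, 0), (1, 2), (0, 1) and (2, 1), the
  midpoints of the four edges of the pillowcase.\<close>

definition branch_vals :: "(real \<times> real \<times> real) set" where
  "branch_vals = {(0, 1, 0), (0, - 1, 0), (1, 0, 0), (- 1, 0, 0)}"

lemma pproj_fixed_deck:
  assumes "t \<in> torus" "deck t = t" shows "pproj t \<in> branch_vals"
proof -
  obtain z w where t: "t = (z, w)" by (cases t)
  have r: "u = 1 \<or> u = - 1" if "cnj u = u" "norm u = 1" for u
  proof -
    have "Im u = 0" using that(1) by (simp add: complex_eq_iff)
    then have "\<bar>Re u\<bar> = 1" using that(2) by (simp add: cmod_eq_Re)
    then show ?thesis using \<open>Im u = 0\<close> by (auto simp: complex_eq_iff)
  qed
  have z: "z = 1 \<or> z = - 1" "w = 1 \<or> w = - 1" using assms r by (auto simp: t deck_def torus_def)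
  have tr: "tri 0 = 0" "tri 1 = 1" "tri 2 = 2" "tri 3 = 1" "tri 4 = 0"
    using tri_shift2[of 1] tri_shift2[of 2] by (simp_all add: tri_id)
  have g: "gap 1 0 = 0" "gap 0 1 = 0" "gap 2 1 = 2" by (simp_all add: gap_def)
  have c: "chart 1 0" "chart (-1) 0" "chart 1 1" by (simp_all add: chart_def)
  have p: "cyl 1 1 0 = (1, 1)" "cyl (-1) 1 0 = (-1, -1)" "cyl 1 0 1 = (1, -1)" "cyl 1 2 1 = (-1, 1)"
    by (simp_all add: cyl_def tr g)
  have s: "pproj (1, 1) = (0, 1, 0)" "pproj (-1, -1) = (0, -1, 0)" "pproj (1, -1) = (1, 0, 0)"
      "pproj (-1, 1) = (-1, 0, 0)"
    using pproj_cyl[OF c(1), of 1] pproj_cyl[OF c(2), of 1] pproj_cyl[OF c(3), of 0] pproj_cyl[OF c(3), of 2]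
    by (simp_all add: p sval_def)
  show ?thesis using z s by (auto simp: t branch_vals_def)
qed

lemma pproj_near_branch:
  assumes "\<zeta> > 0"
  shows "\<exists>\<eta>>0. \<forall>t\<in>torus. dist t (deck t) < \<eta> \<longrightarrow> (\<exists>c\<in>branch_vals. dist (pproj t) c < \<zeta>)"
proof -
  have B: "finite branch_vals" "branch_vals \<noteq> {}" by (auto simp: branch_vals_def)
  have "\<exists>\<eta>>0. \<forall>t\<in>torus. dist t (deck t) < \<eta> \<longrightarrow> infdist (pproj t) branch_vals < \<zeta>"
  proof (rule compact_modulus[OF compact_torus])
    show "continuous_on torus (\<lambda>t. dist t (deck t))" by (intro continuous_intros)
    show "continuous_on torus (\<lambda>t. infdist (pproj t) branch_vals)"
      by (intro continuous_on_infdist continuous_pproj)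
    fix t assume "t \<in> torus" "dist t (deck t) \<le> 0"
    then have "pproj t \<in> branch_vals" using pproj_fixed_deck by simp
    then show "infdist (pproj t) branch_vals < \<zeta>" using assms by simp
  qed
  moreover have "\<exists>c\<in>branch_vals. dist v c < \<zeta>" if "infdist v branch_vals < \<zeta>" for v
    using infdist_attains_inf[of branch_vals v] B that by (metis finite_imp_closed)
  ultimately show ?thesis by blast
qed

section \<open>Lifting small continua to bounded linear orbits\<close>

text \<open>The lattice spacing is 4, so at most one point of \<open>- m + lat4\<close> can be near
  \<open>m\<close>. If there is one within \<open>3 * r\<close>, its ball and that of
  \<open>m\<close> both lie inside radius \<open>4 * r\<close>, and \<open>4.5 * r\<close> is free.
  Otherwise the ball of \<open>m\<close> has radius \<open>r\<close>, all others begin beyond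
  \<open>2 * r\<close>, and \<open>1.5 * r\<close> is free.\<close>

lemma lattice_free_radius:
  fixes m :: "real \<times> real"
  assumes r: "0 < r" "r \<le> 1 / 4"
    and Y: "\<And>b. b \<in> Y \<Longrightarrow> \<exists>l\<in>lat4. norm (b - (m + l)) < r \<or> norm (b - (- m + l)) < r"
  shows "\<exists>R. r < R \<and> R < 5 * r \<and> (\<forall>b\<in>Y. norm (b - m) \<noteq> R)"
proof (cases "\<exists>l\<in>lat4. norm (- m + l - m) \<le> 3 * r")
  case True
  then obtain l0 where l0: "l0 \<in> lat4" "norm (- m + l0 - m) \<le> 3 * r" by blast
  have "norm (b - m) < 4.5 * r \<or> norm (b - m) > 4.5 * r" if b: "b \<in> Y" for b
  proof -
    obtain l where l: "l \<in> lat4" "norm (b - (m + l)) < r \<or> norm (b - (- m + l)) < r" using Y[OF b] by blast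
    from l(2) show ?thesis
    proof
      assume a: "norm (b - (m + l)) < r"
      show ?thesis
      proof (cases "l = 0")
        case False
        then have "norm l \<ge> 4" using lat4_norm_ge l(1) by blast
        moreover have "norm l \<le> norm (b - m) + norm (b - (m + l))"
          using norm_triangle_ineq4[of "b - m" "b - (m + l)"] by simp
        ultimately show ?thesis using a r by linarith
      qed (use a r in auto)
    next
      assume a: "norm (b - (- m + l)) < r"
      show ?thesis
      proof (cases "l = l0")
        case True
        have "norm (b - m) \<le> norm (b - (- m + l)) + norm (- m + l - m)"
          using norm_triangle_ineq[of "b - (- m + l)" "- m + l - m"] by simp
        then show ?thesis using a l0(2) r unfolding True by linarith
      next
        case False
        then have "norm (l - l0) \<ge> 4" using lat4_norm_ge[OF lat4_diff[OF l(1) l0(1)]] by simp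
        moreover have "norm (l - l0) \<le> norm (- m + l - m) + norm (- m + l0 - m)"
          using norm_triangle_ineq4[of "- m + l - m" "- m + l0 - m"] by simp
        moreover have "norm (- m + l - m) \<le> norm (b - m) + norm (b - (- m + l))"
          using norm_triangle_ineq4[of "b - m" "b - (- m + l)"] by (simp add: algebra_simps)
        ultimately show ?thesis using a l0(2) r by linarith
      qed
    qed
  qed
  then show ?thesis using r by (intro exI[of _ "4.5 * r"]) force
next
  case False
  have "norm (b - m) < 1.5 * r \<or> norm (b - m) > 1.5 * r" if b: "b \<in> Y" for b
  proof -
    obtain l where l: "l \<in> lat4" "norm (b - (m + l)) < r \<or> norm (b - (- m + l)) < r" using Y[OF b] by blast
    from l(2) show ?thesis
    proof
      assume a: "norm (b - (m + l)) < r"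
      show ?thesis
      proof (cases "l = 0")
        case False
        then have "norm l \<ge> 4" using lat4_norm_ge l(1) by blast
        moreover have "norm l \<le> norm (b - m) + norm (b - (m + l))"
          using norm_triangle_ineq4[of "b - m" "b - (m + l)"] by simp
        ultimately show ?thesis using a r by linarith
      qed (use a r in auto)
    next
      assume a: "norm (b - (- m + l)) < r"
      have "norm (- m + l - m) > 3 * r" using False l(1) by force
      moreover have "norm (- m + l - m) \<le> norm (b - m) + norm (b - (- m + l))"
        using norm_triangle_ineq4[of "b - m" "b - (- m + l)"] by (simp add: algebra_simps)
      ultimately show ?thesis using a r by linarith
    qed
  qed
  then show ?thesis using r by (intro exI[of _ "1.5 * r"]) force
qed

lemma linear_funpow: "linear (L :: 'a::real_vector \<Rightarrow> 'a) \<Longrightarrow> linear (L ^^ k)"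
proof (induction k)
  case (Suc k)
  then show ?case using linear_compose[of "L ^^ k" L] by (simp add: o_def)
qed (simp add: id_def linear_iff)

text \<open>
  The sets \<open>W n\<close> of lifts that stay close to \<open>a\<close> up to time \<open>n\<close> are relatively clopen, because no lift
  lies on the spheres of radius \<open>R k\<close>; connectedness of \<open>K\<close> excludes a change of the sign, which a
  single orbit could perform near a cone point.
\<close>

lemma continuum_shadow:
  fixes f :: "complex \<times> complex \<Rightarrow> complex \<times> complex" and L :: "real \<times> real \<Rightarrow> real \<times> real"
  assumes L: "linear L"
    and f: "\<And>t. t \<in> torus \<Longrightarrow> f t \<in> torus"
    and semi: "\<And>t b. t \<in> torus \<Longrightarrow> pproj t = pillow b \<Longrightarrow> pproj (f t) = pillow (L b)"
    and r: "0 < r" "r \<le> 1 / 4"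
    and \<delta>: "\<And>a b. dist (pillow a) (pillow b) < \<delta> \<Longrightarrow> \<exists>l\<in>lat4. norm (a - (b + l)) < r \<or> norm (a - (- b + l)) < r"
    and K: "K \<subseteq> torus" "connected K" "compact K" "w \<in> K" "pproj w = pillow a"
    and close: "\<And>k t. t \<in> K \<Longrightarrow> dist (pproj ((f ^^ k) t)) (pproj ((f ^^ k) w)) < \<delta>"
    and t: "t \<in> K"
  shows "\<exists>c. pillow c = pproj t \<and> (\<forall>k. norm ((L ^^ k) (c - a)) \<le> 5 * r)"
proof -
  have fk: "(f ^^ k) t \<in> torus" if "t \<in> torus" for t k
    using that f by (induction k) auto
  have semik: "pproj ((f ^^ k) t) = pillow ((L ^^ k) b)" if "t \<in> torus" "pproj t = pillow b" for t b k
    using that fk semi by (induction k) auto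
  have Lk: "linear (L ^^ k)" for k using linear_funpow[OF L] .
  have Ld: "(L ^^ k) (c - a) = (L ^^ k) c - (L ^^ k) a" for k c using linear_diff[OF Lk] .
  have "\<exists>R. r < R \<and> R < 5 * r \<and> (\<forall>b \<in> (L ^^ k) ` (pillow -` (pproj ` K)). norm (b - (L ^^ k) a) \<noteq> R)" for k
  proof (rule lattice_free_radius[OF r])
    fix b assume "b \<in> (L ^^ k) ` (pillow -` (pproj ` K))"
    then obtain c u where "b = (L ^^ k) c" "u \<in> K" "pillow c = pproj u" by auto
    moreover have "u \<in> torus" "w \<in> torus" using \<open>u \<in> K\<close> K by blast+
    ultimately have "dist (pillow b) (pillow ((L ^^ k) a)) < \<delta>"
      using close[of u k] semik[of u c k] semik[of w a k] K(5) by simp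
    then show "\<exists>l\<in>lat4. norm (b - ((L ^^ k) a + l)) < r \<or> norm (b - (- (L ^^ k) a + l)) < r" by (rule \<delta>)
  qed
  then have "\<exists>R. r < R \<and> R < 5 * r \<and> (\<forall>c. pillow c \<in> pproj ` K \<longrightarrow> norm ((L ^^ k) (c - a)) \<noteq> R)" for k
    unfolding Ld by (meson imageI vimageI2)
  then obtain R where R: "\<And>k. r < R k" "\<And>k. R k < 5 * r"
    "\<And>k c. pillow c \<in> pproj ` K \<Longrightarrow> norm ((L ^^ k) (c - a)) \<noteq> R k"
    by metis
  define W where "W n = {c. pillow c \<in> pproj ` K \<and> (\<forall>k\<le>n. norm ((L ^^ k) (c - a)) \<le> R k)}" for n :: nat
  have contL: "continuous_on UNIV (\<lambda>c. norm ((L ^^ k) (c - a)))" for k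
  proof -
    have "continuous_on UNIV (\<lambda>c. (L ^^ k) (c - a))"
      using linear_continuous_on_compose[OF _ Lk[of k], of UNIV "\<lambda>c. c - a"] by (simp add: continuous_intros)
    then show ?thesis by (rule continuous_on_norm)
  qed
  have cK: "compact (pproj ` K)"
    using K by (intro compact_continuous_image continuous_on_subset[OF continuous_pproj])
  have cW: "compact (W n)" for n
  proof -
    have "W n = pillow -` (pproj ` K) \<inter> (\<Inter>k\<in>{..n}. {c. norm ((L ^^ k) (c - a)) \<le> R k})"
      by (auto simp: W_def)
    moreover have "closed (pillow -` (pproj ` K))"
      using continuous_pillow[of UNIV] compact_imp_closed[OF cK] by (simp add: continuous_on_closed_vimage)
    moreover have "closed {c. norm ((L ^^ k) (c - a)) \<le> R k}" for k
      using contL[of k] by (intro closed_Collect_le continuous_on_const)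
    ultimately have "closed (W n)" by (auto intro!: closed_Int closed_INT)
    moreover have "W n \<subseteq> cball a (R 0)"
      by (auto simp: W_def dist_norm norm_minus_commute dest!: spec[of _ 0])
    ultimately show ?thesis using compact_Int_closed[OF compact_cball, of "W n" a "R 0"] by (simp add: inf.absorb2)
  qed
  have surj: "pillow ` W n = pproj ` K" for n
  proof -
    have "connected (pproj ` K)"
      using K by (intro connected_continuous_image continuous_on_subset[OF continuous_pproj])
    moreover have sub: "pillow ` W n \<subseteq> pproj ` K" by (auto simp: W_def)
    moreover have "closedin (top_of_set (pproj ` K)) (pillow ` W n)"
      using sub cW continuous_pillow by (intro closed_subset compact_imp_closed compact_continuous_image)
    moreover have "openin (top_of_set (pproj ` K)) (pillow ` W n)"
      unfolding openin_euclidean_subtopology_iff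
    proof (intro conjI ballI sub)
      fix s assume "s \<in> pillow ` W n"
      then obtain c where c: "c \<in> W n" "s = pillow c" by blast
      define U where "U = (\<Inter>k\<in>{..n}. {c. norm ((L ^^ k) (c - a)) < R k})"
      have "open U"
        unfolding U_def using contL by (intro open_INT ballI open_Collect_less continuous_on_const finite_atMost)
      moreover have "c \<in> U" using c(1) R(3)[of c] by (force simp: U_def W_def le_less)
      ultimately obtain e where e: "e > 0" "ball c e \<subseteq> U" using open_contains_ball by blast
      obtain d where d: "d > 0" "\<And>b c. dist (pillow b) (pillow c) < d \<Longrightarrow> \<exists>c'. pillow c' = pillow c \<and> norm (c' - b) < e"
        using pillow_lift[OF e(1)] by blast
      have "s' \<in> pillow ` W n" if s': "s' \<in> pproj ` K" "dist s' s < d" for s'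
      proof -
        obtain b where b: "s' = pillow b" using s'(1) K(1) pproj_pillow by blast
        then obtain c' where c': "pillow c' = s'" "norm (c' - c) < e"
          using d(2)[of c b] s'(2) c(2) by (auto simp: dist_commute)
        then have "c' \<in> U" using e(2) by (auto simp: dist_norm norm_minus_commute)
        then have "c' \<in> W n" using s'(1) c'(1) by (auto simp: U_def W_def intro: less_imp_le)
        then show ?thesis using c'(1) by blast
      qed
      then show "\<exists>e>0. \<forall>x'\<in>pproj ` K. dist x' s < e \<longrightarrow> x' \<in> pillow ` W n" using d(1) by blast
    qed
    moreover have "a \<in> W n"
    proof -
      have "0 \<le> R k" for k using R(1)[of k] r by linarith
      moreover have "pillow a \<in> pproj ` K" using K(4,5) by (metis imageI)
      ultimately show ?thesis by (simp add: W_def linear_0[OF Lk])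
    qed
    ultimately show ?thesis using connected_clopen[of "pproj ` K"] by blast
  qed
  \<comment> \<open>The lift found for the time bound \<open>n\<close> may depend on
    \<open>n\<close>; nested compact sets of candidates yield one lift that works for all
    times.\<close>
  define V where "V n = W n \<inter> pillow -` {pproj t}" for n
  have "\<Inter> (range V) \<noteq> {}"
  proof (rule compact_nest)
    fix n
    have "closed (pillow -` {pproj t})"
      using continuous_pillow[of UNIV] by (simp add: continuous_on_closed_vimage)
    then show "compact (V n)" unfolding V_def using cW by (rule compact_Int_closed[rotated])
    have "pproj t \<in> pillow ` W n" using surj[of n] t by simp
    then show "V n \<noteq> {}" by (force simp: V_def)
  next
    show "V n \<subseteq> V m" if "m \<le> n" for m n using that by (force simp: V_def W_def)
  qed
  then obtain c where c: "\<And>n. c \<in> V n" by blast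
  have "norm ((L ^^ k) (c - a)) \<le> 5 * r" for k
    using c[of k] R(2)[of k] by (force simp: V_def W_def)
  moreover have "pillow c = pproj t" using c[of 0] by (simp add: V_def)
  ultimately show ?thesis by blast
qed

text \<open>An eigenfunctional with factor of modulus above 1 grows geometrically along the orbit,
  so on a bounded orbit it must vanish.\<close>

lemma expanding_functional_zero:
  fixes L :: "'a::real_normed_vector \<Rightarrow> 'a" and \<phi> :: "'a \<Rightarrow> real"
  assumes "\<And>v. \<bar>\<phi> (L v)\<bar> = \<kappa> * \<bar>\<phi> v\<bar>" "\<kappa> > 1" "\<And>v. \<bar>\<phi> v\<bar> \<le> B * norm v" "B \<ge> 0"
    and "\<And>k. norm ((L ^^ k) v) \<le> C"
  shows "\<phi> v = 0"
proof (rule ccontr)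
  assume "\<phi> v \<noteq> 0"
  have k: "\<bar>\<phi> ((L ^^ k) v)\<bar> = \<kappa> ^ k * \<bar>\<phi> v\<bar>" for k
    by (induction k) (simp_all add: assms(1))
  obtain n where "\<kappa> ^ n > B * C / \<bar>\<phi> v\<bar>" using real_arch_pow[OF assms(2)] by blast
  then have "\<kappa> ^ n * \<bar>\<phi> v\<bar> > B * C" using \<open>\<phi> v \<noteq> 0\<close> by (simp add: field_simps)
  moreover have "\<kappa> ^ n * \<bar>\<phi> v\<bar> \<le> B * C"
    using assms(3)[of "(L ^^ n) v"] mult_left_mono[OF assms(5)[of n] assms(4)] unfolding k by linarith
  ultimately show False by simp
qed

section \<open>Local product structure and cw-expansivity\<close>

text \<open>The expanding eigenvalue of \<open>cat\<close>. The determinant is -1, so the other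
  eigenvalue is \<open>- 1 / lam\<close>, that is \<open>8 - lam\<close>.\<close>

definition lam :: real where "lam = 4 + sqrt 17"

lemma lam_gt: "lam > 8" and lam_sq: "lam * lam = 8 * lam + 1" and lam_inv: "1 / lam = lam - 8"
proof -
  have "sqrt 17 > sqrt 16" by (rule real_sqrt_less_mono) simp
  then show g: "lam > 8" by (simp add: lam_def)
  show sq: "lam * lam = 8 * lam + 1" by (simp add: lam_def algebra_simps)
  show "1 / lam = lam - 8" using g sq by (simp add: field_simps)
qed

definition twist :: "complex \<times> complex \<Rightarrow> complex \<times> complex" where
  "twist t = shear 1 (flip t)"

definition untwist :: "complex \<times> complex \<Rightarrow> complex \<times> complex" where
  "untwist t = flip (shear (- 1) t)"

definition cat :: "real \<times> real \<Rightarrow> real \<times> real" where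
  "cat b = (8 * fst b + snd b, fst b)"

definition icat :: "real \<times> real \<Rightarrow> real \<times> real" where
  "icat b = (snd b, fst b - 8 * snd b)"

lemma linear_cat: "linear cat" and linear_icat: "linear icat"
  by (auto simp: linear_iff cat_def icat_def algebra_simps)

lemma icat_cat [simp]: "icat (cat b) = b"
  by (simp add: cat_def icat_def)

lemma twist_in_torus: "t \<in> torus \<Longrightarrow> twist t \<in> torus"
  and untwist_in_torus: "t \<in> torus \<Longrightarrow> untwist t \<in> torus"
  by (simp_all add: twist_def untwist_def shear_in_torus)

lemma twist_untwist: "t \<in> torus \<Longrightarrow> twist (untwist t) = t"
  and untwist_twist: "t \<in> torus \<Longrightarrow> untwist (twist t) = t"
  using shear_shear[of t 1] shear_shear[of "flip t" "- 1"] by (simp_all add: twist_def untwist_def)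

lemma continuous_twist: "continuous_on torus twist"
  unfolding twist_def
  by (rule continuous_on_compose2[OF continuous_shear continuous_flip]) auto

lemma continuous_untwist: "continuous_on torus untwist"
  unfolding untwist_def
  by (rule continuous_on_compose2[OF continuous_flip[of UNIV] continuous_shear]) auto

lemma homeomorphism_twist: "homeomorphism torus torus twist untwist"
proof (rule homeomorphismI)
  show "twist ` torus \<subseteq> torus" "untwist ` torus \<subseteq> torus"
    using twist_in_torus untwist_in_torus by auto
qed (simp_all add: continuous_twist continuous_untwist twist_untwist untwist_twist)

lemma swap12_pillow: "swap12 (pillow b) = pillow (snd b, fst b)"
  by (simp add: swap12_def pillow_def mult.commute)

lemma pproj_twist:
  assumes "t \<in> torus" "pproj t = pillow b" shows "pproj (twist t) = pillow (cat b)"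
  using pproj_shear[of "flip t" "(snd b, fst b)" 1] pproj_flip[OF assms(1)] assms
  by (simp add: twist_def swap12_pillow cat_def add.commute)

lemma pproj_untwist:
  assumes "t \<in> torus" "pproj t = pillow b" shows "pproj (untwist t) = pillow (icat b)"
  using pproj_shear[OF assms, of "- 1"] pproj_flip[OF shear_in_torus[OF assms(1), of "- 1"]]
  by (simp add: untwist_def swap12_pillow icat_def)

lemma funpow_twist_in_torus: "t \<in> torus \<Longrightarrow> (twist ^^ k) t \<in> torus"
  by (induction k) (auto simp: twist_in_torus)

lemma funpow_untwist_in_torus: "t \<in> torus \<Longrightarrow> (untwist ^^ k) t \<in> torus"
  by (induction k) (auto simp: untwist_in_torus)

lemma iterate_twist_int [simp]: "iterate torus twist (int k) t = (twist ^^ k) t"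
  by (simp add: iterate_def)

lemma iterate_twist_neg:
  assumes "t \<in> torus" shows "iterate torus twist (- int k) t = (untwist ^^ k) t"
proof (cases "k = 0")
  case False
  have inv: "inv_into torus twist u = untwist u" if "u \<in> torus" for u
    by (rule inv_into_f_eq) (use that in \<open>auto simp: untwist_in_torus twist_untwist intro: inj_on_inverseI untwist_twist\<close>)
  have "(inv_into torus twist ^^ k) t = (untwist ^^ k) t"
    by (induction k) (use assms in \<open>auto simp: inv funpow_untwist_in_torus\<close>)
  then show ?thesis using False by (simp add: iterate_def)
qed (simp add: iterate_def)

lemma pillow_uniform:
  assumes "e > 0"
  shows "\<exists>\<rho>>0. \<forall>a b. norm (a - b) < \<rho> \<longrightarrow> dist (pillow a) (pillow b) < e"
proof -
  have "uniformly_continuous_on ({-3..3::real} \<times> {-3..3::real}) pillow"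
    by (intro compact_uniformly_continuous continuous_pillow compact_Times compact_Icc)
  then obtain d where d: "d > 0" "\<And>a b. a \<in> {-3..3} \<times> {-3..3} \<Longrightarrow> b \<in> {-3..3} \<times> {-3..3} \<Longrightarrow> dist a b < d
      \<Longrightarrow> dist (pillow a) (pillow b) < e"
    using assms unfolding uniformly_continuous_on_def by (metis dist_commute)
  have "dist (pillow a) (pillow b) < e" if ab: "norm (a - b) < min d 1" for a b
  proof -
    obtain l where l: "l \<in> lat4" "a - l \<in> {-2..2} \<times> {-2..2}" using lat4_reduce[of a] by (rule bexE)
    have "\<bar>fst a - fst b\<bar> \<le> 1" "\<bar>snd a - snd b\<bar> \<le> 1"
      using abs_fst_le_norm[of "a - b"] abs_snd_le_norm[of "a - b"] ab by auto
    then have "a - l \<in> {-3..3} \<times> {-3..3}" "b - l \<in> {-3..3} \<times> {-3..3}"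
      using l(2) by (auto simp: mem_Times_iff)
    moreover have "dist (a - l) (b - l) < d" using ab by (simp add: dist_norm)
    moreover have "pillow (a - l) = pillow a" "pillow (b - l) = pillow b"
      using pillow_add_lat4[OF lat4_uminus[OF l(1)], of a] pillow_add_lat4[OF lat4_uminus[OF l(1)], of b] by auto
    ultimately show ?thesis using d(2) by metis
  qed
  then show ?thesis using d(1) by (intro exI[of _ "min d 1"]) auto
qed

text \<open>Half lattice vectors are the lifts of the cone points: both cosines there are 1 or -1,
  while one of them is 0 at each branch value.\<close>

lemma half_lattice_far_from_branch:
  assumes "l \<in> lat4" "c \<in> branch_vals" shows "1 \<le> dist (pillow ((1 / 2) *\<^sub>R l)) c"
proof -
  obtain m n :: int where l: "l = (4 * of_int m, 4 * of_int n)" using assms(1) by (auto simp: lat4_def)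
  define v where "v = pillow ((1 / 2) *\<^sub>R l)"
  have "\<bar>cos (pi * of_int k)\<bar> = 1" for k :: int
    by (cases "even k") (simp_all add: cos_npi_int mult.commute)
  then have v: "\<bar>fst v\<bar> = 1" "\<bar>fst (snd v)\<bar> = 1" by (simp_all add: v_def l pillow_def)
  have "dist (fst v) (fst c) \<le> dist v c" "dist (fst (snd v)) (fst (snd c)) \<le> dist v c"
    using dist_fst_le[of v c] dist_snd_le[of v c] dist_fst_le[of "snd v" "snd c"] by auto
  moreover have "fst c = 0 \<or> fst (snd c) = 0" using assms(2) by (auto simp: branch_vals_def)
  ultimately show ?thesis using v by (auto simp: v_def dist_real_def)
qed

section \<open>Stable and unstable linear coordinates\<close>

text \<open>Eigenfunctionals: \<open>ucoord\<close> expands under \<open>cat\<close> and vanishes on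
  the stable line, spanned by (-1, \<open>lam\<close>); \<open>scoord\<close> expands under
  \<open>icat\<close> and vanishes on the unstable line, spanned by (1,
  \<open>1 / lam\<close>).\<close>

definition ucoord :: "real \<times> real \<Rightarrow> real" where "ucoord b = lam * fst b + snd b"
definition scoord :: "real \<times> real \<Rightarrow> real" where "scoord b = snd b - fst b / lam"

lemma ucoord_cat: "ucoord (cat b) = lam * ucoord b"
proof -
  have "lam * lam * fst b = (8 * lam + 1) * fst b" by (simp add: lam_sq)
  then show ?thesis by (simp add: ucoord_def cat_def algebra_simps)
qed

lemma scoord_icat: "scoord (icat b) = - lam * scoord b"
proof -
  have "snd b / lam = (lam - 8) * snd b" unfolding lam_inv[symmetric] by simp
  then show ?thesis using lam_gt by (simp add: scoord_def icat_def algebra_simps)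
qed

lemma ucoord_diff: "ucoord (a - b) = ucoord a - ucoord b" and scoord_diff: "scoord (a - b) = scoord a - scoord b"
  by (simp_all add: ucoord_def scoord_def algebra_simps diff_divide_distrib)

lemma coords_zero: "ucoord b = 0 \<Longrightarrow> scoord b = 0 \<Longrightarrow> b = 0"
proof -
  assume b: "ucoord b = 0" "scoord b = 0"
  then have "(lam + 1 / lam) * fst b = 0" by (simp add: ucoord_def scoord_def algebra_simps)
  moreover have "lam + 1 / lam > 0" using lam_gt by (intro add_pos_pos) auto
  ultimately have "fst b = 0" by simp
  then show "b = 0" using b by (simp add: ucoord_def prod_eq_iff)
qed

lemma stable_ucoord: "(\<And>k. norm ((cat ^^ k) v) \<le> C) \<Longrightarrow> ucoord v = 0"
proof (rule expanding_functional_zero[of ucoord cat lam "lam + 1"])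
  show "\<bar>ucoord (cat v)\<bar> = lam * \<bar>ucoord v\<bar>" for v using lam_gt by (simp add: ucoord_cat abs_mult)
  show "\<bar>ucoord v\<bar> \<le> (lam + 1) * norm v" for v
  proof -
    have "\<bar>ucoord v\<bar> \<le> lam * \<bar>fst v\<bar> + \<bar>snd v\<bar>"
      using lam_gt abs_triangle_ineq[of "lam * fst v" "snd v"] by (simp add: ucoord_def abs_mult)
    also have "\<dots> \<le> lam * norm v + norm v"
      using lam_gt by (intro add_mono mult_left_mono abs_fst_le_norm abs_snd_le_norm) auto
    finally show ?thesis by (simp add: algebra_simps)
  qed
qed (use lam_gt in auto)

lemma unstable_scoord: "(\<And>k. norm ((icat ^^ k) v) \<le> C) \<Longrightarrow> scoord v = 0"
proof (rule expanding_functional_zero[of scoord icat lam 2])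
  show "\<bar>scoord (icat v)\<bar> = lam * \<bar>scoord v\<bar>" for v using lam_gt by (simp add: scoord_icat abs_mult)
  show "\<bar>scoord v\<bar> \<le> 2 * norm v" for v
  proof -
    have "\<bar>fst v / lam\<bar> \<le> \<bar>fst v\<bar>" using lam_gt mult_right_mono[of 1 lam "\<bar>fst v\<bar>"]
      by (simp add: divide_le_eq mult.commute)
    then show ?thesis using abs_fst_le_norm[of v] abs_snd_le_norm[of v] unfolding scoord_def by linarith
  qed
qed (use lam_gt in auto)

lemma dist_le_diameter_torus:
  "S \<subseteq> torus \<Longrightarrow> diameter S \<le> \<alpha> \<Longrightarrow> x \<in> S \<Longrightarrow> y \<in> S \<Longrightarrow> dist x y \<le> \<alpha>"
  using diameter_bounded_bound[of S x y] bounded_subset[OF compact_imp_bounded[OF compact_torus]] by force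

lemma card_le_2_if_no_three:
  assumes "\<And>x y z. x \<in> S \<Longrightarrow> y \<in> S \<Longrightarrow> z \<in> S \<Longrightarrow> x = y \<or> y = z \<or> x = z"
  shows "finite S \<and> card S \<le> 2"
proof -
  have "\<exists>x y. S \<subseteq> {x, y}"
  proof (cases "S = {}")
    case False
    then obtain x where x: "x \<in> S" by blast
    show ?thesis
    proof (cases "S \<subseteq> {x}")
      case False
      then obtain y where "y \<in> S" "y \<noteq> x" by blast
      then have "S \<subseteq> {x, y}" using assms x by blast
      then show ?thesis by blast
    qed blast
  qed blast
  then obtain x y where "S \<subseteq> {x, y}" by blast
  moreover have "card {x, y} \<le> 2" by (simp add: card_insert_if)
  ultimately show ?thesis using card_mono[of "{x, y}" S] finite_subset[of S "{x, y}"] by auto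
qed

lemma cw_expansive_twist: "cw_expansive 2 torus twist"
proof -
  obtain \<rho> where \<rho>: "\<rho> > 0" "\<And>a b. norm (a - b) < \<rho> \<Longrightarrow> dist (pillow a) (pillow b) < 1 / 4"
    using pillow_uniform[of "1 / 4"] by auto
  \<comment> \<open>With \<open>20 * r < 4\<close> the four displacements compared in
    \<open>opt_unique\<close> are too short for a nonzero lattice vector;
    \<open>10 * r < \<rho>\<close> keeps the points in \<open>inj\<close> close to the cone
    point.\<close>
  define r where "r = min (1 / 20) (\<rho> / 20)"
  have r: "0 < r" "r \<le> 1 / 4" "20 * r < 4" "10 * r < \<rho>" using \<rho>(1) by (auto simp: r_def min_def)
  obtain \<delta> where \<delta>: "\<delta> > 0" "\<And>a b. dist (pillow a) (pillow b) < \<delta> \<Longrightarrow>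
      \<exists>l\<in>lat4. norm (a - (b + l)) < r \<or> norm (a - (- b + l)) < r"
    using pillow_near[OF r(1)] by blast
  obtain \<eta> where \<eta>: "\<eta> > 0" "\<And>t. t \<in> torus \<Longrightarrow> dist t (deck t) < \<eta> \<Longrightarrow>
      \<exists>c\<in>branch_vals. dist (pproj t) c < 1 / 2"
    using pproj_near_branch[of "1 / 2"] by auto
  have "uniformly_continuous_on torus pproj"
    using continuous_pproj compact_torus by (rule compact_uniformly_continuous)
  then obtain \<gamma> where \<gamma>: "\<gamma> > 0"
    "\<And>t u. t \<in> torus \<Longrightarrow> u \<in> torus \<Longrightarrow> dist t u < \<gamma> \<Longrightarrow> dist (pproj t) (pproj u) < \<delta>"
    using \<delta>(1) unfolding uniformly_continuous_on_def by (metis dist_commute)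
  define \<alpha> where "\<alpha> = min (\<gamma> / 2) (\<eta> / 2)"
  have \<alpha>: "\<alpha> > 0" "\<alpha> < \<gamma>" "\<alpha> < \<eta>" using \<gamma>(1) \<eta>(1) by (auto simp: \<alpha>_def min_def)
  have "finite (A \<inter> B) \<and> card (A \<inter> B) \<le> 2"
    if A: "A \<subseteq> torus" "continuum A" "\<forall>k\<ge>0. diameter (iterate torus twist k ` A) \<le> \<alpha>"
      and B: "B \<subseteq> torus" "continuum B" "\<forall>k\<le>0. diameter (iterate torus twist k ` B) \<le> \<alpha>" for A B
  proof -
    have closeA: "dist ((twist ^^ k) t) ((twist ^^ k) w) \<le> \<alpha>" if "t \<in> A" "w \<in> A" for k t w
    proof (rule dist_le_diameter_torus)
      show "(twist ^^ k) ` A \<subseteq> torus" using A(1) funpow_twist_in_torus by auto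
      show "diameter ((twist ^^ k) ` A) \<le> \<alpha>" using A(3)[rule_format, of "int k"] by simp
    qed (use that in auto)
    have closeB: "dist ((untwist ^^ k) t) ((untwist ^^ k) w) \<le> \<alpha>" if "t \<in> B" "w \<in> B" for k t w
    proof (rule dist_le_diameter_torus)
      show "(untwist ^^ k) ` B \<subseteq> torus" using B(1) funpow_untwist_in_torus by auto
      have "iterate torus twist (- int k) ` B = (untwist ^^ k) ` B"
        using B(1) by (intro image_cong refl iterate_twist_neg) auto
      then show "diameter ((untwist ^^ k) ` B) \<le> \<alpha>" using B(3)[rule_format, of "- int k"] by simp
    qed (use that in auto)
    have stable: "\<exists>c. pillow c = pproj t \<and> norm (c - a) \<le> 5 * r \<and> ucoord (c - a) = 0"
      if t: "t \<in> A" "w \<in> A" "pproj w = pillow a" for t w a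
    proof -
      have "\<exists>c. pillow c = pproj t \<and> (\<forall>k. norm ((cat ^^ k) (c - a)) \<le> 5 * r)"
      proof (rule continuum_shadow[of cat twist r \<delta> A w a t])
        show "dist (pproj ((twist ^^ k) u)) (pproj ((twist ^^ k) w)) < \<delta>" if "u \<in> A" for k u
          using that t A(1) closeA[of u w k] \<alpha>(2) by (intro \<gamma>(2) funpow_twist_in_torus) auto
      qed (use r \<delta> A t linear_cat twist_in_torus pproj_twist in \<open>auto simp: continuum_def\<close>)
      then obtain c where c: "pillow c = pproj t" "\<And>k. norm ((cat ^^ k) (c - a)) \<le> 5 * r" by blast
      show ?thesis using c(1) c(2)[of 0] stable_ucoord[OF c(2)] by (intro exI[of _ c]) simp
    qed
    have unstable: "\<exists>c. pillow c = pproj t \<and> norm (c - a) \<le> 5 * r \<and> scoord (c - a) = 0"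
      if t: "t \<in> B" "w \<in> B" "pproj w = pillow a" for t w a
    proof -
      have "\<exists>c. pillow c = pproj t \<and> (\<forall>k. norm ((icat ^^ k) (c - a)) \<le> 5 * r)"
      proof (rule continuum_shadow[of icat untwist r \<delta> B w a t])
        show "dist (pproj ((untwist ^^ k) u)) (pproj ((untwist ^^ k) w)) < \<delta>" if "u \<in> B" for k u
          using that t B(1) closeB[of u w k] \<alpha>(2) by (intro \<gamma>(2) funpow_untwist_in_torus) auto
      qed (use r \<delta> B t linear_icat untwist_in_torus pproj_untwist in \<open>auto simp: continuum_def\<close>)
      then obtain c where c: "pillow c = pproj t" "\<And>k. norm ((icat ^^ k) (c - a)) \<le> 5 * r" by blast
      show ?thesis using c(1) c(2)[of 0] unstable_scoord[OF c(2)] by (intro exI[of _ c]) simp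
    qed
    have "w = t1 \<or> t1 = t2 \<or> w = t2" if I: "w \<in> A \<inter> B" "t1 \<in> A \<inter> B" "t2 \<in> A \<inter> B" for w t1 t2
    proof -
      have in_torus: "t \<in> torus" if "t \<in> A \<inter> B" for t using that A(1) by blast
      obtain a where a: "pproj w = pillow a" using pproj_pillow in_torus I(1) by blast
      \<comment> \<open>The exceptional case: the stable lift \<open>a + u\<close> and the unstable
        lift \<open>a + v\<close> of \<open>t\<close> are negatives of each other modulo the
        lattice. Then \<open>a\<close> is close to half of \<open>l\<close>, a lift of a cone
        point.\<close>
      define opt where "opt t l u v \<longleftrightarrow> l \<in> lat4 \<and> 2 *\<^sub>R a + u + v = l \<and> norm u \<le> 5 * r \<and> norm v \<le> 5 * r \<and>
        ucoord u = 0 \<and> scoord v = 0 \<and> pproj t = pillow (a + u)" for t l u v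
      have dich: "pproj t = pproj w \<or> (\<exists>l u v. opt t l u v)" if t: "t \<in> A \<inter> B" for t
      proof -
        obtain c1 where c1: "pillow c1 = pproj t" "norm (c1 - a) \<le> 5 * r" "ucoord (c1 - a) = 0"
          using stable[of t w a] t I(1) a by blast
        obtain c2 where c2: "pillow c2 = pproj t" "norm (c2 - a) \<le> 5 * r" "scoord (c2 - a) = 0"
          using unstable[of t w a] t I(1) a by blast
        obtain l where l: "l \<in> lat4" "c1 = c2 + l \<or> c1 = - c2 + l" using pillow_eq_iff[of c1 c2] c1(1) c2(1) by auto
        from l(2) show ?thesis
        proof
          assume "c1 = c2 + l"
          then have e: "l = (c1 - a) - (c2 - a)" by simp
          then have "norm l \<le> norm (c1 - a) + norm (c2 - a)" using norm_triangle_ineq4 by metis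
          then have "l = 0" using lat4_eq_0[OF l(1)] c1(2) c2(2) r by linarith
          then have "c1 - a = 0" using e c1(3) c2(3) coords_zero[of "c1 - a"] by simp
          then show ?thesis using c1(1) a by simp
        next
          assume "c1 = - c2 + l"
          then have "2 *\<^sub>R a + (c1 - a) + (c2 - a) = l" by (simp add: scaleR_2)
          then have "opt t l (c1 - a) (c2 - a)" using l(1) c1 c2 by (simp add: opt_def)
          then show ?thesis by blast
        qed
      qed
      \<comment> \<open>Short displacements force the same lattice vector; \<open>u - u'\<close>
        then lies on both lines and is 0. So all exceptional points have the same
        projection.\<close>
      have opt_unique: "pproj t = pproj t'" if o: "opt t l u v" "opt t' l' u' v'" for t t' l l' u u' v v'
      proof -
        have e: "l - l' = (u - u') + (v - v')" using o by (auto simp: opt_def)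
        have "norm ((u - u') + (v - v')) \<le> (norm u + norm u') + (norm v + norm v')"
          by (intro norm_triangle_mono norm_triangle_ineq4)
        then have "norm (l - l') < 4" using o r e by (auto simp: opt_def)
        then have "l - l' = 0" using lat4_eq_0[OF lat4_diff] o by (auto simp: opt_def)
        then have "u - u' = v' - v" using e by (simp add: algebra_simps eq_neg_iff_add_eq_0)
        moreover have "ucoord (u - u') = 0" "scoord (v' - v) = 0"
          using o by (simp_all add: opt_def ucoord_diff scoord_diff)
        ultimately have "u - u' = 0" using coords_zero by metis
        then show ?thesis using o by (simp add: opt_def)
      qed
      have conj: "t' = deck t \<and> dist t (deck t) < \<eta>"
        if "t \<in> A \<inter> B" "t' \<in> A \<inter> B" "pproj t = pproj t'" "t \<noteq> t'" for t t'
        using pproj_eq[of t t'] that in_torus closeA[of t t' 0] \<alpha>(3) by auto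
      \<comment> \<open>Distinct points over one value would be exchanged by \<open>deck\<close> at
        distance below \<eta>, hence near a branch value. In the exceptional case every point of the
        intersection is near a cone point instead.\<close>
      have inj: "t = t'"
        if o: "opt s l u v" and t: "t \<in> A \<inter> B" "t' \<in> A \<inter> B" "pproj t = pproj t'" for s l u v t t'
      proof (rule ccontr)
        assume "t \<noteq> t'"
        then obtain c where c: "c \<in> branch_vals" "dist (pproj t) c < 1 / 2"
          using conj[OF t] \<eta>(2) in_torus t(1) by blast
        obtain b where b: "pillow b = pproj t" "norm (b - a) \<le> 5 * r" using stable[of t w a] t I(1) a by blast
        have e: "b - (1 / 2) *\<^sub>R l = (b - a) - (1 / 2) *\<^sub>R (u + v)"
          using o by (auto simp: opt_def scaleR_add_right)
        then have "norm (b - (1 / 2) *\<^sub>R l) \<le> norm (b - a) + 1 / 2 * norm (u + v)"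
          unfolding e using norm_triangle_ineq4[of "b - a" "(1 / 2) *\<^sub>R (u + v)"] by simp
        moreover have "norm (u + v) \<le> 10 * r" using o norm_triangle_ineq[of u v] by (simp add: opt_def)
        ultimately have "norm (b - (1 / 2) *\<^sub>R l) < \<rho>" using b(2) r by linarith
        then have "dist (pproj t) (pillow ((1 / 2) *\<^sub>R l)) < 1 / 4" using \<rho>(2)[of b] b(1) by simp
        moreover have "1 \<le> dist (pillow ((1 / 2) *\<^sub>R l)) c"
          using half_lattice_far_from_branch o c(1) by (simp add: opt_def)
        moreover have "dist (pillow ((1 / 2) *\<^sub>R l)) c \<le> dist (pproj t) (pillow ((1 / 2) *\<^sub>R l)) + dist (pproj t) c"
          by (rule dist_triangle3)
        ultimately show False using c(2) by linarith
      qed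
      \<comment> \<open>With an exceptional point there are at most two projected values, each
        attained once; without one there is a single value, attained at most twice.\<close>
      show ?thesis
      proof (cases "\<exists>t l u v. t \<in> {t1, t2} \<and> opt t l u v")
        case True
        then obtain s l u v where o: "opt s l u v" by blast
        note inj = inj[OF o]
        show ?thesis using inj[of w t1] inj[of w t2] inj[of t1 t2] I dich[OF I(2)] dich[OF I(3)] opt_unique by metis
      next
        case False
        then have "pproj t1 = pproj w" "pproj t2 = pproj w" using dich I by blast+
        then show ?thesis using conj[of w t1] conj[of w t2] I by metis
      qed
    qed
    then show ?thesis by (intro card_le_2_if_no_three) metis
  qed
  then show ?thesis unfolding cw_expansive_def using \<alpha>(1) by blast
qed

section \<open>One-prongs\<close>

lemma wrap_in_torus [simp]: "wrap a \<in> torus"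
  by (simp add: wrap_def torus_def)

lemma dist_wrap_0: "dist (wrap a) (wrap 0) = sqrt (4 - 2 * cos (pi / 2 * \<bar>fst a\<bar>) - 2 * cos (pi / 2 * \<bar>snd a\<bar>))"
proof -
  have "(dist (cis u) 1)\<^sup>2 = 2 - 2 * cos u" for u
  proof -
    have "(dist (cis u) 1)\<^sup>2 = (cos u - 1)\<^sup>2 + (sin u)\<^sup>2"
      by (simp add: dist_norm cmod_power2)
    also have "\<dots> = ((sin u)\<^sup>2 + (cos u)\<^sup>2) + 1 - 2 * cos u" by (simp add: power2_eq_square algebra_simps)
    finally show ?thesis by simp
  qed
  moreover have "cos (pi / 2 * \<bar>x\<bar>) = cos (pi / 2 * x)" for x by (simp add: abs_if)
  ultimately show ?thesis by (simp add: wrap_def dist_prod_def)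
qed

text \<open>Strict growth of the distance along a leaf makes its part within a given distance of the
  prong an initial segment, so the metric condition cuts out an arc.\<close>

lemma dist_wrap_ray_less:
  assumes "0 \<le> \<sigma>" "\<sigma> < \<tau>" "\<bar>fst u\<bar> * \<tau> \<le> 2" "\<bar>snd u\<bar> * \<tau> \<le> 2" "snd u \<noteq> 0"
  shows "dist (wrap (\<sigma> *\<^sub>R u)) (wrap 0) < dist (wrap (\<tau> *\<^sub>R u)) (wrap 0)"
proof -
  have bd: "0 \<le> pi / 2 * (v * \<sigma>)" "pi / 2 * (v * \<sigma>) \<le> pi / 2 * (v * \<tau>)" "pi / 2 * (v * \<tau>) \<le> pi"
    if "0 \<le> v" "v * \<tau> \<le> 2" for v
    using that assms(1,2) mult_left_mono[of \<sigma> \<tau> v] mult_left_mono[of "v * \<tau>" 2 "pi / 2"]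
    by (auto intro!: mult_left_mono)
  have "cos (pi / 2 * (\<bar>fst u\<bar> * \<tau>)) \<le> cos (pi / 2 * (\<bar>fst u\<bar> * \<sigma>))"
    using bd[of "\<bar>fst u\<bar>"] assms(3) by (intro cos_monotone_0_pi_le) auto
  moreover have "cos (pi / 2 * (\<bar>snd u\<bar> * \<tau>)) < cos (pi / 2 * (\<bar>snd u\<bar> * \<sigma>))"
    using bd[of "\<bar>snd u\<bar>"] assms(2,4,5) by (intro cos_monotone_0_pi) auto
  ultimately show ?thesis
    using assms(1,2) by (simp add: dist_wrap_0 abs_mult mult.commute mult.left_commute)
qed

text \<open>The angles (0, 1): the tip of an arm of the slit, where the bottom circle of the
  cylinder folds back at \<open>x = 0\<close>. It lies over the cone point
  \<open>pillow 0\<close>.\<close>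

definition prong :: "complex \<times> complex" where "prong = (1, \<i>)"

lemma prong_wrap: "prong = wrap (0, 1)"
  by (simp add: prong_def wrap_def)

lemma prong_cyl: "prong = cyl 1 0 0"
  using tri_id[of 0] tri_id[of 2] by (simp add: prong_def cyl_def gap_def)

lemma prong_in_torus: "prong \<in> torus"
  by (simp add: prong_wrap)

lemma pproj_prong: "pproj prong = pillow 0"
  unfolding prong_cyl by (subst pproj_cyl) (simp_all add: chart_def sval_def pillow_def)

lemma flip_prong: "flip prong = prong"
  by (simp add: prong_def flip_def)

lemma shear_prong: "shear c prong = prong"
  unfolding prong_cyl by (subst shear_cyl) (simp_all add: chart_def)

lemma twist_prong: "(twist ^^ k) prong = prong" and untwist_prong: "(untwist ^^ k) prong = prong"
  by (induction k) (simp_all add: twist_def untwist_def flip_prong shear_prong)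

text \<open>At \<open>pillow 0\<close> the sign ambiguity is void, since 0 is its own negative, so
  no connectedness is required. \<open>L\<close> stretches by at most 10, so the lattice vector at
  each step is shorter than \<open>11 * r\<close>, below 4, and vanishes.\<close>

lemma point_shadow:
  fixes f :: "complex \<times> complex \<Rightarrow> complex \<times> complex" and L :: "real \<times> real \<Rightarrow> real \<times> real"
  assumes Lb: "\<And>b. norm (L b) \<le> 10 * norm b"
    and f: "\<And>t. t \<in> torus \<Longrightarrow> f t \<in> torus"
    and semi: "\<And>t b. t \<in> torus \<Longrightarrow> pproj t = pillow b \<Longrightarrow> pproj (f t) = pillow (L b)"
    and r: "0 < r" "r \<le> 1 / 4"
    and \<delta>: "\<And>a b. dist (pillow a) (pillow b) < \<delta> \<Longrightarrow> \<exists>l\<in>lat4. norm (a - (b + l)) < r \<or> norm (a - (- b + l)) < r"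
    and t: "t \<in> torus" "\<And>k. dist (pproj ((f ^^ k) t)) (pillow 0) < \<delta>"
  shows "\<exists>b. pillow b = pproj t \<and> (\<forall>k. norm ((L ^^ k) b) < r)"
proof -
  have fk: "(f ^^ k) t \<in> torus" for k using t f by (induction k) auto
  have semik: "pproj ((f ^^ k) t) = pillow ((L ^^ k) b)" if "pproj t = pillow b" for b k
    using that fk semi by (induction k) auto
  have near: "\<exists>l\<in>lat4. norm ((L ^^ k) b - l) < r" if "pproj t = pillow b" for b k
    using \<delta>[of "(L ^^ k) b" 0] t(2)[of k] semik[OF that] by auto
  obtain b where b: "pproj t = pillow b" using pproj_pillow t by blast
  obtain l where l: "l \<in> lat4" "norm (b - l) < r" using near[OF b, of 0] by auto
  have b': "pproj t = pillow (b - l)" using b pillow_add_lat4[OF lat4_uminus[OF l(1)], of b] by simp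
  have "norm ((L ^^ k) (b - l)) < r" for k
  proof (induction k)
    case (Suc k)
    obtain l' where l': "l' \<in> lat4" "norm ((L ^^ Suc k) (b - l) - l') < r" using near[OF b'] by blast
    have "norm ((L ^^ Suc k) (b - l)) \<le> 10 * r" using Lb[of "(L ^^ k) (b - l)"] Suc by simp
    moreover have "norm l' \<le> norm ((L ^^ Suc k) (b - l)) + norm ((L ^^ Suc k) (b - l) - l')"
      using norm_triangle_ineq4[of "(L ^^ Suc k) (b - l)" "(L ^^ Suc k) (b - l) - l'"] by simp
    ultimately have "norm l' < 4" using l'(2) r by linarith
    then show ?case using lat4_eq_0[OF l'(1)] l'(2) by simp
  qed (use l in simp)
  then show ?thesis using b' by metis
qed

text \<open>One argument for both local sets: \<open>u\<close> is the direction of the leaf in the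
  angles of the torus, \<open>w\<close> its direction in the plane. Points that stay near the prong
  lift to bounded linear orbits and so to the line of \<open>w\<close>. The other preimage is
  excluded because \<open>deck prong\<close> is at distance 2.\<close>

lemma prong_arc:
  fixes f :: "complex \<times> complex \<Rightarrow> complex \<times> complex" and L :: "real \<times> real \<Rightarrow> real \<times> real"
    and u w :: "real \<times> real"
  defines "\<gamma> \<equiv> \<lambda>\<tau>. wrap ((0, 1) + \<tau> *\<^sub>R u)"
  assumes Lb: "\<And>b. norm (L b) \<le> 10 * norm b"
    and f: "\<And>t. t \<in> torus \<Longrightarrow> f t \<in> torus"
    and semi: "\<And>t b. t \<in> torus \<Longrightarrow> pproj t = pillow b \<Longrightarrow> pproj (f t) = pillow (L b)"
    and fp: "\<And>k. (f ^^ k) prong = prong"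
    and T: "0 < T" "\<bar>fst u\<bar> * T \<le> 2" "\<bar>snd u\<bar> * T \<le> 2" "snd u \<noteq> 0"
    and contract: "\<And>\<tau>. 0 \<le> \<tau> \<Longrightarrow> \<tau> \<le> T \<Longrightarrow> f (\<gamma> \<tau>) = \<gamma> (\<tau> / lam)"
    and leaf: "\<And>\<tau>. 0 \<le> \<tau> \<Longrightarrow> \<tau> \<le> T \<Longrightarrow> pproj (\<gamma> \<tau>) = pillow (\<tau> *\<^sub>R w)"
    and dir: "\<And>b C. (\<And>k. norm ((L ^^ k) b) \<le> C) \<Longrightarrow> \<exists>\<tau>. b = \<tau> *\<^sub>R w" "\<bar>fst w\<bar> = 1"
  shows "\<exists>\<epsilon>\<^sub>0>0. \<forall>\<epsilon>. 0 < \<epsilon> \<and> \<epsilon> \<le> \<epsilon>\<^sub>0 \<longrightarrow>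
    arc_from prong {y \<in> torus. \<forall>k. dist ((f ^^ k) prong) ((f ^^ k) y) \<le> \<epsilon>}"
proof -
  have \<gamma>0: "\<gamma> 0 = prong" by (simp add: \<gamma>_def prong_wrap)
  have cont: "continuous_on S \<gamma>" for S
    unfolding \<gamma>_def by (intro continuous_on_compose2[OF continuous_wrap[of UNIV]] continuous_intros) auto
  have d: "dist prong (\<gamma> \<tau>) = dist (wrap (\<tau> *\<^sub>R u)) (wrap 0)" for \<tau>
    unfolding \<gamma>_def prong_wrap using dist_wrap[of "(0, 1) + \<tau> *\<^sub>R u" "(0, 1)"] by (simp add: dist_commute)
  have mono: "dist prong (\<gamma> \<sigma>) < dist prong (\<gamma> \<tau>)" if "0 \<le> \<sigma>" "\<sigma> < \<tau>" "\<tau> \<le> T" for \<sigma> \<tau>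
  proof -
    have "\<bar>v\<bar> * \<tau> \<le> 2" if "\<bar>v\<bar> * T \<le> 2" for v :: real
      using that mult_left_mono[OF \<open>\<tau> \<le> T\<close>, of "\<bar>v\<bar>"] by linarith
    then show ?thesis unfolding d using T that by (intro dist_wrap_ray_less) auto
  qed
  obtain s where s: "s > 0" "\<And>\<tau>. \<bar>\<tau>\<bar> < s \<Longrightarrow> dist prong (\<gamma> \<tau>) < 1 / 2"
  proof -
    have "isCont \<gamma> 0" using cont[of UNIV] by (simp add: continuous_on_eq_continuous_at)
    then obtain s where "s > 0" "\<And>\<tau>. dist \<tau> 0 < s \<Longrightarrow> dist (\<gamma> \<tau>) (\<gamma> 0) < 1 / 2"
      unfolding continuous_at by (metis Lim_at_zero half_gt_zero_iff continuous_at_eps_delta zero_less_one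
        \<open>isCont \<gamma> 0\<close>)
    then show thesis using that[of s] by (simp add: \<gamma>0 dist_commute)
  qed
  define r where "r = min (1 / 4) (min s T)"
  have r: "0 < r" "r \<le> 1 / 4" "r \<le> s" "r \<le> T" using s(1) T(1) by (auto simp: r_def)
  obtain \<delta> where \<delta>: "\<delta> > 0" "\<And>a b. dist (pillow a) (pillow b) < \<delta> \<Longrightarrow>
      \<exists>l\<in>lat4. norm (a - (b + l)) < r \<or> norm (a - (- b + l)) < r"
    using pillow_near[OF r(1)] by blast
  obtain e where e: "e > 0" "\<And>t. t \<in> torus \<Longrightarrow> dist t prong < e \<Longrightarrow> dist (pproj t) (pproj prong) < \<delta>"
    using continuous_pproj prong_in_torus \<delta>(1) unfolding continuous_on_iff by meson
  define \<epsilon>\<^sub>0 where "\<epsilon>\<^sub>0 = min (min (e / 2) 1) (dist prong (\<gamma> T))"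
  have \<epsilon>0: "\<epsilon>\<^sub>0 > 0" "\<epsilon>\<^sub>0 < e" "\<epsilon>\<^sub>0 \<le> 1" "\<epsilon>\<^sub>0 \<le> dist prong (\<gamma> T)"
    using e(1) mono[of 0 T] T(1) \<gamma>0 by (auto simp: \<epsilon>\<^sub>0_def min_def)
  have capture: "\<exists>\<tau>. 0 \<le> \<tau> \<and> \<tau> \<le> T \<and> t = \<gamma> \<tau>"
    if t: "t \<in> torus" "\<And>k. dist prong ((f ^^ k) t) \<le> \<epsilon>\<^sub>0" for t
  proof -
    have fk: "(f ^^ k) t \<in> torus" for k using t f by (induction k) auto
    have "dist (pproj ((f ^^ k) t)) (pillow 0) < \<delta>" for k
      using e(2)[OF fk[of k]] t(2)[of k] \<epsilon>0(2) by (simp add: dist_commute pproj_prong)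
    then obtain b where b: "pillow b = pproj t" "\<And>k. norm ((L ^^ k) b) < r"
      using point_shadow[of L f r \<delta> t, OF Lb f semi r(1,2) \<delta>(2) t(1)] by blast
    obtain \<tau> where \<tau>: "b = \<tau> *\<^sub>R w" using dir(1)[of b r] b(2) by (meson less_imp_le)
    have "\<bar>\<tau>\<bar> \<le> norm b" using abs_fst_le_norm[of b] dir(2) by (simp add: \<tau> abs_mult)
    then have \<tau>r: "\<bar>\<tau>\<bar> < r" using b(2)[of 0] by simp
    \<comment> \<open>\<open>pillow\<close> identifies the two halves of the line, so the parameter
      may be taken nonnegative: one prong instead of two.\<close>
    have "pillow (\<bar>\<tau>\<bar> *\<^sub>R w) = pillow b" using pillow_uminus[of b] by (simp add: \<tau> abs_if)
    then have "pproj (\<gamma> \<bar>\<tau>\<bar>) = pproj t" using leaf[of "\<bar>\<tau>\<bar>"] \<tau>r r b(1) by simp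
    then have "t = \<gamma> \<bar>\<tau>\<bar> \<or> t = deck (\<gamma> \<bar>\<tau>\<bar>)"
      using pproj_eq[of "\<gamma> \<bar>\<tau>\<bar>" t] t(1) by (simp add: \<gamma>_def)
    moreover have "t \<noteq> deck (\<gamma> \<bar>\<tau>\<bar>)"
    proof
      assume "t = deck (\<gamma> \<bar>\<tau>\<bar>)"
      then have "dist t (deck prong) < 1 / 2" using s(2)[of "\<bar>\<tau>\<bar>"] \<tau>r r(3) by (simp add: dist_commute)
      moreover have "dist prong t \<le> 1" using t(2)[of 0] \<epsilon>0(3) by simp
      moreover have "dist prong (deck prong) = 2"
        by (simp add: prong_def deck_def dist_prod_def dist_norm)
      ultimately show False using dist_triangle[of prong "deck prong" t] by linarith
    qed
    ultimately show ?thesis using \<tau>r r(4) by (intro exI[of _ "\<bar>\<tau>\<bar>"]) auto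
  qed
  have "arc_from prong {y \<in> torus. \<forall>k. dist ((f ^^ k) prong) ((f ^^ k) y) \<le> \<epsilon>}"
    if \<epsilon>: "0 < \<epsilon>" "\<epsilon> \<le> \<epsilon>\<^sub>0" for \<epsilon>
  proof -
    \<comment> \<open>The far end of the arc is the point at distance exactly \<epsilon>; it exists
      because \<open>\<epsilon>\<^sub>0\<close> does not exceed the distance to
      \<open>\<gamma> T\<close>.\<close>
    have "\<exists>x\<ge>0. x \<le> T \<and> dist prong (\<gamma> x) = \<epsilon>"
      using \<epsilon> \<epsilon>0 T(1) by (intro IVT') (auto simp: \<gamma>0 intro!: continuous_intros cont)
    then obtain x where x: "0 \<le> x" "x \<le> T" "dist prong (\<gamma> x) = \<epsilon>" by blast
    have xpos: "x > 0" using x(1,3) \<epsilon>(1) \<gamma>0 by (cases "x = 0") auto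
    have iter: "(f ^^ k) (\<gamma> \<tau>) = \<gamma> (\<tau> / lam ^ k) \<and> 0 \<le> \<tau> / lam ^ k \<and> \<tau> / lam ^ k \<le> \<tau>"
      if "0 \<le> \<tau>" "\<tau> \<le> T" for \<tau> k
    proof (induction k)
      case (Suc k)
      have le: "y / lam \<le> y" if "0 \<le> y" for y :: real
        using that lam_gt mult_left_mono[of 1 lam y] by (simp add: divide_le_eq)
      have "f ((f ^^ k) (\<gamma> \<tau>)) = \<gamma> (\<tau> / lam ^ k / lam)"
        using Suc that by (simp add: contract)
      moreover have "0 \<le> \<tau> / lam ^ k / lam" "\<tau> / lam ^ k / lam \<le> \<tau>"
        using Suc le[of "\<tau> / lam ^ k"] lam_gt by auto
      moreover have "\<tau> / lam ^ Suc k = \<tau> / lam ^ k / lam" by (simp add: field_simps)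
      ultimately show ?case by (simp only: funpow.simps o_apply)
    qed (use that in simp)
    have "{y \<in> torus. \<forall>k. dist ((f ^^ k) prong) ((f ^^ k) y) \<le> \<epsilon>} = \<gamma> ` {0..x}"
    proof (intro equalityI subsetI)
      fix y assume "y \<in> {y \<in> torus. \<forall>k. dist ((f ^^ k) prong) ((f ^^ k) y) \<le> \<epsilon>}"
      then have y: "y \<in> torus" "\<And>k. dist prong ((f ^^ k) y) \<le> \<epsilon>" by (auto simp: fp)
      then obtain \<tau> where \<tau>: "0 \<le> \<tau>" "\<tau> \<le> T" "y = \<gamma> \<tau>" using capture \<epsilon>(2) by (meson order_trans)
      have "\<tau> \<le> x" using mono[of x \<tau>] y(2)[of 0] x \<tau> by force
      then show "y \<in> \<gamma> ` {0..x}" using \<tau> by auto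
    next
      fix y assume "y \<in> \<gamma> ` {0..x}"
      then obtain \<tau> where \<tau>: "0 \<le> \<tau>" "\<tau> \<le> x" "y = \<gamma> \<tau>" by auto
      have "dist prong ((f ^^ k) y) \<le> \<epsilon>" for k
      proof -
        have i: "(f ^^ k) y = \<gamma> (\<tau> / lam ^ k)" "0 \<le> \<tau> / lam ^ k" "\<tau> / lam ^ k \<le> x"
          using iter[of \<tau> k] \<tau> x(2) by auto
        show ?thesis
        proof (cases "\<tau> / lam ^ k = x")
          case False
          then show ?thesis using mono[of "\<tau> / lam ^ k" x] i x by simp
        qed (use i x in simp)
      qed
      then show "y \<in> {y \<in> torus. \<forall>k. dist ((f ^^ k) prong) ((f ^^ k) y) \<le> \<epsilon>}"
        using \<tau>(3) by (simp add: fp \<gamma>_def)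
    qed
    moreover have "arc_from prong (\<gamma> ` {0..x})"
      unfolding arc_from_def
    proof (intro exI conjI)
      let ?g = "\<lambda>v. \<gamma> (x * v)"
      have "path ?g"
        unfolding path_def by (rule continuous_on_compose2[OF cont[of UNIV]]) (auto intro!: continuous_intros)
      moreover have "inj_on ?g {0..1}"
      proof (rule linorder_inj_onI)
        fix a b :: real assume ab: "a < b" "a \<in> {0..1}" "b \<in> {0..1}"
        then have "x * a < x * b" "x * b \<le> x" using xpos by (auto simp: mult_left_le)
        then show "?g a \<noteq> ?g b" using mono[of "x * a" "x * b"] x ab by force
      qed auto
      ultimately show "arc ?g" by (simp add: arc_def)
      show "pathstart ?g = prong" by (simp add: pathstart_def \<gamma>0)
      have "(\<lambda>v. x * v) ` {0..1} = {0..x}"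
        using xpos by (simp add: image_mult_atLeastAtMost)
      then show "path_image ?g = \<gamma> ` {0..x}" by (metis image_image path_image_def)
    qed
    ultimately show ?thesis by simp
  qed
  then show ?thesis using \<epsilon>0(1) by blast
qed

lemma norm_cat_le: "norm (cat b) \<le> 10 * norm b" and norm_icat_le: "norm (icat b) \<le> 10 * norm b"
  using norm_le_abs_sum[of "cat b"] norm_le_abs_sum[of "icat b"] abs_fst_le_norm[of b] abs_snd_le_norm[of b]
  unfolding cat_def icat_def fst_conv snd_conv by linarith+

section \<open>The two leaves through the prong\<close>

text \<open>\<open>gap\<close> is linear along this leaf, so the line stays straight in the angles,
  though in another direction. The bound on \<tau> keeps the height at most 1.\<close>

lemma stable_leaf_cyl:
  assumes "0 \<le> \<tau>" "\<tau> \<le> 1 / lam"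
  shows "wrap ((0, 1) + \<tau> *\<^sub>R (- 1, lam - 1)) = cyl 1 (- \<tau>) (lam * \<tau>)"
proof -
  have l: "lam * \<tau> \<le> 1" using assms lam_gt by (simp add: field_simps)
  moreover have "\<tau> \<le> lam * \<tau>" using assms lam_gt mult_right_mono[of 1 lam \<tau>] by simp
  ultimately have "gap (- \<tau>) (lam * \<tau>) = - \<tau>" "gap (2 - \<tau>) (lam * \<tau>) = 1 + \<tau> * (lam - 1)" "\<tau> \<le> 1"
    using assms by (auto simp: gap_def min_def max_def algebra_simps)
  then show ?thesis
    using assms tri_id[of "- \<tau>"] tri_shift2[of "- \<tau>"] by (simp add: wrap_def cyl_def)
qed

lemma unstable_leaf_cyl:
  assumes "0 \<le> \<tau>" "\<tau> \<le> 1"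
  shows "wrap ((0, 1) + \<tau> *\<^sub>R (1 / lam, 1 / lam - 1)) = cyl 1 \<tau> (\<tau> / lam)"
proof -
  have "\<tau> / lam \<le> \<tau>" using assms lam_gt mult_left_mono[of 1 lam \<tau>] by (simp add: divide_le_eq)
  moreover have "0 \<le> \<tau> / lam" using assms lam_gt by simp
  ultimately have "gap \<tau> (\<tau> / lam) = \<tau> / lam" "gap (2 - \<tau>) (\<tau> / lam) = 1 + \<tau> * (1 / lam - 1)"
    using assms by (auto simp: gap_def min_def max_def algebra_simps)
  then show ?thesis
    using assms tri_id[of "\<tau>"] tri_shift2[of "\<tau>"] by (simp add: wrap_def cyl_def)
qed

text \<open>The eigenvalue \<open>- 1 / lam\<close> acts on the folded line as a contraction without
  reversal: flip and shear lead to the position \<open>- ((lam - 8) * \<tau>)\<close>, and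
  \<open>lam - 8\<close> equals \<open>1 / lam\<close>.\<close>

lemma twist_stable_leaf:
  assumes "0 \<le> \<tau>" "\<tau> \<le> 1 / lam"
  shows "twist (cyl 1 (- \<tau>) (lam * \<tau>)) = cyl 1 (- (\<tau> / lam)) (lam * (\<tau> / lam))"
proof -
  have "lam * \<tau> \<le> 1" "1 / lam \<le> 1" using assms lam_gt by (simp_all add: field_simps)
  moreover from this have "\<tau> \<le> 1" using assms by linarith
  ultimately have c: "chart 1 (lam * \<tau>)" "chart 1 \<tau>" and "\<bar>- \<tau>\<bar> \<le> 1"
    using assms lam_gt by (auto simp: chart_def)
  then have "flip (cyl 1 (- \<tau>) (lam * \<tau>)) = cyl 1 (- (lam * \<tau>)) \<tau>"
    using flip_cyl_1(1)[of 1 "lam * \<tau>" "- \<tau>"] assms(1) by (cases "\<tau> = 0") auto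
  moreover have "- (lam * \<tau>) + 8 * \<tau> = - ((lam - 8) * \<tau>)" by (simp add: algebra_simps)
  then have "- (lam * \<tau>) + 8 * \<tau> = - (\<tau> / lam)" unfolding lam_inv[symmetric] by simp
  ultimately show ?thesis using shear_cyl[OF c(2), of 1] lam_gt by (simp add: twist_def)
qed

lemma untwist_unstable_leaf:
  assumes "0 \<le> \<tau>" "\<tau> \<le> 1"
  shows "untwist (cyl 1 \<tau> (\<tau> / lam)) = cyl 1 (\<tau> / lam) (\<tau> / lam / lam)"
proof -
  have le: "0 \<le> y / lam \<and> y / lam \<le> y" if "0 \<le> y" for y :: real
    using that lam_gt mult_left_mono[of 1 lam y] by (simp add: divide_le_eq)
  note b = le[OF assms(1)] le[of "\<tau> / lam"]
  have c: "chart 1 (\<tau> / lam)" using b assms by (auto simp: chart_def)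
  have "\<tau> - 8 * (\<tau> / lam) = \<tau> / lam * (lam - 8)" using lam_gt by (simp add: field_simps)
  then have "\<tau> - 8 * (\<tau> / lam) = \<tau> / lam / lam" unfolding lam_inv[symmetric] by simp
  then have "shear (- 1) (cyl 1 \<tau> (\<tau> / lam)) = cyl 1 (\<tau> / lam / lam) (\<tau> / lam)"
    using shear_cyl[OF c, of "- 1" \<tau>] by simp
  then show ?thesis
    using flip_cyl_1(1)[OF c, of "\<tau> / lam / lam"] b assms by (simp add: untwist_def)
qed

lemma one_prong_twist: "one_prong torus twist prong"
proof -
  have "\<exists>\<epsilon>\<^sub>0>0. \<forall>\<epsilon>. 0 < \<epsilon> \<and> \<epsilon> \<le> \<epsilon>\<^sub>0 \<longrightarrow>
    arc_from prong {y \<in> torus. \<forall>k. dist ((twist ^^ k) prong) ((twist ^^ k) y) \<le> \<epsilon>}"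
  proof (rule prong_arc[where L = cat and u = "(- 1, lam - 1)" and w = "(- 1, lam)" and T = "1 / lam"])
    fix \<tau> :: real assume \<tau>: "0 \<le> \<tau>" "\<tau> \<le> 1 / lam"
    have t': "0 \<le> \<tau> / lam" "\<tau> / lam \<le> 1 / lam"
    proof -
      have "1 / lam \<le> 1" using lam_gt by simp
      then have "\<tau> \<le> 1" using \<tau> by linarith
      then show "0 \<le> \<tau> / lam" "\<tau> / lam \<le> 1 / lam" using \<tau> lam_gt by (simp_all add: divide_right_mono)
    qed
    show "twist (wrap ((0, 1) + \<tau> *\<^sub>R (- 1, lam - 1))) = wrap ((0, 1) + (\<tau> / lam) *\<^sub>R (- 1, lam - 1))"
      unfolding stable_leaf_cyl[OF \<tau>] stable_leaf_cyl[OF t'] by (rule twist_stable_leaf[OF \<tau>])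
    have "chart 1 (lam * \<tau>)" using \<tau> lam_gt by (auto simp: chart_def field_simps)
    then show "pproj (wrap ((0, 1) + \<tau> *\<^sub>R (- 1, lam - 1))) = pillow (\<tau> *\<^sub>R (- 1, lam))"
      unfolding stable_leaf_cyl[OF \<tau>] by (simp add: pproj_cyl pillow_sval mult.commute)
  next
    fix b :: "real \<times> real" and C assume "\<And>k. norm ((cat ^^ k) b) \<le> C"
    then have "ucoord b = 0" by (rule stable_ucoord)
    then have "b = (- fst b) *\<^sub>R (- 1, lam)"
      by (simp add: ucoord_def prod_eq_iff algebra_simps eq_neg_iff_add_eq_0)
    then show "\<exists>\<tau>. b = \<tau> *\<^sub>R (- 1, lam)" ..
  next
    have "\<bar>lam - 1\<bar> / lam \<le> 2" "1 / lam \<le> 2" using lam_gt by (simp_all add: divide_le_eq)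
    then show "\<bar>fst (- 1, lam - 1)\<bar> * (1 / lam) \<le> 2" "\<bar>snd (- 1, lam - 1)\<bar> * (1 / lam) \<le> 2"
      by simp_all
  qed (use lam_gt in \<open>auto simp: norm_cat_le twist_in_torus pproj_twist twist_prong\<close>)
  then obtain e1 where e1: "e1 > 0" "\<And>\<epsilon>. 0 < \<epsilon> \<Longrightarrow> \<epsilon> \<le> e1 \<Longrightarrow>
      arc_from prong {y \<in> torus. \<forall>k. dist ((twist ^^ k) prong) ((twist ^^ k) y) \<le> \<epsilon>}" by blast
  have "\<exists>\<epsilon>\<^sub>0>0. \<forall>\<epsilon>. 0 < \<epsilon> \<and> \<epsilon> \<le> \<epsilon>\<^sub>0 \<longrightarrow>
    arc_from prong {y \<in> torus. \<forall>k. dist ((untwist ^^ k) prong) ((untwist ^^ k) y) \<le> \<epsilon>}"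
  proof (rule prong_arc[where L = icat and u = "(1 / lam, 1 / lam - 1)" and w = "(1, 1 / lam)" and T = 1])
    fix \<tau> :: real assume \<tau>: "0 \<le> \<tau>" "\<tau> \<le> 1"
    have t': "0 \<le> \<tau> / lam" "\<tau> / lam \<le> 1" using \<tau> lam_gt by (simp_all add: divide_le_eq)
    show "untwist (wrap ((0, 1) + \<tau> *\<^sub>R (1 / lam, 1 / lam - 1))) = wrap ((0, 1) + (\<tau> / lam) *\<^sub>R (1 / lam, 1 / lam - 1))"
      unfolding unstable_leaf_cyl[OF \<tau>] unstable_leaf_cyl[OF t'] by (rule untwist_unstable_leaf[OF \<tau>])
    have "chart 1 (\<tau> / lam)" using t' by (auto simp: chart_def)
    then show "pproj (wrap ((0, 1) + \<tau> *\<^sub>R (1 / lam, 1 / lam - 1))) = pillow (\<tau> *\<^sub>R (1, 1 / lam))"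
      unfolding unstable_leaf_cyl[OF \<tau>] by (simp add: pproj_cyl pillow_sval)
  next
    fix b :: "real \<times> real" and C assume "\<And>k. norm ((icat ^^ k) b) \<le> C"
    then have "scoord b = 0" by (rule unstable_scoord)
    then have "b = fst b *\<^sub>R (1, 1 / lam)" by (simp add: scoord_def prod_eq_iff)
    then show "\<exists>\<tau>. b = \<tau> *\<^sub>R (1, 1 / lam)" ..
  next
    have aux: "\<bar>x\<bar> * 1 \<le> 2" "\<bar>x - 1\<bar> * 1 \<le> 2" "x - 1 \<noteq> 0" if "0 < x" "x < 1" for x :: real
      using that by auto
    have "0 < 1 / lam" "1 / lam < 1" using lam_gt by simp_all
    note aux = aux[OF this]
    show "\<bar>fst (1 / lam, 1 / lam - 1)\<bar> * 1 \<le> 2" "\<bar>snd (1 / lam, 1 / lam - 1)\<bar> * 1 \<le> 2"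
      "snd (1 / lam, 1 / lam - 1) \<noteq> 0"
      unfolding fst_conv snd_conv by (rule aux)+
  qed (use lam_gt in \<open>auto simp: norm_icat_le untwist_in_torus pproj_untwist untwist_prong\<close>)
  then obtain e2 where e2: "e2 > 0" "\<And>\<epsilon>. 0 < \<epsilon> \<Longrightarrow> \<epsilon> \<le> e2 \<Longrightarrow>
      arc_from prong {y \<in> torus. \<forall>k. dist ((untwist ^^ k) prong) ((untwist ^^ k) y) \<le> \<epsilon>}" by blast
  have nonneg: "(\<forall>k\<ge>0. Q k) \<longleftrightarrow> (\<forall>n. Q (int n))" for Q
    by (metis of_nat_0_le_iff nonneg_int_cases)
  have nonpos: "(\<forall>k\<le>0. Q k) \<longleftrightarrow> (\<forall>n. Q (- int n))" for Q
    by (metis neg_le_0_iff_le of_nat_0_le_iff nonpos_int_cases)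
  have "local_stable torus twist \<epsilon> prong = {y \<in> torus. \<forall>k. dist ((twist ^^ k) prong) ((twist ^^ k) y) \<le> \<epsilon>}" for \<epsilon>
    by (simp add: local_stable_def nonneg)
  moreover have "local_unstable torus twist \<epsilon> prong = {y \<in> torus. \<forall>k. dist ((untwist ^^ k) prong) ((untwist ^^ k) y) \<le> \<epsilon>}" for \<epsilon>
    unfolding local_unstable_def nonpos using iterate_twist_neg prong_in_torus by auto
  ultimately show ?thesis
    unfolding one_prong_def using prong_in_torus e1 e2 by (intro conjI exI[of _ "min e1 e2"]) auto
qed

section \<open>Homoclinic orbits and the failure of expansivity\<close>

text \<open>
  The two branches lie on the stable and unstable line of \<open>0\<close>. They are matched so that \<open>cat\<close> maps
  \<open>homoclinic (- 1)\<close> to \<open>homoclinic 0 - (0, 4)\<close>, so modulo \<open>lat4\<close> this is one orbit.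
\<close>

definition homoclinic :: "int \<Rightarrow> real \<times> real" where
  "homoclinic j = (if j \<ge> 0 then (2 / sqrt 17 * (- (1 / lam)) ^ nat j) *\<^sub>R (- 1, lam)
     else (- (2 / sqrt 17 * (1 / lam) ^ nat (- j))) *\<^sub>R (1, 1 / lam))"

lemma cat_stable: "cat (c *\<^sub>R (- 1, lam)) = (c * (- (1 / lam))) *\<^sub>R (- 1, lam)"
proof -
  have "cat (c *\<^sub>R (- 1, lam)) = (c * (lam - 8), - c)" by (simp add: cat_def algebra_simps)
  also have "\<dots> = (c * (1 / lam), - c)" unfolding lam_inv ..
  finally show ?thesis using lam_gt by simp
qed

lemma cat_unstable: "cat (c *\<^sub>R (1, 1 / lam)) = (c * lam) *\<^sub>R (1, 1 / lam)"
proof -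
  have "8 * c + c * (1 / lam) = c * lam" unfolding lam_inv by (simp add: algebra_simps)
  then show ?thesis using lam_gt by (simp add: cat_def)
qed

lemma cat_homoclinic: "\<exists>l\<in>lat4. cat (homoclinic j) = homoclinic (j + 1) + l"
proof -
  consider "j \<ge> 0" | "j = -1" | "j < -1" by linarith
  then show ?thesis
  proof cases
    case 1
    then have n: "nat (j + 1) = Suc (nat j)" and 1: "0 \<le> j" "0 \<le> j + 1" by auto
    have "cat (homoclinic j) = homoclinic (j + 1)"
      by (simp only: homoclinic_def 1 if_True cat_stable n power_Suc mult_ac)
    then show ?thesis by (intro bexI[of _ 0]) auto
  next
    case 2
    \<comment> \<open>The factor \<open>2 / sqrt 17\<close> is chosen for this identity, as
      \<open>lam + 1 / lam\<close> equals \<open>2 * sqrt 17\<close>. It makes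
      \<open>homoclinic 0\<close> the intersection of the stable line through 0 with the unstable
      line through the lattice point (0, 4).\<close>
    have s: "2 / sqrt 17 * (1 / lam + lam) = 4"
      unfolding lam_inv by (simp add: lam_def)
    have "homoclinic j = (- (2 / sqrt 17 * (1 / lam))) *\<^sub>R (1, 1 / lam)"
      by (simp add: homoclinic_def 2)
    then have "cat (homoclinic j) = (- (2 / sqrt 17)) *\<^sub>R (1, 1 / lam)"
      using lam_gt by (simp only: cat_unstable) simp
    moreover have "(- a) *\<^sub>R (1, b) = a *\<^sub>R (- 1, c) + (4 * of_int 0, 4 * of_int (- 1))"
      if "a * (b + c) = 4" for a b c :: real
      using that by (simp add: algebra_simps)
    from this[OF s] have "(- (2 / sqrt 17)) *\<^sub>R (1, 1 / lam) =
        homoclinic 0 + (4 * of_int 0, 4 * of_int (- 1))" by (simp add: homoclinic_def)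
    ultimately have "cat (homoclinic j) = homoclinic (j + 1) + (4 * of_int 0, 4 * of_int (- 1))"
      using 2 by simp
    then show ?thesis unfolding lat4_def by blast
  next
    case 3
    then have n: "nat (- j) = Suc (nat (- (j + 1)))" and 3: "\<not> 0 \<le> j" "\<not> 0 \<le> j + 1" by auto
    have "(- (2 / sqrt 17 * (1 / lam) ^ nat (- j))) * lam = - (2 / sqrt 17 * (1 / lam) ^ nat (- (j + 1)))"
      unfolding n using lam_gt by simp
    then have "cat (homoclinic j) = homoclinic (j + 1)"
      by (simp only: homoclinic_def 3 if_False cat_unstable)
    then show ?thesis by (intro bexI[of _ 0]) auto
  qed
qed

lemma norm_homoclinic: "norm (homoclinic j) \<le> 20 * (1 / 8) ^ nat \<bar>j\<bar>"
proof -
  have "sqrt 17 < sqrt 25" by (rule real_sqrt_less_mono) simp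
  then have l9: "lam < 9" by (simp add: lam_def)
  have s: "0 \<le> 2 / sqrt 17" "2 / sqrt 17 \<le> 1" using lam_gt by (simp_all add: lam_def divide_le_eq)
  have p: "(1 / lam) ^ n \<le> (1 / 8) ^ n" for n
    using lam_gt by (intro power_mono divide_left_mono) auto
  have w: "norm (- 1 :: real, lam) \<le> 20" "norm (1 :: real, 1 / lam) \<le> 20"
  proof -
    have "\<bar>1 / lam\<bar> \<le> 1" using lam_gt by simp
    then show "norm (1 :: real, 1 / lam) \<le> 20"
      using norm_le_abs_sum[of "(1, 1 / lam)"] unfolding fst_conv snd_conv by linarith
    show "norm (- 1 :: real, lam) \<le> 20" using norm_le_abs_sum[of "(- 1, lam)"] lam_gt l9 by simp
  qed
  have key: "2 / sqrt 17 * (1 / lam) ^ n * norm w \<le> 20 * (1 / 8) ^ n" if "norm w \<le> 20" for w :: "real \<times> real" and n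
  proof -
    have "2 / sqrt 17 * (1 / lam) ^ n \<le> 1 * (1 / 8) ^ n"
      using s p[of n] lam_gt by (intro mult_mono) auto
    then show ?thesis using mult_mono[of "2 / sqrt 17 * (1 / lam) ^ n" "(1 / 8) ^ n" "norm w" 20] that
      by (simp add: mult.commute)
  qed
  show ?thesis
  proof (cases "j \<ge> 0")
    case True
    have "\<bar>2 / sqrt 17 * (- (1 / lam)) ^ nat j\<bar> = 2 / sqrt 17 * (1 / lam) ^ nat j"
      using lam_gt by (simp add: abs_mult power_abs)
    then show ?thesis using key[OF w(1), of "nat j"]
      unfolding homoclinic_def if_P[OF True] norm_scaleR abs_of_nonneg[OF True] by (simp only:)
  next
    case False
    have "\<bar>- (2 / sqrt 17 * (1 / lam) ^ nat (- j))\<bar> = 2 / sqrt 17 * (1 / lam) ^ nat (- j)"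
      using lam_gt by (simp add: abs_mult power_abs)
    moreover have "\<bar>j\<bar> = - j" using False by simp
    ultimately show ?thesis using key[OF w(2), of "nat (- j)"]
      unfolding homoclinic_def if_not_P[OF False] norm_scaleR by (simp only:)
  qed
qed

text \<open>Modulo 4 the first coordinate is \<open>- 4 / sqrt 17\<close>, which lies between -1 and
  -4/5. Consequently the sign of an excursion can be seen at its middle point, even modulo the
  lattice.\<close>

lemma double_homoclinic_far_from_lat4:
  assumes "l \<in> lat4" shows "4 / 5 \<le> norm (2 *\<^sub>R homoclinic 0 - l)"
proof -
  obtain m n :: int where l: "l = (4 * of_int m, 4 * of_int n)" using assms by (auto simp: lat4_def)
  have "sqrt 17 < sqrt 25" "sqrt 16 < sqrt 17" by (intro real_sqrt_less_mono; simp)+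
  then have s: "4 / 5 < 4 / sqrt 17" "4 / sqrt 17 < 1" by (simp_all add: field_simps)
  have "fst (2 *\<^sub>R homoclinic 0 - l) = - (4 / sqrt 17) - 4 * of_int m" by (simp add: homoclinic_def l)
  moreover have "4 / 5 \<le> \<bar>- (4 / sqrt 17) - 4 * of_int m\<bar>"
  proof (cases "m \<ge> 0")
    case True
    then show ?thesis using s by linarith
  next
    case False
    then have "real_of_int m \<le> - 1" by linarith
    then show ?thesis using s by linarith
  qed
  ultimately show ?thesis using abs_fst_le_norm[of "2 *\<^sub>R homoclinic 0 - l"] by simp
qed

text \<open>An arithmetic description of the lifts of branch points, invariant under the dynamics:
  modulo 2, \<open>cat\<close> only exchanges the coordinates, and \<open>lat4\<close> is
  even.\<close>

definition odd_vector :: "real \<times> real \<Rightarrow> bool" where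
  "odd_vector b \<longleftrightarrow> (\<exists>m n :: int. b = (of_int m, of_int n) \<and> odd (m + n))"

lemma odd_vector_if_branch:
  assumes "pillow b \<in> branch_vals" shows "odd_vector b"
proof -
  have "pillow (1, 0) = (0, 1, 0)" "pillow (1, 2) = (0, - 1, 0)" "pillow (0, 1) = (1, 0, 0)" "pillow (2, 1) = (- 1, 0, 0)"
    by (simp_all add: pillow_def)
  then have "\<exists>m n :: int. pillow b = pillow (of_int m, of_int n) \<and> odd (m + n)"
    using assms unfolding branch_vals_def
    by (elim insertE emptyE; simp) (metis of_int_0 of_int_1 of_int_numeral odd_one even_numeral odd_add add.commute add_0)+
  then obtain m n :: int where mn: "pillow b = pillow (of_int m, of_int n)" "odd (m + n)" by blast
  then obtain p q :: int where "b = (of_int m, of_int n) + (4 * of_int p, 4 * of_int q)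
      \<or> b = - (of_int m, of_int n) + (4 * of_int p, 4 * of_int q)"
    unfolding pillow_eq_iff lat4_def by blast
  then have "b = (of_int (m + 4 * p), of_int (n + 4 * q)) \<or> b = (of_int (- m + 4 * p), of_int (- n + 4 * q))" by auto
  moreover have "odd ((m + 4 * p) + (n + 4 * q))" "odd ((- m + 4 * p) + (- n + 4 * q))" using mn(2) by auto
  ultimately show ?thesis unfolding odd_vector_def by blast
qed

lemma odd_vector_step:
  assumes "odd_vector b" "cat b = c + l" "l \<in> lat4" shows "odd_vector c"
proof -
  obtain m n :: int where b: "b = (of_int m, of_int n)" "odd (m + n)" using assms(1) by (auto simp: odd_vector_def)
  obtain p q :: int where l: "l = (4 * of_int p, 4 * of_int q)" using assms(3) by (auto simp: lat4_def)
  have "c = cat b - l" using assms(2) by simp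
  then have "c = (of_int (8 * m + n - 4 * p), of_int (m - 4 * q))" by (simp add: b l cat_def)
  moreover have "odd ((8 * m + n - 4 * p) + (m - 4 * q))" using b(2) by auto
  ultimately show ?thesis unfolding odd_vector_def by blast
qed

text \<open>Oddness would propagate along the forward orbit, which tends to 0; but the only integer
  vector of norm below 1 is 0, and it is even.\<close>

lemma homoclinic_not_odd: "\<not> odd_vector (homoclinic j)"
proof
  assume "odd_vector (homoclinic j)"
  then have o: "odd_vector (homoclinic (j + int n))" for n
  proof (induction n)
    case (Suc n)
    then have "odd_vector (homoclinic (j + int n + 1))"
      using odd_vector_step cat_homoclinic[of "j + int n"] by blast
    then show ?case by (simp add: algebra_simps)
  qed simp
  define n where "n = nat \<bar>j\<bar> + 2"
  have "norm (homoclinic (j + int n)) \<le> 20 * (1 / 8) ^ nat \<bar>j + int n\<bar>" by (rule norm_homoclinic)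
  also have "\<dots> \<le> 20 * (1 / 8) ^ 2"
    by (intro mult_left_mono power_decreasing) (auto simp: n_def)
  also have "\<dots> < 1" by (simp add: power2_eq_square)
  finally have small: "norm (homoclinic (j + int n)) < 1" .
  obtain p q :: int where pq: "homoclinic (j + int n) = (of_int p, of_int q)" "odd (p + q)"
    using o[of n] by (auto simp: odd_vector_def)
  have "\<bar>real_of_int p\<bar> < 1" "\<bar>real_of_int q\<bar> < 1"
    using abs_fst_le_norm[of "homoclinic (j + int n)"] abs_snd_le_norm[of "homoclinic (j + int n)"] small
    by (auto simp: pq)
  then have "p = 0" "q = 0" by linarith+
  then show False using pq(2) by simp
qed

lemma finite_positive_lower_bound:
  fixes f :: "'a \<Rightarrow> real"
  assumes "finite S" "\<And>x. x \<in> S \<Longrightarrow> f x > 0"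
  shows "\<exists>\<zeta>>0. \<forall>x\<in>S. \<zeta> \<le> f x"
  using assms by (intro exI[of _ "Min (insert 1 (f ` S))"]) auto

text \<open>All but finitely many points are close to the cone point, which has distance at least 1
  from every branch value; the finitely many others have a positive minimal distance.\<close>

lemma homoclinic_away_from_branch:
  "\<exists>\<zeta>>0. \<forall>j. \<forall>c\<in>branch_vals. \<zeta> \<le> dist (pillow (homoclinic j)) c"
proof -
  obtain \<rho> where \<rho>: "\<rho> > 0" "\<And>a b. norm (a - b) < \<rho> \<Longrightarrow> dist (pillow a) (pillow b) < 1 / 2"
    using pillow_uniform[of "1 / 2"] by auto
  obtain J where J: "(1 / 8) ^ J < \<rho> / 20" using real_arch_pow_inv[of "\<rho> / 20" "1 / 8"] \<rho>(1) by auto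
  have "\<exists>\<zeta>>0. \<forall>x\<in>{- int J..int J} \<times> branch_vals. \<zeta> \<le> dist (pillow (homoclinic (fst x))) (snd x)"
  proof (rule finite_positive_lower_bound)
    show "finite ({- int J..int J} \<times> branch_vals)" by (simp add: branch_vals_def)
    fix x assume "x \<in> {- int J..int J} \<times> branch_vals"
    then have "pillow (homoclinic (fst x)) \<noteq> snd x"
      using odd_vector_if_branch homoclinic_not_odd by (metis mem_Times_iff)
    then show "0 < dist (pillow (homoclinic (fst x))) (snd x)" by simp
  qed
  then obtain \<zeta> where \<zeta>: "\<zeta> > 0" "\<And>j c. j \<in> {- int J..int J} \<Longrightarrow> c \<in> branch_vals \<Longrightarrow> \<zeta> \<le> dist (pillow (homoclinic j)) c"
    by auto
  have far: "1 / 2 \<le> dist (pillow (homoclinic j)) c" if "j \<notin> {- int J..int J}" "c \<in> branch_vals" for j c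
  proof -
    have "J \<le> nat \<bar>j\<bar>" using that(1) by auto
    then have "(1 / 8 :: real) ^ nat \<bar>j\<bar> \<le> (1 / 8) ^ J" by (intro power_decreasing) auto
    then have "norm (homoclinic j - 0) < \<rho>" using norm_homoclinic[of j] J unfolding diff_zero by linarith
    then have "dist (pillow (homoclinic j)) (pillow 0) < 1 / 2" by (rule \<rho>(2))
    moreover have "1 \<le> dist (pillow 0) c" using half_lattice_far_from_branch[OF lat4_0 that(2)] by simp
    ultimately show ?thesis using dist_triangle[of "pillow 0" c "pillow (homoclinic j)"] by (simp add: dist_commute)
  qed
  show ?thesis
  proof (intro exI[of _ "min \<zeta> (1 / 2)"] conjI allI ballI)
    show "min \<zeta> (1 / 2) \<le> dist (pillow (homoclinic j)) c" if "c \<in> branch_vals" for j c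
      using \<zeta>(2)[of j c] far[of j c] that by (cases "j \<in> {- int J..int J}") auto
  qed (use \<zeta>(1) in auto)
qed

text \<open>
  A pseudo-sum of homoclinic excursions at the times \<open>0, M, 2 M, \<dots>, (m - 1) M\<close>, with the sign of the
  \<open>l\<close>-th excursion flipped (none if \<open>l \<ge> m\<close>). Up to sign all of them stay close to each other, and
  signs are invisible in the pillowcase.
\<close>

definition multi_orbit :: "nat \<Rightarrow> nat \<Rightarrow> nat \<Rightarrow> int \<Rightarrow> real \<times> real" where
  "multi_orbit m M l k = (\<Sum>i<m. (if i = l then - 1 else 1) *\<^sub>R homoclinic (k - int (i * M)))"

section \<open>Orbits with several excursions\<close>

lemma lat4_sum: "(\<And>i. i \<in> S \<Longrightarrow> g i \<in> lat4) \<Longrightarrow> sum g S \<in> lat4"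
  by (induction S rule: infinite_finite_induct) (auto intro: lat4_add)

lemma cat_multi_orbit: "\<exists>x\<in>lat4. cat (multi_orbit m M l k) = multi_orbit m M l (k + 1) + x"
proof -
  obtain g where g: "\<And>j. g j \<in> lat4" "\<And>j. cat (homoclinic j) = homoclinic (j + 1) + g j"
    using cat_homoclinic by metis
  define e :: "nat \<Rightarrow> real" where "e i = (if i = l then - 1 else 1)" for i
  have "cat (multi_orbit m M l k) = (\<Sum>i<m. e i *\<^sub>R (homoclinic (k - int (i * M) + 1) + g (k - int (i * M))))"
    unfolding multi_orbit_def e_def using linear_cat g(2) by (simp only: linear_sum linear_scale)
  also have "\<dots> = multi_orbit m M l (k + 1) + (\<Sum>i<m. e i *\<^sub>R g (k - int (i * M)))"
    by (simp add: scaleR_add_right sum.distrib multi_orbit_def e_def algebra_simps)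
  finally have "cat (multi_orbit m M l k) = multi_orbit m M l (k + 1) + (\<Sum>i<m. e i *\<^sub>R g (k - int (i * M)))" .
  moreover have "(\<Sum>i<m. e i *\<^sub>R g (k - int (i * M))) \<in> lat4"
    by (intro lat4_sum) (auto simp: e_def g(1) lat4_uminus)
  ultimately show ?thesis by blast
qed

lemma cat_lat4: "l \<in> lat4 \<Longrightarrow> cat l \<in> lat4" and icat_lat4: "l \<in> lat4 \<Longrightarrow> icat l \<in> lat4"
proof -
  assume "l \<in> lat4"
  then obtain m n :: int where l: "l = (4 * of_int m, 4 * of_int n)" by (auto simp: lat4_def)
  have "cat l = (4 * of_int (8 * m + n), 4 * of_int m)" "icat l = (4 * of_int n, 4 * of_int (m - 8 * n))"
    by (simp_all add: l cat_def icat_def)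
  then show "cat l \<in> lat4" "icat l \<in> lat4" unfolding lat4_def by blast+
qed

lemma pillow_cat_multi_orbit: "pillow (cat (multi_orbit m M l k)) = pillow (multi_orbit m M l (k + 1))"
  using cat_multi_orbit[of m M l k] pillow_add_lat4 by metis

lemma pillow_icat_multi_orbit: "pillow (icat (multi_orbit m M l k)) = pillow (multi_orbit m M l (k - 1))"
proof -
  obtain x where x: "x \<in> lat4" "cat (multi_orbit m M l (k - 1)) = multi_orbit m M l k + x"
    using cat_multi_orbit[of m M l "k - 1"] by auto
  have "multi_orbit m M l (k - 1) = icat (multi_orbit m M l k + x)" by (metis x(2) icat_cat)
  also have "\<dots> = icat (multi_orbit m M l k) + icat x" using linear_add[OF linear_icat] .
  finally show ?thesis using pillow_add_lat4[OF icat_lat4[OF x(1)]] by metis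
qed

lemma pproj_twist_orbit:
  assumes "t \<in> torus" "pproj t = pillow (multi_orbit m M l 0)"
  shows "pproj ((twist ^^ n) t) = pillow (multi_orbit m M l (int n))"
    "pproj ((untwist ^^ n) t) = pillow (multi_orbit m M l (- int n))"
proof -
  show "pproj ((twist ^^ n) t) = pillow (multi_orbit m M l (int n))"
    by (induction n) (simp_all add: assms pproj_twist funpow_twist_in_torus pillow_cat_multi_orbit add.commute)
  show "pproj ((untwist ^^ n) t) = pillow (multi_orbit m M l (- int n))"
  proof (induction n)
    case (Suc n)
    have "- int (Suc n) = - int n - 1" by simp
    moreover have "pproj (untwist ((untwist ^^ n) t)) = pillow (multi_orbit m M l (- int n - 1))"
      using pproj_untwist[OF funpow_untwist_in_torus[OF assms(1)] Suc] pillow_icat_multi_orbit by simp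
    ultimately show ?case by (simp only: funpow.simps o_apply)
  qed (simp add: assms)
qed

text \<open>All excursions except \<open>i0\<close> are at least \<open>H\<close> steps away, where
  the homoclinic orbit is exponentially small; together they are a negligible error.\<close>

lemma multi_orbit_near:
  assumes "i0 < m" "\<And>i. i < m \<Longrightarrow> i \<noteq> i0 \<Longrightarrow> int H \<le> \<bar>k - int (i * M)\<bar>"
  shows "norm (multi_orbit m M l k - (if i0 = l then - 1 else 1) *\<^sub>R homoclinic (k - int (i0 * M)))
    \<le> real m * (20 * (1 / 8) ^ H)"
proof -
  let ?h = "\<lambda>i. (if i = l then - 1 else 1 :: real) *\<^sub>R homoclinic (k - int (i * M))"
  have "multi_orbit m M l k = ?h i0 + (\<Sum>i\<in>{..<m} - {i0}. ?h i)"
    unfolding multi_orbit_def using assms(1) by (intro sum.remove) auto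
  then have "norm (multi_orbit m M l k - ?h i0) \<le> (\<Sum>i\<in>{..<m} - {i0}. norm (?h i))"
    by (simp only: add_diff_cancel_left' norm_sum)
  also have "\<dots> \<le> (\<Sum>i\<in>{..<m} - {i0}. 20 * (1 / 8) ^ H)"
  proof (rule sum_mono)
    fix i assume i: "i \<in> {..<m} - {i0}"
    have "norm (?h i) \<le> 20 * (1 / 8) ^ nat \<bar>k - int (i * M)\<bar>" using norm_homoclinic by auto
    also have "\<dots> \<le> 20 * (1 / 8) ^ H"
      using assms(2)[of i] i by (intro mult_left_mono power_decreasing) auto
    finally show "norm (?h i) \<le> 20 * (1 / 8) ^ H" .
  qed
  also have "\<dots> = real (card ({..<m} - {i0})) * (20 * (1 / 8) ^ H)" by simp
  also have "\<dots> \<le> real m * (20 * (1 / 8) ^ H)"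
    using card_mono[of "{..<m}" "{..<m} - {i0}"] by (intro mult_right_mono) auto
  finally show ?thesis .
qed

lemma separated_times:
  fixes k :: int
  assumes "i \<noteq> i'" "\<bar>k - int (i' * (2 * H))\<bar> < int H" shows "int H \<le> \<bar>k - int (i * (2 * H))\<bar>"
proof -
  have "1 \<le> \<bar>int i - int i'\<bar>" using assms(1) by auto
  then have "int (2 * H) * 1 \<le> int (2 * H) * \<bar>int i - int i'\<bar>" by (intro mult_left_mono) auto
  moreover have "int (2 * H) * (int i - int i') = int (i * (2 * H)) - int (i' * (2 * H))"
    by (simp add: algebra_simps)
  then have "int (2 * H) * \<bar>int i - int i'\<bar> = \<bar>int (i * (2 * H)) - int (i' * (2 * H))\<bar>"
    by (metis abs_mult abs_of_nat)
  ultimately have "int (2 * H) \<le> \<bar>int (i * (2 * H)) - int (i' * (2 * H))\<bar>" by linarith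
  then show ?thesis using assms(2) by linarith
qed

lemma nearest_time:
  fixes k :: int
  assumes "0 < m"
  obtains i0 where "i0 < m" "\<And>i. i < m \<Longrightarrow> i \<noteq> i0 \<Longrightarrow> int H \<le> \<bar>k - int (i * (2 * H))\<bar>"
proof (cases "\<exists>i'<m. \<bar>k - int (i' * (2 * H))\<bar> < int H")
  case True
  then show ?thesis using that separated_times by blast
next
  case False
  then show ?thesis using that[of 0] assms by force
qed

text \<open>Closeness in the pillowcase leaves a choice between two sheets. The next points are
  within \<open>\<eta> / 2\<close> by uniform continuity, so closeness to the wrong sheet would
  bring the point of the orbit of \<open>t\<close> within \<eta> of its own \<open>deck\<close>
  image.\<close>

lemma shadow_keeps_sheet:
  fixes f :: "complex \<times> complex \<Rightarrow> complex \<times> complex"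
  assumes f: "\<And>t. t \<in> torus \<Longrightarrow> f t \<in> torus"
    and unif: "\<And>t u. t \<in> torus \<Longrightarrow> u \<in> torus \<Longrightarrow> dist t u < \<beta> \<Longrightarrow> dist (f t) (f u) < \<eta> / 2"
    and \<beta>: "\<beta> \<le> \<eta> / 2"
    and near: "\<And>t u. t \<in> torus \<Longrightarrow> u \<in> torus \<Longrightarrow> dist (pproj t) (pproj u) < \<delta> \<Longrightarrow> dist t u < \<beta> \<or> dist t (deck u) < \<beta>"
    and t: "t \<in> torus" "u \<in> torus" "dist t u < \<beta>"
    and sep: "\<And>k. \<eta> \<le> dist ((f ^^ k) t) (deck ((f ^^ k) t))"
    and close: "\<And>k. dist (pproj ((f ^^ k) t)) (pproj ((f ^^ k) u)) < \<delta>"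
  shows "dist ((f ^^ k) t) ((f ^^ k) u) < \<beta>"
proof (induction k)
  case (Suc k)
  have fk: "(f ^^ k) v \<in> torus" if "v \<in> torus" for v k using that f by (induction k) auto
  let ?t = "(f ^^ Suc k) t" and ?u = "(f ^^ Suc k) u"
  have d: "dist ?t ?u < \<eta> / 2" using unif[OF fk fk Suc] t by simp
  have "dist ?t ?u < \<beta> \<or> dist ?t (deck ?u) < \<beta>" using near fk t close by blast
  moreover have "\<not> dist ?t (deck ?u) < \<beta>"
  proof
    assume "dist ?t (deck ?u) < \<beta>"
    moreover have "dist ?t (deck ?t) \<le> dist ?t (deck ?u) + dist (deck ?u) (deck ?t)"
      by (rule dist_triangle)
    ultimately have "dist ?t (deck ?t) < \<eta>" using d \<beta> by (simp add: dist_commute)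
    then show False using sep[of "Suc k"] by simp
  qed
  ultimately show ?case by blast
qed (use t in simp)

text \<open>Both sequences follow \<open>cat\<close> modulo \<open>lat4\<close>. A coincidence at
  time 0 can thus be examined at the time of any excursion, where a flipped sign shows.\<close>

lemma multi_orbit_rel_step:
  assumes "x \<in> lat4" "multi_orbit m M l 0 = s *\<^sub>R multi_orbit m M l' 0 + x" "s = 1 \<or> s = - 1"
  shows "\<exists>y\<in>lat4. multi_orbit m M l (int n) = s *\<^sub>R multi_orbit m M l' (int n) + y"
proof (induction n)
  case 0
  then show ?case using assms(1,2) by auto
next
  case (Suc n)
  then obtain y where y: "y \<in> lat4" "multi_orbit m M l (int n) = s *\<^sub>R multi_orbit m M l' (int n) + y" by blast
  obtain p where p: "p \<in> lat4" "cat (multi_orbit m M l (int n)) = multi_orbit m M l (int n + 1) + p"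
    using cat_multi_orbit by blast
  obtain q where q: "q \<in> lat4" "cat (multi_orbit m M l' (int n)) = multi_orbit m M l' (int n + 1) + q"
    using cat_multi_orbit by blast
  have "cat (multi_orbit m M l (int n)) = s *\<^sub>R cat (multi_orbit m M l' (int n)) + cat y"
    unfolding y(2) using linear_cat by (simp add: linear_add linear_scale)
  then have "multi_orbit m M l (int n + 1) = s *\<^sub>R multi_orbit m M l' (int n + 1) + (s *\<^sub>R q + cat y - p)"
    unfolding p(2) q(2) by (simp add: scaleR_add_right algebra_simps)
  moreover have "s *\<^sub>R q + cat y - p \<in> lat4"
    using assms(3) p(1) q(1) cat_lat4[OF y(1)] by (auto intro!: lat4_diff lat4_add lat4_uminus)
  ultimately show ?case by (auto simp: add.commute)
qed

text \<open>If the lifts agree with equal signs, consider excursion \<open>l\<close>, flipped in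
  only one of the two; with opposite signs, consider a third excursion, flipped in neither, which is
  where \<open>3 \<le> m\<close> enters. Either way twice \<open>homoclinic 0\<close> would be too
  close to the lattice.\<close>

lemma multi_orbit_distinct:
  assumes "3 \<le> m" "l < m" "l' < m" "l \<noteq> l'" "0 < H" "real m * (20 * (1 / 8) ^ H) < 2 / 5"
  shows "pillow (multi_orbit m (2 * H) l 0) \<noteq> pillow (multi_orbit m (2 * H) l' 0)"
proof
  let ?o = "multi_orbit m (2 * H)"
  assume "pillow (?o l 0) = pillow (?o l' 0)"
  then obtain x where x: "x \<in> lat4" "?o l 0 = ?o l' 0 + x \<or> ?o l 0 = - ?o l' 0 + x" unfolding pillow_eq_iff by blast
  have near: "norm (?o a (int (i * (2 * H))) - (if i = a then - 1 else 1) *\<^sub>R homoclinic 0) < 2 / 5" if "i < m" for i a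
  proof -
    have "int H \<le> \<bar>int (i * (2 * H)) - int (i' * (2 * H))\<bar>" if "i' \<noteq> i" for i'
      using separated_times[of i' i "int (i * (2 * H))" H] that assms(5) by auto
    then show ?thesis using multi_orbit_near[OF that, of H "int (i * (2 * H))" "2 * H" a] assms(6) by fastforce
  qed
  from x(2) show False
  proof
    assume "?o l 0 = ?o l' 0 + x"
    then obtain y where y: "y \<in> lat4" "?o l (int (l * (2 * H))) = ?o l' (int (l * (2 * H))) + y"
      using multi_orbit_rel_step[OF x(1), of m "2 * H" l 1 l' "l * (2 * H)"] by auto
    have "2 *\<^sub>R homoclinic 0 - (- y) = (?o l (int (l * (2 * H))) - (- 1) *\<^sub>R homoclinic 0) - (?o l' (int (l * (2 * H))) - homoclinic 0)"
      unfolding y(2) by (simp add: scaleR_2)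
    then have "norm (2 *\<^sub>R homoclinic 0 - (- y)) < 4 / 5"
      using near[OF assms(2), of l] near[OF assms(2), of l'] assms(4)
        norm_triangle_ineq4[of "?o l (int (l * (2 * H))) - (- 1) *\<^sub>R homoclinic 0" "?o l' (int (l * (2 * H))) - homoclinic 0"]
      by simp
    then show False using double_homoclinic_far_from_lat4[OF lat4_uminus[OF y(1)]] by simp
  next
    assume "?o l 0 = - ?o l' 0 + x"
    then have e: "\<exists>y\<in>lat4. ?o l (int n) = - ?o l' (int n) + y" for n
      using multi_orbit_rel_step[OF x(1), of m "2 * H" l "- 1" l' n] by auto
    have "\<exists>i<m. i \<noteq> l \<and> i \<noteq> l'"
    proof (rule ccontr)
      assume "\<not> ?thesis"
      then have "{..<m} \<subseteq> {l, l'}" by auto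
      then have "m \<le> card {l, l'}" using card_mono[of "{l, l'}" "{..<m}"] by simp
      then show False using assms(1) by (simp add: card_insert_if split: if_splits)
    qed
    then obtain i where i: "i < m" "i \<noteq> l" "i \<noteq> l'" by blast
    obtain y where y: "y \<in> lat4" "?o l (int (i * (2 * H))) = - ?o l' (int (i * (2 * H))) + y" using e by blast
    have "2 *\<^sub>R homoclinic 0 - y = - ((?o l (int (i * (2 * H))) - homoclinic 0) + (?o l' (int (i * (2 * H))) - homoclinic 0))"
      unfolding y(2) by (simp add: scaleR_2)
    then have "norm (2 *\<^sub>R homoclinic 0 - y) < 4 / 5"
      using near[OF i(1), of l] near[OF i(1), of l'] i(2,3)
        norm_triangle_ineq[of "?o l (int (i * (2 * H))) - homoclinic 0" "?o l' (int (i * (2 * H))) - homoclinic 0"]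
      by (simp only: norm_minus_cancel) simp
    then show False using double_homoclinic_far_from_lat4[OF y(1)] by simp
  qed
qed

lemma not_expansive_twist: "\<not> expansive N torus twist"
proof
  assume "expansive N torus twist"
  then obtain \<alpha> where \<alpha>: "\<alpha> > 0" "\<And>x. x \<in> torus \<Longrightarrow>
      finite (dynamical_ball torus twist \<alpha> x) \<and> card (dynamical_ball torus twist \<alpha> x) \<le> N"
    unfolding expansive_def by blast
  \<comment> \<open>More than \<open>N\<close> orbits, and at least the three excursions that
    distinctness requires.\<close>
  define m where "m = N + 3"
  obtain \<zeta> where \<zeta>: "\<zeta> > 0" "\<And>j c. c \<in> branch_vals \<Longrightarrow> \<zeta> \<le> dist (pillow (homoclinic j)) c"
    using homoclinic_away_from_branch by blast
  obtain \<eta> where \<eta>: "\<eta> > 0" "\<And>t. t \<in> torus \<Longrightarrow> dist t (deck t) < \<eta> \<Longrightarrow>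
      \<exists>c\<in>branch_vals. dist (pproj t) c < \<zeta> / 2"
    using pproj_near_branch[of "\<zeta> / 2"] \<zeta>(1) by auto
  have "uniformly_continuous_on torus twist" "uniformly_continuous_on torus untwist"
    using continuous_twist continuous_untwist compact_torus by (auto intro: compact_uniformly_continuous)
  then obtain \<beta>1 \<beta>2 where \<beta>12: "\<beta>1 > 0" "\<beta>2 > 0"
    "\<And>t u. t \<in> torus \<Longrightarrow> u \<in> torus \<Longrightarrow> dist t u < \<beta>1 \<Longrightarrow> dist (twist t) (twist u) < \<eta> / 2"
    "\<And>t u. t \<in> torus \<Longrightarrow> u \<in> torus \<Longrightarrow> dist t u < \<beta>2 \<Longrightarrow> dist (untwist t) (untwist u) < \<eta> / 2"
    unfolding uniformly_continuous_on_def using \<eta>(1) half_gt_zero dist_commute by metis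
  define \<beta> where "\<beta> = min (min \<beta>1 \<beta>2) (min (\<eta> / 2) \<alpha>)"
  have \<beta>: "\<beta> > 0" "\<beta> \<le> \<beta>1" "\<beta> \<le> \<beta>2" "\<beta> \<le> \<eta> / 2" "\<beta> \<le> \<alpha>" using \<alpha>(1) \<eta>(1) \<beta>12(1,2) by (auto simp: \<beta>_def)
  obtain \<delta> where \<delta>: "\<delta> > 0" "\<And>t u. t \<in> torus \<Longrightarrow> u \<in> torus \<Longrightarrow> dist (pproj t) (pproj u) < \<delta> \<Longrightarrow>
      dist t u < \<beta> \<or> dist t (deck u) < \<beta>"
    using pproj_near[OF \<beta>(1)] by blast
  define \<delta>0 where "\<delta>0 = min (\<delta> / 2) (\<zeta> / 2)"
  have \<delta>0: "\<delta>0 > 0" "\<delta>0 \<le> \<delta> / 2" "\<delta>0 \<le> \<zeta> / 2" using \<delta>(1) \<zeta>(1) by (auto simp: \<delta>0_def)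
  obtain \<rho> where \<rho>: "\<rho> > 0" "\<And>a b. norm (a - b) < \<rho> \<Longrightarrow> dist (pillow a) (pillow b) < \<delta>0"
    using pillow_uniform[OF \<delta>0(1)] by blast
  \<comment> \<open>The error of the excursion sums has to be below \<rho> for shadowing and below
    2/5 for distinctness; passing to \<open>Suc H0\<close> makes \<open>H\<close> positive.\<close>
  have "0 < min \<rho> (2 / 5) / (20 * real m)" using \<rho>(1) by (simp add: m_def)
  then obtain H0 where "(1 / 8) ^ H0 < min \<rho> (2 / 5) / (20 * real m)"
    using real_arch_pow_inv[of "min \<rho> (2 / 5) / (20 * real m)" "1 / 8"] by auto
  moreover have "(1 / 8 :: real) ^ Suc H0 \<le> (1 / 8) ^ H0" by (intro power_decreasing) auto
  ultimately have "(1 / 8) ^ Suc H0 < min \<rho> (2 / 5) / (20 * real m)" by linarith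
  then have H: "real m * (20 * (1 / 8) ^ Suc H0) < min \<rho> (2 / 5)"
    by (simp add: m_def field_simps)
  define H where "H = Suc H0"
  define orb where "orb = multi_orbit m (2 * H)"
  have near: "\<exists>j. \<forall>l. dist (pillow (orb l k)) (pillow (homoclinic j)) < \<delta>0" for k
  proof -
    obtain i0 where i0: "i0 < m" "\<And>i. i < m \<Longrightarrow> i \<noteq> i0 \<Longrightarrow> int H \<le> \<bar>k - int (i * (2 * H))\<bar>"
      using nearest_time[of m H k] by (auto simp: m_def)
    have "dist (pillow (orb l k)) (pillow (homoclinic (k - int (i0 * (2 * H))))) < \<delta>0" for l
    proof -
      have "norm (orb l k - (if i0 = l then - 1 else 1) *\<^sub>R homoclinic (k - int (i0 * (2 * H)))) < \<rho>"
        using multi_orbit_near[OF i0, of l] H unfolding orb_def H_def[symmetric] by linarith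
      then have "dist (pillow (orb l k)) (pillow ((if i0 = l then - 1 else 1) *\<^sub>R homoclinic (k - int (i0 * (2 * H))))) < \<delta>0"
        by (rule \<rho>(2))
      then show ?thesis by (simp split: if_splits)
    qed
    then show ?thesis by blast
  qed
  have close: "dist (pillow (orb l k)) (pillow (orb l' k)) < \<delta>" for l l' k
  proof -
    obtain j where "\<And>l. dist (pillow (orb l k)) (pillow (homoclinic j)) < \<delta>0" using near[of k] by blast
    from this[of l] this[of l'] show ?thesis
      using dist_triangle2[of "pillow (orb l k)" "pillow (orb l' k)" "pillow (homoclinic j)"] \<delta>0(2) by linarith
  qed
  have sep: "\<eta> \<le> dist t (deck t)" if orb: "t \<in> torus" "pproj t = pillow (orb l k)" for t l k
  proof (rule ccontr)
    assume "\<not> ?thesis"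
    then obtain c where c: "c \<in> branch_vals" "dist (pillow (orb l k)) c < \<zeta> / 2" using \<eta>(2)[of t] orb by auto
    obtain j where "dist (pillow (orb l k)) (pillow (homoclinic j)) < \<delta>0" using near[of k] by blast
    then have "dist (pillow (homoclinic j)) c < \<zeta>"
      using dist_triangle3[of "pillow (homoclinic j)" c "pillow (orb l k)"] c(2) \<delta>0(3) by linarith
    then show False using \<zeta>(2)[OF c(1), of j] by simp
  qed
  \<comment> \<open>The index \<open>m\<close> is out of range, so no excursion of the central orbit
    is flipped. The orbits with index below \<open>m\<close> will fill its dynamical ball.\<close>
  obtain t where t: "t \<in> torus" "pproj t = pillow (orb m 0)" using pillow_pproj by blast
  have "\<exists>u\<in>torus. pproj u = pillow (orb l 0) \<and> dist t u < \<beta>" for l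
  proof -
    obtain u where u: "u \<in> torus" "pproj u = pillow (orb l 0)" using pillow_pproj by blast
    have "dist (pproj t) (pproj u) < \<delta>" using close t u by simp
    then have "dist t u < \<beta> \<or> dist t (deck u) < \<beta>" using \<delta>(2) t u by blast
    \<comment> \<open>Of the two preimages the one on the sheet of \<open>t\<close> is taken; both
      have the same projection.\<close>
    then show ?thesis using u pproj_deck[OF u(1)] deck_in_torus[of u] by metis
  qed
  then obtain u where u: "\<And>l. u l \<in> torus" "\<And>l. pproj (u l) = pillow (orb l 0)" "\<And>l. dist t (u l) < \<beta>" by metis
  note orbit = pproj_twist_orbit[where M = "2 * H" and m = m, folded orb_def]
  have fwd: "dist ((twist ^^ k) t) ((twist ^^ k) (u l)) < \<beta>" for k l
  proof (rule shadow_keeps_sheet[where \<eta> = \<eta> and \<delta> = \<delta>])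
    show "dist (twist v) (twist w) < \<eta> / 2" if "v \<in> torus" "w \<in> torus" "dist v w < \<beta>" for v w
      using that \<beta>(2) by (intro \<beta>12(3)) auto
    show "\<eta> \<le> dist ((twist ^^ k) t) (deck ((twist ^^ k) t))" for k
      using sep funpow_twist_in_torus orbit(1) t by blast
    show "dist (pproj ((twist ^^ k) t)) (pproj ((twist ^^ k) (u l))) < \<delta>" for k
      using close orbit(1) t u by simp
  qed (use twist_in_torus \<beta>(4) \<delta>(2) t u in auto)
  have bwd: "dist ((untwist ^^ k) t) ((untwist ^^ k) (u l)) < \<beta>" for k l
  proof (rule shadow_keeps_sheet[where \<eta> = \<eta> and \<delta> = \<delta>])
    show "dist (untwist v) (untwist w) < \<eta> / 2" if "v \<in> torus" "w \<in> torus" "dist v w < \<beta>" for v w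
      using that \<beta>(3) by (intro \<beta>12(4)) auto
    show "\<eta> \<le> dist ((untwist ^^ k) t) (deck ((untwist ^^ k) t))" for k
      using sep funpow_untwist_in_torus orbit(2) t by blast
    show "dist (pproj ((untwist ^^ k) t)) (pproj ((untwist ^^ k) (u l))) < \<delta>" for k
      using close orbit(2) t u by simp
  qed (use untwist_in_torus \<beta>(4) \<delta>(2) t u in auto)
  have "u l \<in> dynamical_ball torus twist \<alpha> t" for l
  proof -
    have "dist (iterate torus twist k t) (iterate torus twist k (u l)) \<le> \<alpha>" for k
    proof (cases k rule: int_cases2)
      case (nonneg n)
      then show ?thesis using fwd[of n l] \<beta>(5) by simp
    next
      case (nonpos n)
      then show ?thesis using bwd[of n l] \<beta>(5) t(1) u(1) by (simp add: iterate_twist_neg)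
    qed
    then show ?thesis using u(1) by (simp add: dynamical_ball_def)
  qed
  then have sub: "u ` {..<m} \<subseteq> dynamical_ball torus twist \<alpha> t" by blast
  have "inj_on u {..<m}"
  proof (rule inj_onI, rule ccontr)
    fix l l' assume l: "l \<in> {..<m}" "l' \<in> {..<m}" "u l = u l'" "l \<noteq> l'"
    then have "pillow (orb l 0) = pillow (orb l' 0)" using u(2) by metis
    moreover have "pillow (orb l 0) \<noteq> pillow (orb l' 0)"
      unfolding orb_def using l H by (intro multi_orbit_distinct) (auto simp: m_def H_def)
    ultimately show False by blast
  qed
  then have "card (u ` {..<m}) = N + 3" by (simp add: card_image m_def)
  moreover have "card (u ` {..<m}) \<le> N"
    using \<alpha>(2)[OF t(1)] card_mono[OF _ sub] by linarith
  ultimately show False by simp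
qed

theorem proposition3p2:
  "\<exists>(f :: complex \<times> complex \<Rightarrow> complex \<times> complex) g.
     homeomorphism torus torus f g \<and>
     cw_expansive 2 torus f \<and>
     (\<exists>p. one_prong torus f p) \<and>
     (\<forall>N\<ge>1. \<not> expansive N torus f)"
  using homeomorphism_twist cw_expansive_twist one_prong_twist not_expansive_twist by blast

end
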